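(* Let $\mathfrak{t}$ be a fat $3$-seedling. Then one of the following holds: (i) $\mathfrak{t}$ is isomorphic to one of the following five Hoffman graphs: the Hoffman graph with one slim vertex and three fat neighbours; $\mathfrak{c}_2$; the Hoffman graph with one fat vertex $f$ and three slim vertices each adjacent only to $f$; the Hoffman graph with slim vertices $x,y,z$, fat vertices $f,g$ and edges exactly $xf,fy,yg,gz$; $\mathfrak{c}_3$. (ii) The special graph $\mathcal{S}(\mathfrak{t})$ is switching equivalent to $\widetilde{E}_6$, $\widetilde{E}_7$ or $\widetilde{E}_8$ (with all edges of one sign), and no two $(-)$-edges of $\mathcal{S}(\mathfrak{t})$ share a vertex.
   Context: A Hoffman graph $\mathfrak{h}$ is a finite simple graph $H$ whose vertices are labelled slim or fat, such that every fat vertex is adjacent to at least one slim vertex and fat vertices are pairwise nonadjacent; $V_s(\mathfrak{h})$ is the slim vertex set. $\mathfrak{h}$ is fat if every slim vertex has a fat neighbour; tree-like if $H$ is a tree. An induced Hoffman subgraph is an induced subgraph of $H$ with inherited labels; isomorphisms are label-preserving. The special matrix is $Sp(\mathfrak{h})=A_s-CC^T$ where $\begin{pmatrix}A_s&C\\C^T&0\end{pmatrix}$ is the adjacency matrix of $H$ with fat vertices last; $\lambda_{\min}(\mathfrak{h})$ is its smallest eigenvalue. The special graph $\mathcal{S}(\mathfrak{h})$ is the edge-signed graph on $V_s(\mathfrak{h})$ in which distinct $x,y$ are joined by a $(+)$-edge if $Sp(\mathfrak{h})_{xy}>0$, by a $(-)$-edge if $Sp(\mathfrak{h})_{xy}<0$,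 and not joined otherwise. Switching at a vertex changes the sign of all edges at it; two edge-signed graphs are switching equivalent if one is isomorphic to a graph obtained from the other by switching at a set of vertices. $\mathfrak{h}$ is a direct sum of $\mathfrak{h}^1,\mathfrak{h}^2$ if there is a partition $\{V^1,V^2\}$ of $V_s(\mathfrak{h})$ such that the induced Hoffman subgraph on $V^i$ plus all fat vertices adjacent to $V^i$ is $\mathfrak{h}^i$ and $Sp(\mathfrak{h})$ is block diagonal w.r.t. the partition. For real $\mu\le-1$ and $\lambda_{\min}(\mathfrak{h})\ge\mu$: $\mathfrak{h}$ is $\mu$-reducible if there is a Hoffman graph $\widetilde{\mathfrak{h}}$ containing $\mathfrak{h}$ as an induced Hoffman subgraph with $\widetilde{\mathfrak{h}}=\widetilde{\mathfrak{h}}_1\oplus\widetilde{\mathfrak{h}}_2$, $\lambda_{\min}(\widetilde{\mathfrak{h}}_i)\ge\mu$ and $V_s(\widetilde{\mathfrak{h}}_i)\cap V_s(\mathfrak{h})\neq\emptyset$ for $i=1,2$; otherwise $\mu$-irreducible. For $\mu>0$, a $\mu$-seedling is a tree-like Hoffman graph $\mathfrak{t}$ with $\lambda_{\min}(\mathfrak{t})\ge-\mu$ which is $(-\mu)$-irreducible and is not a proper induced Hoffman subgraph of any $(-\mu)$-irreducible tree-like Hoffman graph. $\mathfrak{c}_m$ ($m\ge2$): slim $y_1,\ldots,y_m$, fat $f_1,f_{1,2},f_m$, edges exactly $y_iy_{i+2}$ ($1\le i\le m-2$), $f_1y_1,f_{1,2}y_1,f_{1,2}y_2,f_my_m$. $\widetilde{E}_6,\widetilde{E}_7,\widetilde{E}_8$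 are the trees consisting of a central vertex with three pendant paths of lengths $(2,2,2)$, $(1,3,3)$, $(1,2,5)$ respectively. *)

theory Defs
  imports "HOL-Analysis.Analysis"
begin

section \<open>Hoffman graphs\<close>

record 'a hoffman_graph =
  slim :: "'a set"
  fat :: "'a set"
  adj :: "'a \<Rightarrow> 'a \<Rightarrow> bool"

definition verts :: "'a hoffman_graph \<Rightarrow> 'a set" where
  "verts h = slim h \<union> fat h"

text \<open>Adjacency is false outside the vertex set, so that equality of records is equality of
  labelled graphs.\<close>

definition hoffman :: "'a hoffman_graph \<Rightarrow> bool" where
  "hoffman h \<longleftrightarrow>
     finite (slim h) \<and> finite (fat h) \<and> slim h \<inter> fat h = {} \<and>
     (\<forall>x y. adj h x y \<longrightarrow> x \<in> verts h \<and> y \<in> verts h) \<and>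
     (\<forall>x y. adj h x y \<longrightarrow> adj h y x) \<and>
     (\<forall>x. \<not> adj h x x) \<and>
     (\<forall>f\<in>fat h. \<exists>x\<in>slim h. adj h f x) \<and>
     (\<forall>f\<in>fat h. \<forall>g\<in>fat h. \<not> adj h f g)"

definition fat_hoffman :: "'a hoffman_graph \<Rightarrow> bool" where
  "fat_hoffman h \<longleftrightarrow> hoffman h \<and> (\<forall>x\<in>slim h. \<exists>f\<in>fat h. adj h x f)"

text \<open>A cycle is given by the list of its (at least three) vertices.\<close>

definition has_cycle :: "'a hoffman_graph \<Rightarrow> bool" where
  "has_cycle h \<longleftrightarrow>
     (\<exists>xs. length xs \<ge> 3 \<and> distinct xs \<and> successively (adj h) xs \<and> adj h (last xs) (hd xs))"

definition tree_like :: "'a hoffman_graph \<Rightarrow> bool" where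
  "tree_like h \<longleftrightarrow>
     hoffman h \<and> verts h \<noteq> {} \<and>
     (\<forall>x\<in>verts h. \<forall>y\<in>verts h. (adj h)\<^sup>*\<^sup>* x y) \<and> \<not> has_cycle h"

definition induced :: "'a hoffman_graph \<Rightarrow> 'a set \<Rightarrow> 'a hoffman_graph" where
  "induced h U =
     \<lparr>slim = slim h \<inter> U, fat = fat h \<inter> U, adj = (\<lambda>x y. adj h x y \<and> x \<in> U \<and> y \<in> U)\<rparr>"

definition hoffman_iso :: "('a \<Rightarrow> 'b) \<Rightarrow> 'a hoffman_graph \<Rightarrow> 'b hoffman_graph \<Rightarrow> bool" where
  "hoffman_iso \<phi> h h' \<longleftrightarrow>
     bij_betw \<phi> (verts h) (verts h') \<and> \<phi> ` slim h = slim h' \<and> \<phi> ` fat h = fat h' \<and>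
     (\<forall>x\<in>verts h. \<forall>y\<in>verts h. adj h x y \<longleftrightarrow> adj h' (\<phi> x) (\<phi> y))"

definition hoffman_isomorphic :: "'a hoffman_graph \<Rightarrow> 'b hoffman_graph \<Rightarrow> bool" where
  "hoffman_isomorphic h h' \<longleftrightarrow> (\<exists>\<phi>. hoffman_iso \<phi> h h')"

definition hoffman_embedding :: "('a \<Rightarrow> 'b) \<Rightarrow> 'a hoffman_graph \<Rightarrow> 'b hoffman_graph \<Rightarrow> bool" where
  "hoffman_embedding \<phi> h h' \<longleftrightarrow>
     \<phi> ` verts h \<subseteq> verts h' \<and> hoffman_iso \<phi> h (induced h' (\<phi> ` verts h))"


section \<open>The special matrix and the smallest eigenvalue\<close>

text \<open>Matrices with rows and columns indexed by a finite set \<open>S\<close> are functions of two arguments;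
  the values outside \<open>S\<close> are irrelevant.\<close>

definition adj_matrix :: "'a hoffman_graph \<Rightarrow> 'a \<Rightarrow> 'a \<Rightarrow> real" where
  "adj_matrix h x y = (if adj h x y then 1 else 0)"

definition Sp :: "'a hoffman_graph \<Rightarrow> 'a \<Rightarrow> 'a \<Rightarrow> real" where
  "Sp h x y = adj_matrix h x y - (\<Sum>f\<in>fat h. adj_matrix h x f * adj_matrix h y f)"

definition eigenvalue_on :: "'a set \<Rightarrow> ('a \<Rightarrow> 'a \<Rightarrow> real) \<Rightarrow> real \<Rightarrow> bool" where
  "eigenvalue_on S M \<theta> \<longleftrightarrow>
     (\<exists>v. (\<exists>x\<in>S. v x \<noteq> 0) \<and> (\<forall>x\<in>S. (\<Sum>y\<in>S. M x y * v y) = \<theta> * v x))"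

text \<open>Meaningful when there is a slim vertex, that is, for nonempty Hoffman graphs.\<close>

definition lambda_min :: "'a hoffman_graph \<Rightarrow> real" where
  "lambda_min h = Min {\<theta>. eigenvalue_on (slim h) (Sp h) \<theta>}"


section \<open>Direct sums, irreducibility and seedlings\<close>

definition fat_nbrs :: "'a hoffman_graph \<Rightarrow> 'a set \<Rightarrow> 'a set" where
  "fat_nbrs h V = {f \<in> fat h. \<exists>x\<in>V. adj h x f}"

definition direct_sum :: "'a hoffman_graph \<Rightarrow> 'a hoffman_graph \<Rightarrow> 'a hoffman_graph \<Rightarrow> bool" where
  "direct_sum h h1 h2 \<longleftrightarrow>
     (\<exists>V1 V2. V1 \<noteq> {} \<and> V2 \<noteq> {} \<and> V1 \<inter> V2 = {} \<and> V1 \<union> V2 = slim h \<and>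
        h1 = induced h (V1 \<union> fat_nbrs h V1) \<and> h2 = induced h (V2 \<union> fat_nbrs h V2) \<and>
        (\<forall>x\<in>V1. \<forall>y\<in>V2. Sp h x y = 0 \<and> Sp h y x = 0))"

text \<open>Larger Hoffman graphs are quantified over the vertex type \<^typ>\<open>nat\<close>, and
  \<open>h\<close> is contained in them through an embedding. As all graphs are finite, this
  covers, up to isomorphism, all Hoffman graphs containing \<open>h\<close>.\<close>

definition reducible :: "real \<Rightarrow> 'a hoffman_graph \<Rightarrow> bool" where
  "reducible \<mu> h \<longleftrightarrow>
     (\<exists>(h' :: nat hoffman_graph) \<phi> h1 h2.
        hoffman h' \<and> hoffman_embedding \<phi> h h' \<and> direct_sum h' h1 h2 \<and>
        lambda_min h1 \<ge> \<mu> \<and> lambda_min h2 \<ge> \<mu> \<and>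
        slim h1 \<inter> \<phi> ` slim h \<noteq> {} \<and> slim h2 \<inter> \<phi> ` slim h \<noteq> {})"

text \<open>The notion only applies when \<open>\<mu> \<le> -1\<close> and \<open>\<mu>\<close> is a lower bound for the smallest eigenvalue.\<close>

definition irreducible_hoffman :: "real \<Rightarrow> 'a hoffman_graph \<Rightarrow> bool" where
  "irreducible_hoffman \<mu> h \<longleftrightarrow>
     hoffman h \<and> \<mu> \<le> -1 \<and> lambda_min h \<ge> \<mu> \<and> \<not> reducible \<mu> h"

definition seedling :: "real \<Rightarrow> 'a hoffman_graph \<Rightarrow> bool" where
  "seedling \<mu> t \<longleftrightarrow>
     \<mu> > 0 \<and> tree_like t \<and> lambda_min t \<ge> - \<mu> \<and> irreducible_hoffman (- \<mu>) t \<and>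
     \<not> (\<exists>(h :: nat hoffman_graph) \<phi>.
          tree_like h \<and> irreducible_hoffman (- \<mu>) h \<and>
          hoffman_embedding \<phi> t h \<and> \<phi> ` verts t \<noteq> verts h)"


section \<open>Edge-signed graphs and switching\<close>

text \<open>The sign is \<open>1\<close> on \<open>(+)\<close>-edges, \<open>-1\<close> on \<open>(-)\<close>-edges and \<open>0\<close> on pairs that are not
  edges.\<close>

record 'a signed_graph =
  sverts :: "'a set"
  sgnf :: "'a \<Rightarrow> 'a \<Rightarrow> int"

definition signed_isomorphic :: "'a signed_graph \<Rightarrow> 'b signed_graph \<Rightarrow> bool" where
  "signed_isomorphic G G' \<longleftrightarrow>
     (\<exists>\<phi>. bij_betw \<phi> (sverts G) (sverts G') \<and>
        (\<forall>x\<in>sverts G. \<forall>y\<in>sverts G. sgnf G x y = sgnf G' (\<phi> x) (\<phi> y)))"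

text \<open>Switching at every vertex of \<open>U\<close>: an edge with both ends in \<open>U\<close> changes its sign twice.\<close>

definition switch :: "'a set \<Rightarrow> 'a signed_graph \<Rightarrow> 'a signed_graph" where
  "switch U G =
     \<lparr>sverts = sverts G,
      sgnf = (\<lambda>x y. (if x \<in> U then -1 else 1) * (if y \<in> U then -1 else 1) * sgnf G x y)\<rparr>"

definition switching_equivalent :: "'a signed_graph \<Rightarrow> 'b signed_graph \<Rightarrow> bool" where
  "switching_equivalent G G' \<longleftrightarrow> (\<exists>U \<subseteq> sverts G. signed_isomorphic (switch U G) G')"

definition special_graph :: "'a hoffman_graph \<Rightarrow> 'a signed_graph" where
  "special_graph h =
     \<lparr>sverts = slim h,
      sgnf = (\<lambda>x y. if x \<in> slim h \<and> y \<in> slim h \<and> x \<noteq> y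
                    then if Sp h x y > 0 then 1 else if Sp h x y < 0 then -1 else 0
                    else 0)\<rparr>"


section \<open>The particular graphs\<close>

definition mk_hoffman :: "'a set \<Rightarrow> 'a set \<Rightarrow> ('a \<times> 'a) set \<Rightarrow> 'a hoffman_graph" where
  "mk_hoffman S F E = \<lparr>slim = S, fat = F, adj = (\<lambda>x y. (x, y) \<in> E \<or> (y, x) \<in> E)\<rparr>"

datatype c_vertex = Y nat | F1 | F12 | FM

definition c_graph :: "nat \<Rightarrow> c_vertex hoffman_graph" where
  "c_graph m = mk_hoffman (Y ` {1..m}) {F1, F12, FM}
     ({(Y i, Y (i + 2)) | i. 1 \<le> i \<and> i + 2 \<le> m} \<union>
      {(F1, Y 1), (F12, Y 1), (F12, Y 2), (FM, Y m)})"

definition slim1_fat3 :: "nat hoffman_graph" where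
  "slim1_fat3 = mk_hoffman {0} {1, 2, 3} {(0, 1), (0, 2), (0, 3)}"

definition fat1_slim3 :: "nat hoffman_graph" where
  "fat1_slim3 = mk_hoffman {1, 2, 3} {0} {(0, 1), (0, 2), (0, 3)}"

text \<open>The path \<open>x f y g z\<close> with \<open>x, y, z = 0, 2, 4\<close> slim and \<open>f, g = 1, 3\<close> fat.\<close>

definition path_xfygz :: "nat hoffman_graph" where
  "path_xfygz = mk_hoffman {0, 2, 4} {1, 3} {(0, 1), (1, 2), (2, 3), (3, 4)}"

text \<open>Centre \<open>(0, 0)\<close>; the vertices of the \<open>i\<close>-th pendant path, of length \<open>ls ! i\<close>, are
  \<open>(i, 1), \<dots>, (i, ls ! i)\<close>, in order of their distance from the centre. All edges have the
  sign \<open>s\<close>.\<close>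

definition star_like_edges :: "nat list \<Rightarrow> ((nat \<times> nat) \<times> (nat \<times> nat)) set" where
  "star_like_edges ls =
     {((0, 0), (i, 1)) | i. i < length ls \<and> 1 \<le> ls ! i} \<union>
     {((i, j), (i, j + 1)) | i j. i < length ls \<and> 1 \<le> j \<and> j + 1 \<le> ls ! i}"

definition star_like_tree :: "int \<Rightarrow> nat list \<Rightarrow> (nat \<times> nat) signed_graph" where
  "star_like_tree s ls =
     \<lparr>sverts = {(0, 0)} \<union> {(i, j) | i j. i < length ls \<and> 1 \<le> j \<and> j \<le> ls ! i},
      sgnf = (\<lambda>u v. if (u, v) \<in> star_like_edges ls \<or> (v, u) \<in> star_like_edges ls
                    then s else 0)\<rparr>"

definition E6_tilde :: "int \<Rightarrow> (nat \<times> nat) signed_graph" where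
  "E6_tilde s = star_like_tree s [2, 2, 2]"

definition E7_tilde :: "int \<Rightarrow> (nat \<times> nat) signed_graph" where
  "E7_tilde s = star_like_tree s [1, 3, 3]"

definition E8_tilde :: "int \<Rightarrow> (nat \<times> nat) signed_graph" where
  "E8_tilde s = star_like_tree s [1, 2, 5]"

end

theory Submission
  imports Defs
begin

text \<open>Let \<open>M = Sp + 3 I\<close>, a positive semidefinite form on the slim vertices with diagonal entries
  \<open>0\<close>, \<open>1\<close>, \<open>2\<close> (three minus the number of fat neighbours) and off-diagonal entries \<open>-1\<close>, \<open>0\<close>, \<open>1\<close>. Being a
  seedling has two consequences for \<open>M\<close>. First, \<open>v\<^sup>T M v \<ge> v\<^sub>x\<^sup>2 / 3\<close> fails at every slim vertex \<open>x\<close>: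
  otherwise a pendant slim or fat vertex could be attached at \<open>x\<close>. Second, if
  \<open>v\<^sup>T M v \<ge> (\<Sum>\<^sub>W v)\<^sup>2\<close> for a set \<open>W\<close> of slim vertices, then a new fat vertex with neighbourhood \<open>W\<close> does
  not disconnect the special graph.

  If three slim vertices share a fat neighbour, then they carry a null vector and are all the slim
  vertices. Otherwise the special graph is a tree, and a positive null vector (up to switching) on a
  subtree forces the subtree to be everything. A diagonal entry \<open>0\<close> or \<open>1\<close> leads to the small graphs.
  If all diagonal entries are \<open>2\<close>, then \<open>M\<close> is, up to switching, twice the identity minus the adjacency
  matrix of the tree, which is thus one of the simply laced Dynkin diagrams of finite or affine type.
  Maximality excludes the finite types (some diagonal entry of the inverse is at most \<open>2\<close>), and
  irreducibility excludes a vertex with two leaves in a tree with more than three vertices, hence the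
  affine \<open>D\<close> types; this is carried out along a longest path.\<close>

section \<open>Quadratic forms on a finite set\<close>

text \<open>The constant 1/3 is a Schur complement: a new slim vertex without fat neighbours has
  diagonal entry 3 in \<open>Sp + 3 I\<close>, and eliminating it costs v_x^2 / 3. The obstacle is
  that maximality speaks only of irreducible extensions, so a semidefinite extended form is not
  enough. A pendant fat vertex leaves the slim set unchanged and cannot create a splitting. A
  pendant slim vertex may split off, but only if \<open>x\<close> has a private fat neighbour in
  some larger graph, and then a pendant fat vertex could have been attached instead.

  The tree structure enters as \<open>attach\<close>: a vertex outside a connected set is joined to
  at most one vertex of it. So trees are grown vertex by vertex, and only the wanted edges have to
  be exhibited.

  No infinite family of affine D diagrams has to be treated: forks next to the ends of a longest
  path are impossible by irreducibility, so a branch lies at distance at least two from both ends,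
  and this contains an affine E diagram unless the path has at most seven vertices.\<close>

definition bil :: "'a set \<Rightarrow> ('a \<Rightarrow> 'a \<Rightarrow> real) \<Rightarrow> ('a \<Rightarrow> real) \<Rightarrow> ('a \<Rightarrow> real) \<Rightarrow> real" where
  "bil S A v w = (\<Sum>x\<in>S. v x * (\<Sum>y\<in>S. A x y * w y))"

definition sym_on :: "'a set \<Rightarrow> ('a \<Rightarrow> 'a \<Rightarrow> real) \<Rightarrow> bool" where
  "sym_on S A \<longleftrightarrow> (\<forall>x\<in>S. \<forall>y\<in>S. A x y = A y x)"

definition psd :: "'a set \<Rightarrow> ('a \<Rightarrow> 'a \<Rightarrow> real) \<Rightarrow> bool" where
  "psd S A \<longleftrightarrow> (\<forall>v. 0 \<le> bil S A v v)"

lemma psdD: "psd S A \<Longrightarrow> 0 \<le> bil S A v v"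
  by (simp add: psd_def)

lemma bil_commute:
  assumes "sym_on S A" shows "bil S A v w = bil S A w v"
proof -
  have "bil S A v w = (\<Sum>x\<in>S. \<Sum>y\<in>S. v x * A x y * w y)"
    by (simp add: bil_def sum_distrib_left mult.assoc)
  also have "\<dots> = (\<Sum>y\<in>S. \<Sum>x\<in>S. v x * A x y * w y)"
    by (rule sum.swap)
  also have "\<dots> = (\<Sum>y\<in>S. \<Sum>x\<in>S. w y * (A y x * v x))"
    using assms by (intro sum.cong refl) (simp add: sym_on_def)
  finally show ?thesis
    by (simp add: bil_def sum_distrib_left)
qed

lemma bil_add_left: "bil S A (\<lambda>x. u x + v x) w = bil S A u w + bil S A v w"
  by (simp add: bil_def distrib_right sum.distrib)

lemma bil_add_right: "bil S A w (\<lambda>x. u x + v x) = bil S A w u + bil S A w v"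
  by (simp add: bil_def distrib_left sum.distrib)

lemma bil_scale_left: "bil S A (\<lambda>x. c * v x) w = c * bil S A v w"
  by (simp add: bil_def sum_distrib_left mult.assoc)

lemma bil_scale_right: "bil S A w (\<lambda>x. c * v x) = c * bil S A w v"
  by (simp add: bil_def sum_distrib_left algebra_simps)

lemmas bil_linear = bil_add_left bil_add_right bil_scale_left bil_scale_right

lemma bil_cong:
  assumes "\<And>x y. x \<in> S \<Longrightarrow> y \<in> S \<Longrightarrow> A x y = B x y" "\<And>x. x \<in> S \<Longrightarrow> v x = v' x" "\<And>x. x \<in> S \<Longrightarrow> w x = w' x"
  shows "bil S A v w = bil S B v' w'"
  using assms by (simp add: bil_def cong: sum.cong)

lemma bil_cauchy_schwarz:
  assumes "sym_on S A" "psd S A"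
  shows "(bil S A w v)\<^sup>2 \<le> bil S A w w * bil S A v v"
proof -
  let ?a = "bil S A v v" and ?b = "bil S A w v" and ?c = "bil S A w w"
  have key: "0 \<le> ?c + 2 * t * ?b + t\<^sup>2 * ?a" for t
  proof -
    have "bil S A (\<lambda>x. w x + t * v x) (\<lambda>x. w x + t * v x) = ?c + 2 * t * ?b + t\<^sup>2 * ?a"
      by (simp add: bil_linear bil_commute[OF assms(1), of v w] algebra_simps power2_eq_square)
    then show ?thesis
      using psdD[OF assms(2)] by metis
  qed
  have a0: "0 \<le> ?a"
    using psdD[OF assms(2)] .
  show ?thesis
  proof (cases "?a = 0")
    case True
    have "?b = 0"
    proof (rule ccontr)
      assume "?b \<noteq> 0"
      \<comment> \<open>The quadratic in \<open>t\<close> has become linear, and at this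
        \<open>t\<close> its value is -1.\<close>
      then show False
        using key[of "- (?c + 1) / (2 * ?b)"] True by (simp add: field_simps)
    qed
    then show ?thesis
      using True by simp
  next
    case False
    then have "0 \<le> ?c - ?b\<^sup>2 / ?a"
      using key[of "- ?b / ?a"] by (simp add: field_simps power2_eq_square)
    then show ?thesis
      using False a0 by (simp add: field_simps)
  qed
qed

lemma bil_unit_left:
  assumes "finite S" "x \<in> S"
  shows "bil S A (\<lambda>y. if y = x then 1 else 0) v = (\<Sum>y\<in>S. A x y * v y)"
  using assms by (simp add: bil_def if_distrib if_distribR sum.delta cong: if_cong)

text \<open>Cauchy-Schwarz against the unit vector at \<open>x\<close>: the square of row
  \<open>x\<close> applied to \<open>v\<close> is at most A_xx times 0. A null vector found on part
  of a graph thus gives a linear equation at every other vertex.\<close>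

lemma psd_kernel:
  assumes "finite S" "sym_on S A" "psd S A" "bil S A v v = 0" "x \<in> S"
  shows "(\<Sum>y\<in>S. A x y * v y) = 0"
  using bil_cauchy_schwarz[OF assms(2,3), of "\<lambda>y. if y = x then 1 else 0" v] assms(4)
  by (simp add: bil_unit_left[OF assms(1,5)])

lemma bil_subset:
  assumes "finite S" "X \<subseteq> S" "\<And>x. x \<in> S - X \<Longrightarrow> v x = 0" "\<And>x. x \<in> S - X \<Longrightarrow> w x = 0"
  shows "bil S A v w = bil X A v w"
proof -
  have "(\<Sum>y\<in>S. A x y * w y) = (\<Sum>y\<in>X. A x y * w y)" for x
    using assms by (intro sum.mono_neutral_right) auto
  then show ?thesis
    unfolding bil_def using assms by (auto intro!: sum.mono_neutral_right)
qed

lemma psd_subset: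
  assumes "finite S" "X \<subseteq> S" "psd S A" shows "psd X A"
  unfolding psd_def
proof
  fix v :: "'a \<Rightarrow> real"
  let ?v = "\<lambda>x. if x \<in> X then v x else (0::real)"
  have "0 \<le> bil S A ?v ?v"
    using psdD[OF assms(3)] .
  also have "\<dots> = bil X A ?v ?v"
    using assms by (intro bil_subset) auto
  also have "\<dots> = bil X A v v"
    by (intro bil_cong) auto
  finally show "0 \<le> bil X A v v" .
qed

lemma bil_shift:
  assumes "finite S"
  shows "bil S (\<lambda>x y. A x y + (if x = y then c else 0)) v w = bil S A v w + c * (\<Sum>x\<in>S. v x * w x)"
proof -
  have "bil S (\<lambda>x y. A x y + (if x = y then c else 0)) v w =
      bil S A v w + (\<Sum>x\<in>S. v x * (\<Sum>y\<in>S. (if x = y then c * w y else 0)))"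
  proof -
    have "(\<Sum>y\<in>S. (A x y + (if x = y then c else 0)) * w y) =
        (\<Sum>y\<in>S. A x y * w y) + (\<Sum>y\<in>S. (if x = y then c * w y else 0))" for x
      unfolding sum.distrib[symmetric] by (intro sum.cong) (auto simp: distrib_right)
    then show ?thesis
      by (simp add: bil_def distrib_left sum.distrib)
  qed
  also have "(\<Sum>x\<in>S. v x * (\<Sum>y\<in>S. (if x = y then c * w y else 0))) = c * (\<Sum>x\<in>S. v x * w x)"
    using assms by (simp add: sum_distrib_left algebra_simps)
  finally show ?thesis .
qed

section \<open>Existence and finiteness of eigenvalues of symmetric forms\<close>

lemma eigenvalue_on_norm:
  assumes "finite S" "eigenvalue_on S A \<theta>"
  obtains v where "(\<Sum>x\<in>S. (v x)\<^sup>2) = 1" "\<And>x. x \<in> S \<Longrightarrow> (\<Sum>y\<in>S. A x y * v y) = \<theta> * v x"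
proof -
  obtain v where v: "\<exists>x\<in>S. v x \<noteq> 0" "\<forall>x\<in>S. (\<Sum>y\<in>S. A x y * v y) = \<theta> * v x"
    using assms unfolding eigenvalue_on_def by blast
  define n where "n = (\<Sum>x\<in>S. (v x)\<^sup>2)"
  have "n > 0"
    unfolding n_def using v(1) assms(1) by (meson sum_pos2 zero_le_power2 zero_less_power2)
  have "(\<Sum>x\<in>S. (v x / sqrt n)\<^sup>2) = (\<Sum>x\<in>S. (v x)\<^sup>2) / n"
    using \<open>n > 0\<close> by (simp add: power_divide sum_divide_distrib)
  then have "(\<Sum>x\<in>S. (v x / sqrt n)\<^sup>2) = 1"
    using \<open>n > 0\<close> by (simp add: n_def)
  moreover have "(\<Sum>y\<in>S. A x y * (v y / sqrt n)) = \<theta> * (v x / sqrt n)" if "x \<in> S" for x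
    using v(2)[rule_format, OF that] by (simp flip: sum_divide_distrib)
  ultimately show thesis
    by (rule that)
qed

lemma eigenvalue_bound:
  assumes "finite S" "eigenvalue_on S A \<theta>" "\<And>v. \<mu> * (\<Sum>x\<in>S. (v x)\<^sup>2) \<le> bil S A v v"
  shows "\<mu> \<le> \<theta>"
proof -
  obtain v where v: "(\<Sum>x\<in>S. (v x)\<^sup>2) = 1" "\<And>x. x \<in> S \<Longrightarrow> (\<Sum>y\<in>S. A x y * v y) = \<theta> * v x"
    using eigenvalue_on_norm[OF assms(1,2)] by blast
  have "bil S A v v = (\<Sum>x\<in>S. \<theta> * (v x)\<^sup>2)"
    unfolding bil_def using v(2) by (intro sum.cong) (auto simp: power2_eq_square)
  also have "\<dots> = \<theta>"
    using v(1) by (simp flip: sum_distrib_left)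
  finally show ?thesis
    using assms(3)[of v] v(1) by simp
qed

text \<open>Bessel's inequality for normed eigenvectors of distinct eigenvalues bounds their number.\<close>

lemma finite_eigenvalues:
  assumes "finite S" "sym_on S A"
  shows "finite {\<theta>. eigenvalue_on S A \<theta>}"
proof (rule ccontr)
  assume "infinite {\<theta>. eigenvalue_on S A \<theta>}"
  then obtain T where T: "finite T" "card T = Suc (card S)" "T \<subseteq> {\<theta>. eigenvalue_on S A \<theta>}"
    using infinite_arbitrarily_large by blast
  have "\<exists>v. (\<Sum>x\<in>S. (v x)\<^sup>2) = 1 \<and> (\<forall>x\<in>S. (\<Sum>y\<in>S. A x y * v y) = \<theta> * v x)" if "\<theta> \<in> T" for \<theta>
    using that T(3) eigenvalue_on_norm[OF assms(1), of A \<theta>] by (smt (verit) mem_Collect_eq subsetD)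
  then obtain e where e: "\<And>\<theta>. \<theta> \<in> T \<Longrightarrow> (\<Sum>x\<in>S. (e \<theta> x)\<^sup>2) = (1::real)"
    "\<And>\<theta> x. \<theta> \<in> T \<Longrightarrow> x \<in> S \<Longrightarrow> (\<Sum>y\<in>S. A x y * e \<theta> y) = \<theta> * e \<theta> x"
    by metis
  have bil_e: "bil S A w (e \<theta>) = \<theta> * (\<Sum>x\<in>S. w x * e \<theta> x)" if "\<theta> \<in> T" for \<theta> w
    unfolding bil_def using e(2)[OF that] by (simp add: sum_distrib_left algebra_simps cong: sum.cong)
  have orth: "(\<Sum>x\<in>S. e \<theta> x * e \<eta> x) = (if \<eta> = \<theta> then 1 else 0)" if "\<theta> \<in> T" "\<eta> \<in> T" for \<theta> \<eta>
  proof (cases "\<eta> = \<theta>")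
    case True
    then show ?thesis
      using e(1)[OF that(1)] by (simp add: power2_eq_square)
  next
    case False
    have "(\<Sum>x\<in>S. e \<eta> x * e \<theta> x) = (\<Sum>x\<in>S. e \<theta> x * e \<eta> x)"
      by (simp add: mult.commute)
    then have "\<eta> * (\<Sum>x\<in>S. e \<theta> x * e \<eta> x) = \<theta> * (\<Sum>x\<in>S. e \<theta> x * e \<eta> x)"
      using bil_e[OF that(2), of "e \<theta>"] bil_e[OF that(1), of "e \<eta>"] bil_commute[OF assms(2), of "e \<theta>" "e \<eta>"]
      by metis
    then show ?thesis
      using False by auto
  qed
  have bessel: "(\<Sum>\<theta>\<in>T. (e \<theta> x)\<^sup>2) \<le> 1" if "x \<in> S" for x
  proof -
    \<comment> \<open>\<open>?p\<close> is the orthogonal projection of the unit vector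
      \<open>?d\<close> to the span of the eigenvectors. Expanding their squared distance gives the
      bound, and summing it over \<open>x\<close> gives card T <= card S.\<close>
    let ?d = "\<lambda>y. if y = x then 1 else (0::real)"
    let ?p = "\<lambda>y. \<Sum>\<theta>\<in>T. e \<theta> x * e \<theta> y"
    have 1: "(\<Sum>y\<in>S. ?d y * ?d y) = 1"
      using that assms(1) by (simp add: if_distrib if_distribR cong: if_cong)
    have 2: "(\<Sum>y\<in>S. ?d y * ?p y) = (\<Sum>\<theta>\<in>T. (e \<theta> x)\<^sup>2)"
      using that assms(1) by (simp add: if_distrib if_distribR power2_eq_square cong: if_cong)
    have "(\<Sum>y\<in>S. ?p y * ?p y) = (\<Sum>y\<in>S. \<Sum>\<theta>\<in>T. \<Sum>\<eta>\<in>T. (e \<theta> x * e \<theta> y) * (e \<eta> x * e \<eta> y))"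
      by (simp add: sum_product)
    also have "\<dots> = (\<Sum>\<theta>\<in>T. \<Sum>\<eta>\<in>T. \<Sum>y\<in>S. (e \<theta> x * e \<theta> y) * (e \<eta> x * e \<eta> y))"
      by (subst sum.swap, intro sum.cong refl) (rule sum.swap)
    also have "\<dots> = (\<Sum>\<theta>\<in>T. \<Sum>\<eta>\<in>T. e \<theta> x * e \<eta> x * (\<Sum>y\<in>S. e \<theta> y * e \<eta> y))"
      by (simp add: sum_distrib_left algebra_simps)
    also have "\<dots> = (\<Sum>\<theta>\<in>T. \<Sum>\<eta>\<in>T. if \<eta> = \<theta> then e \<theta> x * e \<eta> x else 0)"
      using orth by (intro sum.cong refl) auto
    also have "\<dots> = (\<Sum>\<theta>\<in>T. (e \<theta> x)\<^sup>2)"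
      using T(1) by (intro sum.cong) (auto simp: power2_eq_square)
    finally have 3: "(\<Sum>y\<in>S. ?p y * ?p y) = (\<Sum>\<theta>\<in>T. (e \<theta> x)\<^sup>2)" .
    have sq: "(a - b)\<^sup>2 = a * a - 2 * (a * b) + b * b" for a b :: real
      by (simp add: power2_eq_square algebra_simps)
    have "0 \<le> (\<Sum>y\<in>S. (?d y - ?p y)\<^sup>2)"
      by (simp add: sum_nonneg)
    also have "\<dots> = (\<Sum>y\<in>S. ?d y * ?d y) - 2 * (\<Sum>y\<in>S. ?d y * ?p y) + (\<Sum>y\<in>S. ?p y * ?p y)"
      unfolding sq sum.distrib sum_subtractf sum_distrib_left[symmetric] ..
    finally show ?thesis
      using 1 2 3 by simp
  qed
  have "real (card T) = (\<Sum>\<theta>\<in>T. \<Sum>x\<in>S. (e \<theta> x)\<^sup>2)"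
    using e(1) by simp
  also have "\<dots> = (\<Sum>x\<in>S. \<Sum>\<theta>\<in>T. (e \<theta> x)\<^sup>2)"
    by (rule sum.swap)
  also have "\<dots> \<le> (\<Sum>x\<in>S. 1)"
    using bessel by (intro sum_mono)
  finally show False
    using T(2) by simp
qed

text \<open>The form attains its minimum on the unit sphere by compactness. Subtracting this value
  from the diagonal leaves a semidefinite form with the minimiser as a null vector, so
  \<open>psd_kernel\<close> makes it an eigenvector.\<close>

lemma exists_min_eigenvalue:
  assumes "finite S" "S \<noteq> {}" "sym_on S A"
  obtains \<theta> where "eigenvalue_on S A \<theta>" "\<And>v. \<theta> * (\<Sum>x\<in>S. (v x)\<^sup>2) \<le> bil S A v v"
proof -
  \<comment> \<open>The box lives in the full function space; coordinates outside \<open>S\<close>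
    are pinned to 0 to make it compact.\<close>
  let ?B = "PiE UNIV (\<lambda>x. if x \<in> S then {-1..1} else {0::real})"
  let ?n = "\<lambda>v. \<Sum>x\<in>S. (v x)\<^sup>2 :: real"
  let ?K = "?B \<inter> {v. ?n v = 1}"
  have "compactin (product_topology (\<lambda>_. euclidean) UNIV) ?B"
    unfolding compactin_PiE by auto
  then have cB: "compact ?B"
    by (simp add: euclidean_product_topology)
  have cont: "continuous_on UNIV (\<lambda>v::'a \<Rightarrow> real. v x)" for x
    by (rule continuous_on_product_coordinates)
  have "closed {v. ?n v = 1}"
    by (intro closed_Collect_eq continuous_intros cont)
  with cB have cK: "compact ?K"
    by (rule compact_Int_closed)
  obtain x0 where x0: "x0 \<in> S"
    using assms(2) by blast
  have "(\<Sum>x\<in>S. (if x = x0 then 1 else (0::real))\<^sup>2) = (\<Sum>x\<in>S. (if x = x0 then 1 else (0::real)))"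
    by (intro sum.cong) auto
  also have "\<dots> = 1"
    using x0 assms(1) by simp
  finally have "(\<lambda>x. if x = x0 then 1 else 0) \<in> ?K"
    using x0 by auto
  then have "?K \<noteq> {}"
    by blast
  moreover have "continuous_on ?K (\<lambda>v. bil S A v v)"
    unfolding bil_def by (intro continuous_intros continuous_on_subset[OF cont]) auto
  ultimately have "\<exists>u\<in>?K. \<forall>v\<in>?K. bil S A u u \<le> bil S A v v"
    by (rule continuous_attains_inf[OF cK])
  then obtain u where u: "u \<in> ?K" "\<forall>v\<in>?K. bil S A u u \<le> bil S A v v"
    by (rule bexE)
  define \<theta> where "\<theta> = bil S A u u"
  have nu: "?n u = 1"
    using u(1) by simp
  have low: "\<theta> * ?n v \<le> bil S A v v" for v
  proof (cases "?n v = 0")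
    case True
    then have "v x = 0" if "x \<in> S" for x
      using that assms(1) by (simp add: sum_nonneg_eq_0_iff)
    then have "bil S A v v = 0"
      by (simp add: bil_def)
    then show ?thesis
      using True by simp
  next
    case False
    define n where "n = ?n v"
    have n: "n > 0"
      using False unfolding n_def by (metis less_eq_real_def sum_nonneg zero_le_power2)
    define r where "r = 1 / sqrt n"
    have r: "r\<^sup>2 * n = 1"
      using n by (simp add: r_def power_divide)
    let ?w = "\<lambda>x. if x \<in> S then r * v x else 0"
    have nw: "?n ?w = 1"
      using r by (simp add: power_mult_distrib n_def sum_distrib_left)
    have "(?w x)\<^sup>2 \<le> 1" if "x \<in> S" for x
      using member_le_sum[OF that, of "\<lambda>x. (?w x)\<^sup>2"] assms(1) nw by simp
    then have "\<bar>?w x\<bar> \<le> 1" if "x \<in> S" for x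
      using that abs_square_le_1 by blast
    then have "?w x \<in> (if x \<in> S then {-1..1} else {0})" for x
      by (cases "x \<in> S") (force simp: abs_le_iff)+
    then have "?w \<in> ?B"
      by (simp add: PiE_def)
    then have "\<theta> \<le> bil S A ?w ?w"
      using bspec[OF u(2), of ?w] nw unfolding \<theta>_def by blast
    also have "\<dots> = bil S A (\<lambda>x. r * v x) (\<lambda>x. r * v x)"
      by (intro bil_cong) auto
    also have "\<dots> = r\<^sup>2 * bil S A v v"
      by (simp add: bil_scale_left bil_scale_right power2_eq_square)
    finally have "\<theta> * n \<le> r\<^sup>2 * bil S A v v * n"
      using n by (intro mult_right_mono) auto
    also have "\<dots> = bil S A v v"
      using r by (metis mult.assoc mult.commute mult_1)
    finally show ?thesis
      by (simp add: n_def)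
  qed
  let ?M = "\<lambda>x y. A x y + (if x = y then - \<theta> else 0)"
  have M: "bil S ?M v v = bil S A v v - \<theta> * ?n v" for v
    unfolding bil_shift[OF assms(1)] by (simp add: power2_eq_square)
  have sM: "sym_on S ?M"
    using assms(3) by (auto simp: sym_on_def)
  have pM: "psd S ?M"
    unfolding psd_def M using low by simp
  have zM: "bil S ?M u u = 0"
    unfolding M nu by (simp add: \<theta>_def)
  have "(\<Sum>y\<in>S. A x y * u y) = \<theta> * u x" if "x \<in> S" for x
  proof -
    have "0 = (\<Sum>y\<in>S. (A x y + (if x = y then - \<theta> else 0)) * u y)"
      using psd_kernel[OF assms(1) sM pM zM that] by simp
    also have "\<dots> = (\<Sum>y\<in>S. A x y * u y + (if x = y then - \<theta> * u y else 0))"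
      by (intro sum.cong) (auto simp: algebra_simps)
    finally have "0 = (\<Sum>y\<in>S. A x y * u y + (if x = y then - \<theta> * u y else 0))" .
    then show ?thesis
      using assms(1) that by (simp add: sum.distrib)
  qed
  moreover have "\<exists>x\<in>S. u x \<noteq> 0"
    using nu by (metis (no_types, lifting) power_zero_numeral sum.neutral zero_neq_one)
  ultimately have "eigenvalue_on S A \<theta>"
    unfolding eigenvalue_on_def by blast
  with low show thesis
    by (rule that[rotated])
qed

section \<open>Eigenvalue bounds as semidefiniteness\<close>

definition shifted :: "real \<Rightarrow> 'a hoffman_graph \<Rightarrow> 'a \<Rightarrow> 'a \<Rightarrow> real" where
  "shifted \<mu> h x y = Sp h x y + (if x = y then - \<mu> else 0)"

lemma hoffmanD:
  assumes "hoffman h"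
  shows "finite (slim h)" "finite (fat h)" "slim h \<inter> fat h = {}"
    "adj h x y \<Longrightarrow> x \<in> verts h" "adj h x y \<Longrightarrow> y \<in> verts h"
    "adj h x y \<longleftrightarrow> adj h y x" "\<not> adj h x x"
    "f \<in> fat h \<Longrightarrow> \<exists>x\<in>slim h. adj h f x" "f \<in> fat h \<Longrightarrow> g \<in> fat h \<Longrightarrow> \<not> adj h f g"
  using assms unfolding hoffman_def by metis+

lemma Sp_sym: "hoffman h \<Longrightarrow> Sp h x y = Sp h y x"
  unfolding Sp_def adj_matrix_def using hoffmanD(6)[of h x y] by (simp add: mult.commute)

lemma shifted_sym: "hoffman h \<Longrightarrow> sym_on S (shifted \<mu> h)"
  by (auto simp: sym_on_def shifted_def Sp_sym)

lemma bil_shifted: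
  assumes "finite S"
  shows "bil S (shifted \<mu> h) v w = bil S (Sp h) v w - \<mu> * (\<Sum>x\<in>S. v x * w x)"
  unfolding shifted_def bil_shift[OF assms] by simp

text \<open>Symmetry of \<open>Sp h\<close> is the hypothesis so that the lemma applies to summands
  of a direct sum, which are given only as induced subgraphs.\<close>

lemma lambda_min_ge_iff_psd:
  assumes "finite (slim h)" "slim h \<noteq> {}" "sym_on (slim h) (Sp h)"
  shows "\<mu> \<le> lambda_min h \<longleftrightarrow> psd (slim h) (shifted \<mu> h)"
proof -
  let ?E = "{\<theta>. eigenvalue_on (slim h) (Sp h) \<theta>}"
  have fin: "finite ?E"
    by (rule finite_eigenvalues[OF assms(1,3)])
  obtain \<theta> where \<theta>: "eigenvalue_on (slim h) (Sp h) \<theta>"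
    "\<And>v. \<theta> * (\<Sum>x\<in>slim h. (v x)\<^sup>2) \<le> bil (slim h) (Sp h) v v"
    using exists_min_eigenvalue[OF assms] by blast
  have min: "lambda_min h = \<theta>"
    unfolding lambda_min_def using fin \<theta>(1) eigenvalue_bound[OF assms(1) _ \<theta>(2)] by (intro Min_eqI) auto
  have psd: "psd (slim h) (shifted \<mu> h) \<longleftrightarrow> (\<forall>v. \<mu> * (\<Sum>x\<in>slim h. (v x)\<^sup>2) \<le> bil (slim h) (Sp h) v v)"
    unfolding psd_def bil_shifted[OF assms(1)] by (simp add: power2_eq_square)
  show ?thesis
  proof
    assume le: "\<mu> \<le> lambda_min h"
    show "psd (slim h) (shifted \<mu> h)"
      unfolding psd
    proof
      fix v :: "'a \<Rightarrow> real"
      have "\<mu> * (\<Sum>x\<in>slim h. (v x)\<^sup>2) \<le> \<theta> * (\<Sum>x\<in>slim h. (v x)\<^sup>2)"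
        using le min by (intro mult_right_mono) (auto intro: sum_nonneg)
      with \<theta>(2)[of v] show "\<mu> * (\<Sum>x\<in>slim h. (v x)\<^sup>2) \<le> bil (slim h) (Sp h) v v"
        by linarith
    qed
  next
    assume "psd (slim h) (shifted \<mu> h)"
    then show "\<mu> \<le> lambda_min h"
      unfolding psd min using eigenvalue_bound[OF assms(1) \<theta>(1)] by blast
  qed
qed

section \<open>Forms of signed trees\<close>

definition conn_in :: "('a \<Rightarrow> 'a \<Rightarrow> bool) \<Rightarrow> 'a set \<Rightarrow> bool" where
  "conn_in E X \<longleftrightarrow> (\<forall>x\<in>X. \<forall>y\<in>X. (\<lambda>a b. a \<in> X \<and> b \<in> X \<and> E a b)\<^sup>*\<^sup>* x y)"

lemma conn_in_singleton: "conn_in E {x}"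
  by (simp add: conn_in_def)

lemma conn_in_insert:
  assumes "conn_in E X" "y \<in> X" "E y z" "E z y"
  shows "conn_in E (insert z X)"
proof -
  let ?r = "\<lambda>X a b. a \<in> X \<and> b \<in> X \<and> E a b"
  have mono: "(?r (insert z X))\<^sup>*\<^sup>* a b" if "(?r X)\<^sup>*\<^sup>* a b" for a b
    using that by (rule rtranclp_mono[THEN predicate2D, rotated]) auto
  have X: "(?r (insert z X))\<^sup>*\<^sup>* a b" if "a \<in> X" "b \<in> X" for a b
    using mono that assms(1) unfolding conn_in_def by blast
  have 1: "(?r (insert z X))\<^sup>*\<^sup>* a z" if "a \<in> X" for a
    using X[OF that assms(2)] assms(2,3) by (auto intro: rtranclp.rtrancl_into_rtrancl)
  have 2: "(?r (insert z X))\<^sup>*\<^sup>* z a" if "a \<in> X" for a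
    using X[OF assms(2) that] assms(2,4) by (auto intro: converse_rtranclp_into_rtranclp)
  show ?thesis
    unfolding conn_in_def using X 1 2 by blast
qed

text \<open>\<open>xs\<close> lists vertices so that each one is joined to exactly one earlier vertex, whose
  position is given by \<open>ps\<close> (the first entry of \<open>ps\<close> is junk).\<close>

definition tree_list :: "('a \<Rightarrow> 'a \<Rightarrow> real) \<Rightarrow> 'a list \<Rightarrow> nat list \<Rightarrow> bool" where
  "tree_list M xs ps \<longleftrightarrow> distinct xs \<and> length ps = length xs \<and>
     (\<forall>i<length xs. \<forall>j<length xs. i \<noteq> j \<longrightarrow>
        (M (xs ! i) (xs ! j) \<noteq> 0 \<longleftrightarrow> (j < i \<and> ps ! i = j) \<or> (i < j \<and> ps ! j = i)))"

text \<open>\<open>M\<close> is the form \<open>Sp + 3 I\<close> of a seedling on its slim vertices \<open>V\<close>: \<open>maximal\<close> says that no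
  pendant vertex can be added, and \<open>irred\<close> that adding a fat vertex with neighbourhood \<open>W\<close> does not
  make the graph decomposable.\<close>

locale special_tree =
  fixes V :: "'a set" and M :: "'a \<Rightarrow> 'a \<Rightarrow> real"
  assumes fin: "finite V" and nonempty: "V \<noteq> {}"
    and sym: "\<And>x y. M x y = M y x"
    and diag: "\<And>x. x \<in> V \<Longrightarrow> M x x \<in> {0, 1, 2}"
    and offdiag: "\<And>x y. x \<in> V \<Longrightarrow> y \<in> V \<Longrightarrow> x \<noteq> y \<Longrightarrow> M x y \<in> {-1, 0, 1}"
    and psd: "psd V M"
    and attach: "\<And>X z y y'. conn_in (\<lambda>a b. M a b \<noteq> 0) X \<Longrightarrow> X \<subseteq> V \<Longrightarrow> z \<in> V - X \<Longrightarrow>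
      y \<in> X \<Longrightarrow> y' \<in> X \<Longrightarrow> M z y \<noteq> 0 \<Longrightarrow> M z y' \<noteq> 0 \<Longrightarrow> y = y'"
    and one_neg: "\<And>x y z. x \<in> V \<Longrightarrow> y \<in> V \<Longrightarrow> z \<in> V \<Longrightarrow> M x x = 2 \<Longrightarrow> M x y = -1 \<Longrightarrow>
      M x z = -1 \<Longrightarrow> y = z"
    and maximal: "\<And>x. x \<in> V \<Longrightarrow> \<exists>v. bil V M v v < (v x)\<^sup>2 / 3"
    and irred: "\<And>W V1. W \<subseteq> V \<Longrightarrow> V1 \<subseteq> V \<Longrightarrow> V1 \<noteq> {} \<Longrightarrow> V1 \<noteq> V \<Longrightarrow>
      (\<And>v. (\<Sum>x\<in>W. v x)\<^sup>2 \<le> bil V M v v) \<Longrightarrow>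
      \<exists>x\<in>V1. \<exists>y\<in>V - V1. M x y \<noteq> of_bool (x \<in> W \<and> y \<in> W)"
begin

abbreviation conn :: "'a set \<Rightarrow> bool" where
  "conn X \<equiv> conn_in (\<lambda>a b. M a b \<noteq> 0) X"

lemma sym_V: "sym_on X M"
  by (simp add: sym_on_def sym)

lemma fin_sub: "X \<subseteq> V \<Longrightarrow> finite X"
  using fin finite_subset by blast

text \<open>\<open>irred\<close> with \<open>W = {}\<close>, where the bound is plain
  semidefiniteness: the special graph is connected.\<close>

lemma outside:
  assumes "X \<subseteq> V" "X \<noteq> {}" "X \<noteq> V"
  obtains x z where "x \<in> X" "z \<in> V - X" "M x z \<noteq> 0"
  using irred[of "{}" X] assms psdD[OF psd] by auto

lemma conn_insert: "conn X \<Longrightarrow> y \<in> X \<Longrightarrow> M z y \<noteq> 0 \<Longrightarrow> conn (insert z X)"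
  by (rule conn_in_insert) (auto simp: sym)

lemma attach_zero:
  assumes "conn X" "X \<subseteq> V" "z \<in> V - X" "y \<in> X" "M z y \<noteq> 0" "w \<in> X" "w \<noteq> y"
  shows "M z w = 0"
  using attach[OF assms(1-4,6,5)] assms(7) by blast

text \<open>A tree has no cycle that could obstruct switching. A connected set is enlarged by one
  vertex at a time; the new vertex is joined to exactly one old vertex, which determines its sign.
  Switching at the vertices of sign -1 makes every edge negative.\<close>

lemma exists_signs:
  "\<exists>\<sigma>. (\<forall>x. \<sigma> x = 1 \<or> \<sigma> x = -1) \<and> (\<forall>x\<in>V. \<forall>y\<in>V. x \<noteq> y \<longrightarrow> M x y = 0 \<or> M x y = - \<sigma> x * \<sigma> y)"
proof -
  let ?P = "\<lambda>X \<sigma>. (\<forall>x. \<sigma> x = 1 \<or> \<sigma> x = -1) \<and>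
    (\<forall>x\<in>X. \<forall>y\<in>X. x \<noteq> y \<longrightarrow> M x y = 0 \<or> M x y = - \<sigma> x * \<sigma> y)"
  have "\<exists>X \<sigma>. X \<subseteq> V \<and> card X = Suc n \<and> conn X \<and> ?P X \<sigma>" if "Suc n \<le> card V" for n
    using that
  proof (induction n)
    case 0
    obtain x where "x \<in> V"
      using nonempty by blast
    then show ?case
      by (intro exI[of _ "{x}"] exI[of _ "\<lambda>_. 1"]) (simp add: conn_in_singleton)
  next
    case (Suc n)
    then obtain X \<sigma> where X: "X \<subseteq> V" "card X = Suc n" "conn X" and \<sigma>: "?P X \<sigma>"
      by auto
    have "X \<noteq> {}" "X \<noteq> V"
      using X Suc.prems by auto
    then obtain x z where xz: "x \<in> X" "z \<in> V - X" "M x z \<noteq> 0"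
      using outside X(1) by metis
    let ?\<sigma> = "\<sigma>(z := - M z x * \<sigma> x)"
    have Mzx: "M z x = 1 \<or> M z x = -1"
      using offdiag[of z x] xz X(1) sym[of x z] by auto
    have "M z y = 0 \<or> M z y = - ?\<sigma> z * \<sigma> y" if "y \<in> X" for y
    proof (cases "y = x")
      case True
      then show ?thesis
        using \<sigma> by (metis fun_upd_same minus_mult_minus mult.assoc mult.right_neutral mult_minus_left)
    next
      case False
      then show ?thesis
        using attach_zero[OF X(3,1) xz(2,1) _ that] xz(3) sym by metis
    qed
    moreover have "?\<sigma> y = 1 \<or> ?\<sigma> y = -1" for y
      using \<sigma> Mzx by (metis fun_upd_apply mult_minus_left mult_minus_right mult_1 minus_minus)
    ultimately have "?P (insert z X) ?\<sigma>"
      using \<sigma> sym xz(2) by (auto simp: mult.commute)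
    moreover have "card (insert z X) = Suc (Suc n)"
      using X xz(2) fin_sub[OF X(1)] by simp
    moreover have "conn (insert z X)"
      using X(3) xz(1) by (rule conn_insert) (use xz(3) sym in metis)
    ultimately show ?case
      using X(1) xz(2) by (intro exI[of _ "insert z X"] exI[of _ ?\<sigma>]) auto
  qed
  moreover obtain n where "card V = Suc n"
    using fin nonempty by (metis card_eq_0_iff not0_implies_Suc)
  ultimately have "\<exists>X \<sigma>. X \<subseteq> V \<and> card X = card V \<and> conn X \<and> ?P X \<sigma>"
    by simp
  then obtain X \<sigma> where X: "X \<subseteq> V" "card X = card V" "?P X \<sigma>"
    by (elim exE conjE) (rule that, assumption+, intro conjI)
  then have "X = V"
    using fin by (simp add: card_subset_eq)
  then show ?thesis
    using X(3) by (intro exI[of _ \<sigma>]) simp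
qed

text \<open>After switching, the positive vector \<open>u\<close> is a null vector of the form on \<open>X\<close>, hence of the form
  on \<open>V\<close>; but a vertex outside \<open>X\<close> would be joined to exactly one vertex of \<open>X\<close>.\<close>

lemma positive_null_vector:
  assumes X: "X \<subseteq> V" "X \<noteq> {}" "conn X" and u: "\<And>x. x \<in> X \<Longrightarrow> 0 < u x"
    and null: "\<And>x. x \<in> X \<Longrightarrow> (\<Sum>y\<in>X. \<bar>M x y\<bar> * u y) = 2 * M x x * u x"
  shows "V = X"
proof (rule ccontr)
  assume "V \<noteq> X"
  then obtain x z where xz: "x \<in> X" "z \<in> V - X" "M x z \<noteq> 0"
    using outside X by metis
  obtain \<sigma> where signs: "(\<forall>x. \<sigma> x = 1 \<or> \<sigma> x = (-1::real)) \<and>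
      (\<forall>x\<in>V. \<forall>y\<in>V. x \<noteq> y \<longrightarrow> M x y = 0 \<or> M x y = - \<sigma> x * \<sigma> y)"
    using exists_signs by (rule exE)
  then have \<sigma>: "\<sigma> x = 1 \<or> \<sigma> x = -1"
    "x \<in> V \<Longrightarrow> y \<in> V \<Longrightarrow> x \<noteq> y \<Longrightarrow> M x y = 0 \<or> M x y = - \<sigma> x * \<sigma> y" for x y
    by simp_all
  define v where "v = (\<lambda>x. if x \<in> X then \<sigma> x * u x else 0)"
  have "(\<Sum>y\<in>X. M p y * v y) = 0" if p: "p \<in> X" for p
  proof -
    \<comment> \<open>In the switched form the off-diagonal entries become minus their absolute
      values, while the diagonal keeps its sign. The term at \<open>y = p\<close> corrects for this
      and explains the factor 2 in \<open>null\<close>.\<close>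
    have "M p y * v y = \<sigma> p * ((if y = p then 2 * M p p * u p else 0) - \<bar>M p y\<bar> * u y)" if y: "y \<in> X" for y
    proof (cases "y = p")
      case True
      have "M p p \<ge> 0"
        using diag[OF subsetD[OF X(1) p]] by auto
      then show ?thesis
        using True y by (simp add: v_def algebra_simps)
    next
      case False
      then have "M p y = 0 \<or> M p y = - \<sigma> p * \<sigma> y"
        using \<sigma>(2)[of p y] p y X(1) by auto
      then show ?thesis
        using False y \<sigma>(1)[of p] \<sigma>(1)[of y] by (auto simp: v_def)
    qed
    then have "(\<Sum>y\<in>X. M p y * v y) = (\<Sum>y\<in>X. \<sigma> p * ((if y = p then 2 * M p p * u p else 0) - \<bar>M p y\<bar> * u y))"
      by simp
    also have "\<dots> = \<sigma> p * (2 * M p p * u p - (\<Sum>y\<in>X. \<bar>M p y\<bar> * u y))"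
      using p fin_sub[OF X(1)] by (simp add: sum_distrib_left[symmetric] sum_subtractf)
    finally show ?thesis
      using null[OF p] by simp
  qed
  then have "bil X M v v = 0"
    by (simp add: bil_def)
  moreover have "bil V M v v = bil X M v v"
    by (intro bil_subset fin X(1)) (auto simp: v_def)
  ultimately have "0 = (\<Sum>y\<in>V. M z y * v y)"
    using psd_kernel[OF fin sym_V psd, of v z] xz(2) by simp
  also have "\<dots> = (\<Sum>y\<in>{x}. M z y * v y)"
  proof (intro sum.mono_neutral_right fin ballI)
    show "{x} \<subseteq> V"
      using xz X by auto
    fix y assume "y \<in> V - {x}"
    then show "M z y * v y = 0"
      using attach_zero[OF X(3,1) xz(2,1), of y] xz(3) sym by (auto simp: v_def)
  qed
  finally show False
    using xz u[OF xz(1)] \<sigma>(1)[of x] sym[of x z] by (auto simp: v_def)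
qed

text \<open>By Cauchy--Schwarz, \<open>(\<Sum>\<^sub>W v)\<^sup>2 = (w\<^sup>T M v)\<^sup>2 \<le> (w\<^sup>T M w) (v\<^sup>T M v)\<close> when \<open>M w\<close> is the indicator of
  \<open>W\<close>.\<close>

lemma irred_potential:
  assumes X: "X \<subseteq> V" and W: "W \<subseteq> V"
    and w: "\<And>x. x \<in> V \<Longrightarrow> (\<Sum>y\<in>X. M x y * w y) = of_bool (x \<in> W)"
    and one: "(\<Sum>x\<in>X. if x \<in> W then w x else 0) \<le> 1"
    and V1: "V1 \<subseteq> V" "V1 \<noteq> {}" "V1 \<noteq> V"
  obtains x y where "x \<in> V1" "y \<in> V - V1" "M x y \<noteq> of_bool (x \<in> W \<and> y \<in> W)"
proof -
  let ?w = "\<lambda>x. if x \<in> X then w x else 0"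
  have Mw: "(\<Sum>y\<in>V. M x y * ?w y) = of_bool (x \<in> W)" if "x \<in> V" for x
  proof -
    have "(\<Sum>y\<in>V. M x y * ?w y) = (\<Sum>y\<in>X. M x y * ?w y)"
      by (intro sum.mono_neutral_right fin X) auto
    then show ?thesis
      using w[OF that] by simp
  qed
  have vw: "bil V M v ?w = (\<Sum>x\<in>W. v x)" for v
  proof -
    have "bil V M v ?w = (\<Sum>x\<in>V. if x \<in> W then v x else 0)"
      unfolding bil_def by (intro sum.cong refl) (simp add: Mw)
    also have "\<dots> = (\<Sum>x\<in>W. v x)"
      using W fin by (simp add: sum.If_cases Int_absorb1)
    finally show ?thesis .
  qed
  have "bil V M ?w ?w = (\<Sum>x\<in>V. if x \<in> W then ?w x else 0)"
    unfolding bil_def by (intro sum.cong refl) (simp add: Mw)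
  also have "\<dots> = (\<Sum>x\<in>X. if x \<in> W then w x else 0)"
    by (rule sum.mono_neutral_cong_right) (use fin X in auto)
  finally have ww: "bil V M ?w ?w \<le> 1"
    using one by simp
  have "(\<Sum>x\<in>W. v x)\<^sup>2 \<le> bil V M v v" for v
  proof -
    have "(\<Sum>x\<in>W. v x)\<^sup>2 \<le> bil V M v v * bil V M ?w ?w"
      using bil_cauchy_schwarz[OF sym_V psd, of v ?w] by (simp add: vw)
    also have "\<dots> \<le> bil V M v v * 1"
      using ww psdD[OF psd] by (intro mult_left_mono)
    finally show ?thesis
      by simp
  qed
  then show thesis
    using irred[OF W V1] that by blast
qed

section \<open>Vertices with diagonal entry 0 or 1\<close>

lemma diag0_singleton:
  assumes "x \<in> V" "M x x = 0" shows "V = {x}"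
  by (rule positive_null_vector[where u = "\<lambda>_. 1"]) (use assms in \<open>auto simp: conn_in_singleton\<close>)

lemma diag1_pair:
  assumes "x \<in> V" "y \<in> V" "x \<noteq> y" "M x x = 1" "M y y = 1" "M x y \<noteq> 0" shows "V = {x, y}"
proof (rule positive_null_vector[where u = "\<lambda>_. 1"])
  show "conn {x, y}"
    using conn_insert[of "{y}" y x] assms(6) by (simp add: conn_in_singleton)
  have "\<bar>M x y\<bar> = 1" "\<bar>M y x\<bar> = 1"
    using offdiag[OF assms(1-3)] assms(6) sym[of x y] by auto
  then show "(\<Sum>y\<in>{x, y}. \<bar>M p y\<bar> * 1) = 2 * M p p * 1" if "p \<in> {x, y}" for p
    using that assms by auto
qed (use assms in auto)

text \<open>If all edges at \<open>x\<close> were positive, row \<open>x\<close> would be the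
  indicator of \<open>x\<close> and its neighbours. The unit vector at \<open>x\<close> is then a
  potential of value 1 for this set, and a new fat vertex on it cancels all entries between
  \<open>x\<close> and the rest. If \<open>x\<close> is alone, the form is v_x^2, against
  \<open>maximal\<close>.\<close>

lemma diag1_negative_edge:
  assumes "x \<in> V" "M x x = 1"
  obtains y where "y \<in> V" "y \<noteq> x" "M x y = -1"
proof (rule ccontr)
  assume no: "\<not> thesis"
  note negative = that
  have M: "M x y = of_bool (M x y \<noteq> 0)" if "y \<in> V" for y
    using that offdiag[OF assms(1) that] assms no negative[OF that] by (cases "y = x") auto
  show False
  proof (cases "V = {x}")
    case True
    obtain v where "bil V M v v < (v x)\<^sup>2 / 3"
      using maximal[OF assms(1)] by blast
    moreover have "bil V M v v = (v x)\<^sup>2"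
      using True assms(2) by (simp add: bil_def power2_eq_square)
    ultimately show False
      using zero_le_power2[of "v x"] by linarith
  next
    case False
    let ?W = "{y \<in> V. M x y \<noteq> 0}"
    obtain p q where "p \<in> {x}" "q \<in> V - {x}" "M p q \<noteq> of_bool (p \<in> ?W \<and> q \<in> ?W)"
      by (rule irred_potential[of "{x}" ?W "\<lambda>_. 1" "{x}"]) (use assms False M sym in auto)
    then show False
      using M assms by auto
  qed
qed

text \<open>The negative edge leads to a vertex \<open>y\<close> with entry 1 or 2. Entry 1 closes
  the graph by \<open>diag1_pair\<close>. For entry 2, a further neighbour \<open>z\<close> of
  \<open>x\<close> yields a positive null vector with weights 2, 1, 1 at \<open>x\<close>,
  \<open>y\<close>, \<open>z\<close>; if \<open>y\<close> is the only neighbour of \<open>x\<close>,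
  then \<open>maximal\<close> or \<open>irred\<close> is violated.\<close>

lemma diag1_cases:
  assumes x: "x \<in> V" "M x x = 1"
  obtains y where "x \<noteq> y" "V = {x, y}" "M y y = 1" "M x y = -1"
  | y z where "distinct [x, y, z]" "V = {x, y, z}" "M y y = 2" "M z z = 2"
      "M x y = -1" "M x z \<noteq> 0" "M y z = 0"
proof -
  obtain y where y: "y \<in> V" "y \<noteq> x" "M x y = -1"
    using diag1_negative_edge[OF x] .
  have yx: "M y x = -1"
    using y(3) sym by metis
  consider "M y y = 0" | "M y y = 1" | "M y y = 2"
    using diag[OF y(1)] by auto
  then show thesis
  proof cases
    case 1
    then show thesis
      using diag0_singleton[OF y(1)] x y(2) by auto
  next
    case 2
    then show thesis
      using that(1)[of y] diag1_pair[OF x(1) y(1) _ x(2)] y by auto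
  next
    case y2: 3
    show thesis
    proof (cases "\<exists>z\<in>V. z \<noteq> x \<and> z \<noteq> y \<and> M x z \<noteq> 0")
      case True
      then obtain z where z: "z \<in> V" "z \<noteq> x" "z \<noteq> y" "M x z \<noteq> 0"
        by blast
      have zx: "M z x \<noteq> 0" "\<bar>M x z\<bar> = 1" "\<bar>M z x\<bar> = 1"
        using z offdiag[OF z(1) x(1) z(2)] sym[of x z] by auto
      have cxy: "conn {y, x}"
        using conn_insert[of "{x}" x y] yx by (simp add: conn_in_singleton)
      have zy: "M z y = 0"
        by (rule attach_zero[OF cxy]) (use x y z zx in auto)
      then have yz: "M y z = 0"
        using sym by metis
      have z2: "M z z = 2"
        using diag[OF z(1)] diag0_singleton[OF z(1)] diag1_pair[OF x(1) z(1) _ x(2)] x y z by auto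
      have "V = {x, y, z}"
      proof (rule positive_null_vector[where u = "\<lambda>p. if p = x then 2 else 1"])
        show "conn {x, y, z}"
          using conn_insert[OF cxy, of x z] zx by (simp add: insert_commute)
        show "(\<Sum>q\<in>{x, y, z}. \<bar>M p q\<bar> * (if q = x then 2 else 1)) = 2 * M p p * (if p = x then 2 else 1)"
          if "p \<in> {x, y, z}" for p
          using that x y z zx yz zy z2 y2 yx by auto
      qed (use x y z in auto)
      then show thesis
        using that(2)[of y z] x y z yz z2 y2 by auto
    next
      case False
      then have only: "M x p = 0" "M p x = 0" if "p \<in> V" "p \<noteq> x" "p \<noteq> y" for p
        using that sym[of x p] by auto
      have pos: "M p y = of_bool (M y p \<noteq> 0)" "M y p = of_bool (M y p \<noteq> 0)" if "p \<in> V" "p \<noteq> x" "p \<noteq> y" for p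
        using offdiag[OF that(1) y(1) that(3)] one_neg[OF y(1) that(1) x(1) y2 _ yx] that sym[of p y] by auto
      show thesis
      proof (cases "V = {x, y}")
        case True
        obtain v where "bil V M v v < (v y)\<^sup>2 / 3"
          using maximal[OF y(1)] by blast
        moreover have "bil V M v v = (v x - v y)\<^sup>2 + (v y)\<^sup>2"
          using True x y y2 yx by (simp add: bil_def power2_eq_square algebra_simps)
        ultimately show thesis
          using zero_le_power2[of "v x - v y"] zero_le_power2[of "v y"] by linarith
      next
        case False
        \<comment> \<open>\<open>M\<close> maps the vector that is 1 on \<open>x\<close> and
          \<open>y\<close> to the indicator of \<open>?W\<close>: it cancels at \<open>x\<close>,
          leaves 2 - 1 at \<open>y\<close>, and the other edges at \<open>y\<close> are positive by
          \<open>one_neg\<close>. The new fat vertex separates \<open>x\<close> and \<open>y\<close>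
          from the rest.\<close>
        let ?W = "insert y {p \<in> V. p \<noteq> x \<and> M y p \<noteq> 0}"
        obtain p q where "p \<in> {x, y}" "q \<in> V - {x, y}" "M p q \<noteq> of_bool (p \<in> ?W \<and> q \<in> ?W)"
        proof (rule irred_potential[of "{x, y}" ?W "\<lambda>_. 1" "{x, y}"])
          show "(\<Sum>q\<in>{x, y}. M p q * 1) = of_bool (p \<in> ?W)" if "p \<in> V" for p
            using that x y y2 yx only[OF that] pos[OF that] by (cases "p = x"; cases "p = y") auto
        qed (use x y False in auto)
        then show thesis
          using only[of q] pos[of q] x y by auto
      qed
    qed
  qed
qed

text \<open>The potential is 1 at \<open>b\<close>, 1/2 at \<open>l1\<close> and -1/2 at
  \<open>l2\<close>: it cancels at both leaves and leaves 2 - 1/2 - 1/2 = 1 at \<open>b\<close>. As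
  \<open>l1\<close> uses up the negative edge at \<open>b\<close>, the remaining edges at
  \<open>b\<close> are positive, so a fat vertex on \<open>b\<close> and its other neighbours splits
  off \<open>b\<close>, \<open>l1\<close>, \<open>l2\<close> whenever there is anything
  else.\<close>

lemma fork_signs:
  assumes b: "b \<in> V" "M b b = 2" and l: "l1 \<in> V" "l2 \<in> V" "M l1 l1 = 2" "M l2 l2 = 2"
    and dist: "distinct [b, l1, l2]"
    and leaf: "\<And>p. p \<in> V \<Longrightarrow> p \<noteq> b \<Longrightarrow> p \<noteq> l1 \<Longrightarrow> M l1 p = 0" "\<And>p. p \<in> V \<Longrightarrow> p \<noteq> b \<Longrightarrow> p \<noteq> l2 \<Longrightarrow> M l2 p = 0"
    and s: "M b l1 = -1" "M b l2 = 1"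
  shows "V = {b, l1, l2}"
proof (rule ccontr)
  assume ne: "V \<noteq> {b, l1, l2}"
  let ?W = "insert b {p \<in> V. p \<noteq> l1 \<and> p \<noteq> l2 \<and> M b p \<noteq> 0}"
  let ?w = "\<lambda>p. if p = b then 1 else if p = l1 then 1/2 else - (1/2 :: real)"
  have s': "M l1 b = -1" "M l2 b = 1"
    using s sym by metis+
  have leaf': "M l1 p = 0" "M p l1 = 0" "M l2 p = 0" "M p l2 = 0" if "p \<in> V" "p \<notin> {b, l1, l2}" for p
    using leaf[of p] that sym[of p l1] sym[of p l2] by auto
  have l12: "M l1 l2 = 0" "M l2 l1 = 0"
    using leaf(1)[of l2] leaf(2)[of l1] l dist by auto
  have pos: "M b p = of_bool (M b p \<noteq> 0)" "M p b = of_bool (M b p \<noteq> 0)" if "p \<in> V" "p \<notin> {b, l1, l2}" for p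
    using offdiag[of b p] one_neg[OF b(1) that(1) l(1) b(2) _ s(1)] that b sym[of p b] by auto
  obtain p q where "p \<in> {b, l1, l2}" "q \<in> V - {b, l1, l2}" "M p q \<noteq> of_bool (p \<in> ?W \<and> q \<in> ?W)"
  proof (rule irred_potential[of "{b, l1, l2}" ?W ?w "{b, l1, l2}"])
    show "(\<Sum>q\<in>{b, l1, l2}. M p q * ?w q) = of_bool (p \<in> ?W)" if "p \<in> V" for p
    proof -
      consider "p = b" | "p = l1" | "p = l2" | "p \<notin> {b, l1, l2}"
        by auto
      then show ?thesis
        using that dist b l s s' l12 leaf'[OF that] pos[OF that] by cases auto
    qed
  qed (use b l dist ne in auto)
  then show False
    using leaf'[of q] pos[of q] dist by auto
qed

text \<open>Two negative edges at \<open>b\<close> contradict \<open>one_neg\<close>, and mixed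
  signs are \<open>fork_signs\<close>. The path on three vertices remains, since there the part to
  be split off is everything.\<close>

lemma fork:
  assumes b: "b \<in> V" "M b b = 2" and l: "l1 \<in> V" "l2 \<in> V" "M l1 l1 = 2" "M l2 l2 = 2"
    and dist: "distinct [b, l1, l2]"
    and leaf: "\<And>p. p \<in> V \<Longrightarrow> p \<noteq> b \<Longrightarrow> p \<noteq> l1 \<Longrightarrow> M l1 p = 0" "\<And>p. p \<in> V \<Longrightarrow> p \<noteq> b \<Longrightarrow> p \<noteq> l2 \<Longrightarrow> M l2 p = 0"
    and e: "M b l1 \<noteq> 0" "M b l2 \<noteq> 0"
  shows "V = {b, l1, l2}"
proof -
  have "M b l1 = 1 \<or> M b l1 = -1" "M b l2 = 1 \<or> M b l2 = -1"
    using offdiag[of b l1] offdiag[of b l2] b l dist e by auto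
  moreover have "\<not> (M b l1 = -1 \<and> M b l2 = -1)"
    using one_neg[OF b(1) l(1,2) b(2)] dist by auto
  ultimately consider "M b l1 = -1" "M b l2 = 1" | "M b l2 = -1" "M b l1 = 1" | "M b l1 = 1" "M b l2 = 1"
    by auto
  then show ?thesis
  proof cases
    case 1
    then show ?thesis
      using fork_signs[OF b l dist leaf] by blast
  next
    case 2
    then have "V = {b, l2, l1}"
      using dist by (intro fork_signs[OF b l(2,1,4,3) _ leaf(2,1)]) auto
    then show ?thesis
      by (simp add: insert_commute)
  next
    case 3
    then have s': "M l1 b = 1" "M l2 b = 1"
      using sym by metis+
    have leaf': "M l1 p = 0" "M p l1 = 0" "M l2 p = 0" "M p l2 = 0" if "p \<in> V" "p \<notin> {b, l1, l2}" for p
      using leaf[of p] that sym[of p l1] sym[of p l2] by auto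
    have l12: "M l1 l2 = 0" "M l2 l1 = 0"
      using leaf(1)[of l2] leaf(2)[of l1] l dist by auto
    \<comment> \<open>Both edges positive: 1/2 on each leaf is mapped to the indicator of
      \<open>b\<close>, \<open>l1\<close>, \<open>l2\<close>, and a fat vertex there cuts the two
      leaves off from \<open>b\<close>. So this case cannot occur at all.\<close>
    obtain p q where "p \<in> {l1, l2}" "q \<in> V - {l1, l2}"
      "M p q \<noteq> of_bool (p \<in> {b, l1, l2} \<and> q \<in> {b, l1, l2})"
    proof (rule irred_potential[of "{l1, l2}" "{b, l1, l2}" "\<lambda>_. 1/2" "{l1, l2}"])
      show "(\<Sum>q\<in>{l1, l2}. M p q * (1/2)) = of_bool (p \<in> {b, l1, l2})" if "p \<in> V" for p
        using that dist b l 3 s' l12 leaf'[OF that] by auto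
    qed (use b l dist in auto)
    then show ?thesis
      using leaf'[of q] s' dist by (cases "q = b") auto
  qed
qed

section \<open>Lower bounds for the form when a vertex is attached\<close>

lemma bil_attach:
  assumes "conn X" "X \<subseteq> V" "z \<in> V - X" "y \<in> X" "M z y \<noteq> 0"
  shows "bil (insert z X) M v v = bil X M v v + M z z * (v z)\<^sup>2 + 2 * M z y * v z * v y"
proof -
  have f: "finite X"
    using fin_sub assms(2) .
  have "(\<Sum>w\<in>X. M z w * v w) = (\<Sum>w\<in>{y}. M z w * v w)"
    using attach_zero[OF assms(1-5)] assms(4) f by (intro sum.mono_neutral_right) auto
  then have s: "(\<Sum>w\<in>X. M z w * v w) = M z y * v y"
    by simp
  have "(\<Sum>w\<in>X. v w * M w z) = (\<Sum>w\<in>X. M z w * v w)"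
    by (intro sum.cong refl) (simp add: sym mult.commute)
  then have s': "(\<Sum>w\<in>X. v w * M w z) = M z y * v y"
    using s by simp
  have "bil (insert z X) M v v = v z * (M z z * v z + M z y * v y) +
      (\<Sum>w\<in>X. v w * (M w z * v z + (\<Sum>y\<in>X. M w y * v y)))"
    using assms(3) f by (simp add: bil_def s)
  also have "(\<Sum>w\<in>X. v w * (M w z * v z + (\<Sum>y\<in>X. M w y * v y))) =
      (\<Sum>w\<in>X. v w * M w z) * v z + bil X M v v"
    by (simp add: bil_def distrib_left sum.distrib sum_distrib_right mult.assoc)
  finally show ?thesis
    unfolding s' by (simp add: power2_eq_square algebra_simps)
qed

text \<open>The square is completed in two ways. Eliminating the old vertex \<open>y\<close> leaves
  2 - 1/c at \<open>z\<close>, which moves the bound along a path; eliminating the new vertex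
  \<open>z\<close> leaves c - 1/2 at \<open>y\<close>, which absorbs a pendant vertex.\<close>

lemma bound_attach:
  assumes X: "conn X" "X \<subseteq> V" "z \<in> V - X" "y \<in> X" "M z y \<noteq> 0" and z: "M z z = 2"
    and c: "\<And>v. c * (v y)\<^sup>2 \<le> bil X M v v"
  shows "c > 0 \<Longrightarrow> (2 - 1 / c) * (v z)\<^sup>2 \<le> bil (insert z X) M v v"
    and "(c - 1 / 2) * (v y)\<^sup>2 \<le> bil (insert z X) M v v"
proof -
  have m: "M z y * M z y = 1"
  proof -
    have "z \<in> V" "y \<in> V" "z \<noteq> y"
      using X by auto
    then show ?thesis
      using offdiag[of z y] X(5) by auto
  qed
  have b: "c * (v y)\<^sup>2 + 2 * (v z)\<^sup>2 + 2 * M z y * v z * v y \<le> bil (insert z X) M v v"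
    unfolding bil_attach[OF X] z using c[of v] by simp
  {
    assume "c > 0"
    have "c * (v y + M z y * v z / c)\<^sup>2 = c * (v y)\<^sup>2 + 2 * M z y * v z * v y + (M z y * M z y) * (v z)\<^sup>2 / c"
      using \<open>c > 0\<close> by (simp add: power2_eq_square field_simps)
    moreover have "0 \<le> c * (v y + M z y * v z / c)\<^sup>2"
      using \<open>c > 0\<close> by simp
    ultimately have "0 \<le> c * (v y)\<^sup>2 + 2 * M z y * v z * v y + (v z)\<^sup>2 / c"
      unfolding m by simp
    then show "(2 - 1 / c) * (v z)\<^sup>2 \<le> bil (insert z X) M v v"
      using b by (simp add: left_diff_distrib)
  }
  have "2 * (v z + M z y * v y / 2)\<^sup>2 = 2 * (v z)\<^sup>2 + 2 * M z y * v z * v y + (M z y * M z y) * (v y)\<^sup>2 / 2"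
    by (simp add: power2_eq_square field_simps)
  then have "0 \<le> 2 * (v z)\<^sup>2 + 2 * M z y * v z * v y + (v y)\<^sup>2 / 2"
    unfolding m by (metis mult_1 mult_nonneg_nonneg zero_le_numeral zero_le_power2)
  then show "(c - 1 / 2) * (v y)\<^sup>2 \<le> bil (insert z X) M v v"
    using b by (simp add: left_diff_distrib)
qed

lemma not_bounded:
  assumes "x \<in> V" "1 / 3 \<le> c" "\<And>v. c * (v x)\<^sup>2 \<le> bil V M v v" shows False
proof -
  obtain v where v: "bil V M v v < (v x)\<^sup>2 / 3"
    using maximal[OF assms(1)] by blast
  have "1 / 3 * (v x)\<^sup>2 \<le> c * (v x)\<^sup>2"
    using assms(2) by (rule mult_right_mono) simp
  then show False
    using v assms(3)[of v] by simp
qed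

end

text \<open>The hypothesis of \<open>positive_null_vector\<close> for diagonal entries 2, so the
  weights are the marks of an affine Dynkin diagram. The quantifiers range over list sets to be
  executable.\<close>

definition null_weights :: "nat list \<Rightarrow> nat list \<Rightarrow> bool" where
  "null_weights ps us \<longleftrightarrow> ps \<noteq> [] \<and> length us = length ps \<and>
     (\<forall>i\<in>set [1..<length ps]. ps ! i < i) \<and>
     (\<forall>i\<in>set [0..<length ps]. 0 < us ! i \<and>
        sum_list (map (\<lambda>j. if j = i then 2 * us ! i
          else if j < i \<and> ps ! i = j \<or> i < j \<and> ps ! j = i then us ! j else 0) [0..<length ps]) = 4 * us ! i)"

text \<open>Centre first, then the arms one after another, each outwards. This is the order of
  \<open>star_vertices\<close>, so that the trees can be matched position by position.\<close>

abbreviation E6_parents :: "nat list" where "E6_parents \<equiv> [0, 0, 1, 0, 3, 0, 5]"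
abbreviation E7_parents :: "nat list" where "E7_parents \<equiv> [0, 0, 0, 2, 3, 0, 5, 6]"
abbreviation E8_parents :: "nat list" where "E8_parents \<equiv> [0, 0, 0, 2, 0, 4, 5, 6, 7]"

lemma null_weights_E:
  "null_weights E6_parents [3, 2, 1, 2, 1, 2, 1]"
  "null_weights E7_parents [4, 2, 3, 2, 1, 3, 2, 1]"
  "null_weights E8_parents [6, 3, 4, 2, 5, 4, 3, 2, 1]"
  by code_simp+

text \<open>Affine D4, D5 and D6. Larger D types do not arise, because the two branch vertices lie
  inside a path of at most seven vertices, at distance at least two from its ends.\<close>

lemma null_weights_D:
  "null_weights [0, 0, 0, 0, 0] [2, 1, 1, 1, 1]"
  "null_weights [0, 0, 0, 0, 1, 1] [2, 2, 1, 1, 1, 1]"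
  "null_weights [0, 0, 1, 0, 0, 2, 2] [2, 2, 2, 1, 1, 1, 1]"
  by code_simp+

lemma image_rev:
  fixes m :: nat
  shows "(\<lambda>i. q (m - i)) ` {..m} = q ` {..m}"
proof (intro subset_antisym image_subsetI)
  fix i assume "i \<in> {..m}"
  then show "q i \<in> (\<lambda>i. q (m - i)) ` {..m}"
    by (intro image_eqI[of _ _ "m - i"]) auto
qed auto

section \<open>Trees with all diagonal entries 2\<close>

locale regular_tree = special_tree +
  assumes diag2: "x \<in> V \<Longrightarrow> M x x = 2"
begin

text \<open>Every initial segment of the list is connected, so by \<open>attach\<close> the parent
  of a vertex is its only earlier neighbour. Nonadjacency thus follows from the tree edges.\<close>

lemma tree_listI:
  assumes "distinct xs" "set xs \<subseteq> V" "length ps = length xs"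
    and par: "\<And>i. i < length xs \<Longrightarrow> i \<noteq> 0 \<Longrightarrow> ps ! i < i \<and> M (xs ! i) (xs ! (ps ! i)) \<noteq> 0"
  shows "tree_list M xs ps" "conn (set xs)"
proof -
  have take: "set (take (Suc i) xs) = insert (xs ! i) (set (take i xs))" if "i < length xs" for i
    using that by (simp add: take_Suc_conv_app_nth)
  have nth: "xs ! j \<in> set (take i xs)" if "j < i" "i \<le> length xs" for i j
    using that by (metis in_set_conv_nth length_take min.absorb2 nth_take)
  have new: "xs ! i \<in> V - set (take i xs)" if "i < length xs" for i
    using that assms(1) subsetD[OF assms(2) nth_mem[OF that]]
    by (auto simp: in_set_conv_nth nth_eq_iff_index_eq)
  have conn: "conn (set (take i xs))" if "i \<le> length xs" for i
    using that
  proof (induction i)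
    case 0
    then show ?case
      by (simp add: conn_in_def)
  next
    case (Suc i)
    show ?case
    proof (cases "i = 0")
      case True
      then have "set (take (Suc i) xs) = {xs ! i}"
        using take[OF Suc_le_lessD[OF Suc.prems]] by (simp only: True take_0 list.set)
      then show ?thesis
        by (simp only: conn_in_singleton)
    next
      case False
      then show ?thesis
        using take[of i] Suc par[of i] nth[of "ps ! i" i] conn_insert by auto
    qed
  qed
  show "conn (set xs)"
    using conn[of "length xs"] by simp
  have adj: "M (xs ! i) (xs ! j) \<noteq> 0 \<longleftrightarrow> ps ! i = j" if "j < i" "i < length xs" for i j
  proof (cases "ps ! i = j")
    case True
    then show ?thesis
      using par[of i] that by auto
  next
    case False
    have "M (xs ! i) (xs ! j) = 0"
    proof (rule attach_zero[of "set (take i xs)" _ "xs ! (ps ! i)"])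
      show "set (take i xs) \<subseteq> V"
        using assms(2) set_take_subset by fast
      show "xs ! j \<noteq> xs ! (ps ! i)"
        using False that par[of i] assms(1) by (simp add: nth_eq_iff_index_eq)
    qed (use conn new nth that par[of i] in auto)
    then show ?thesis
      using False by simp
  qed
  show "tree_list M xs ps"
    unfolding tree_list_def
  proof (intro conjI allI impI assms(1,3))
    fix i j assume ij: "i < length xs" "j < length xs" "i \<noteq> j"
    then consider "i < j" | "j < i"
      by linarith
    then show "M (xs ! i) (xs ! j) \<noteq> 0 \<longleftrightarrow> (j < i \<and> ps ! i = j) \<or> (i < j \<and> ps ! j = i)"
      by cases (use adj[of i j] adj[of j i] ij sym[of "xs ! i" "xs ! j"] in auto)
  qed
qed

text \<open>It suffices to find the edges of an affine diagram: \<open>tree_listI\<close> supplies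
  nonadjacency, and \<open>positive_null_vector\<close> shows that there is no further vertex. The
  edges are stated with \<open>zip\<close> and \<open>list_all\<close> so that simplification
  unfolds them for explicit lists.\<close>

lemma null_tree:
  assumes w: "null_weights ps us" and len: "length xs = length ps"
    and xs: "distinct xs" "set xs \<subseteq> V"
    and e: "list_all (\<lambda>(x, p). M x (xs ! p) \<noteq> 0) (zip (tl xs) (tl ps))"
  shows "set xs = V \<and> tree_list M xs ps"
proof -
  have us: "length us = length ps" "xs \<noteq> []"
    using w len by (auto simp: null_weights_def)
  have par: "ps ! i < i \<and> M (xs ! i) (xs ! (ps ! i)) \<noteq> 0" if i: "i < length xs" "i \<noteq> 0" for i
  proof -
    obtain k where k: "i = Suc k"
      using i(2) not0_implies_Suc by blast
    then have z: "zip (tl xs) (tl ps) ! k = (xs ! i, ps ! i)" "k < length (zip (tl xs) (tl ps))"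
      using i len by (auto simp: nth_tl)
    have "case zip (tl xs) (tl ps) ! k of (x, p) \<Rightarrow> M x (xs ! p) \<noteq> 0"
      using e z(2) by (simp only: list_all_length)
    then have "M (xs ! i) (xs ! (ps ! i)) \<noteq> 0"
      unfolding z(1) by simp
    then show ?thesis
      using w i len by (auto simp: null_weights_def)
  qed
  note tree = tree_listI[OF xs len[symmetric] par]
  define u where "u x = real (the (map_of (zip xs us) x))" for x
  have u: "u (xs ! i) = real (us ! i)" if "i < length xs" for i
    unfolding u_def using that xs(1) len us(1) by (simp add: map_of_zip_nth)
  have "V = set xs"
  proof (rule positive_null_vector[OF xs(2) _ tree(2), of u])
    show "set xs \<noteq> {}"
      using us by simp
    fix x assume "x \<in> set xs"
    then obtain i where i: "i < length xs" "x = xs ! i"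
      by (auto simp: in_set_conv_nth)
    then show "0 < u x"
      using w len u[of i] by (auto simp: null_weights_def)
    have V: "xs ! j \<in> V" if "j < length xs" for j
      using that xs(2) by auto
    have "(\<Sum>y\<in>set xs. \<bar>M x y\<bar> * u y) = (\<Sum>j<length xs. \<bar>M x (xs ! j)\<bar> * u (xs ! j))"
      using sum.reindex_bij_betw[OF bij_betw_nth[OF xs(1) refl refl], of "\<lambda>y. \<bar>M x y\<bar> * u y"] by simp
    also have "\<dots> = (\<Sum>j<length xs. real (if j = i then 2 * us ! i
        else if j < i \<and> ps ! i = j \<or> i < j \<and> ps ! j = i then us ! j else 0))"
    proof (intro sum.cong refl)
      fix j assume "j \<in> {..<length xs}"
      then have j: "j < length xs"
        by simp
      show "\<bar>M x (xs ! j)\<bar> * u (xs ! j) = real (if j = i then 2 * us ! i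
          else if j < i \<and> ps ! i = j \<or> i < j \<and> ps ! j = i then us ! j else 0)"
      proof (cases "j = i")
        case True
        then show ?thesis
          using i diag2[OF V[OF j]] u[OF j] by simp
      next
        case False
        then have "x \<noteq> xs ! j"
          using i j xs(1) by (simp add: nth_eq_iff_index_eq)
        then have "\<bar>M x (xs ! j)\<bar> = (if M x (xs ! j) \<noteq> 0 then 1 else 0)"
          using offdiag[of x "xs ! j"] V[OF j] V[OF i(1)] i(2) by auto
        moreover have "M x (xs ! j) \<noteq> 0 \<longleftrightarrow> (j < i \<and> ps ! i = j) \<or> (i < j \<and> ps ! j = i)"
          using tree(1) i j False unfolding tree_list_def by auto
        ultimately show ?thesis
          using False u[OF j] by auto
      qed
    qed
    also have "\<dots> = real (sum_list (map (\<lambda>j. if j = i then 2 * us ! i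
          else if j < i \<and> ps ! i = j \<or> i < j \<and> ps ! j = i then us ! j else 0) [0..<length ps]))"
      unfolding of_nat_sum[symmetric] by (simp add: len interv_sum_list_conv_sum_set_nat atLeast0LessThan)
    also have "\<dots> = real (4 * us ! i)"
      using w i len by (auto simp: null_weights_def)
    finally show "(\<Sum>y\<in>set xs. \<bar>M x y\<bar> * u y) = 2 * M x x * u x"
      using diag2[OF V[OF i(1)]] u[OF i(1)] i(2) by simp
  qed
  then show ?thesis
    using tree(1) by simp
qed

section \<open>Longest paths\<close>

definition path :: "(nat \<Rightarrow> 'a) \<Rightarrow> nat \<Rightarrow> bool" where
  "path q n \<longleftrightarrow> q ` {..n} \<subseteq> V \<and> inj_on q {..n} \<and> (\<forall>i<n. M (q i) (q (Suc i)) \<noteq> 0)"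

definition longest :: "(nat \<Rightarrow> 'a) \<Rightarrow> nat \<Rightarrow> bool" where
  "longest q m \<longleftrightarrow> path q m \<and> (\<forall>q' n. path q' n \<longrightarrow> n \<le> m)"

lemma path_in: "path q n \<Longrightarrow> i \<le> n \<Longrightarrow> q i \<in> V"
  by (auto simp: path_def)

lemma path_eq: "path q n \<Longrightarrow> i \<le> n \<Longrightarrow> j \<le> n \<Longrightarrow> q i = q j \<longleftrightarrow> i = j"
  by (auto simp: path_def inj_on_def)

lemma path_edge: "path q n \<Longrightarrow> i < n \<Longrightarrow> M (q i) (q (Suc i)) \<noteq> 0" "path q n \<Longrightarrow> i < n \<Longrightarrow> M (q (Suc i)) (q i) \<noteq> 0"
  using sym by (auto simp: path_def)

lemma path_rev: "path q n \<Longrightarrow> path (\<lambda>i. q (n - i)) n"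
  unfolding path_def
proof (intro conjI allI impI; elim conjE)
  assume q: "q ` {..n} \<subseteq> V" "inj_on q {..n}" "\<forall>i<n. M (q i) (q (Suc i)) \<noteq> 0"
  show "(\<lambda>i. q (n - i)) ` {..n} \<subseteq> V"
    using q(1) by auto
  show "inj_on (\<lambda>i. q (n - i)) {..n}"
  proof (rule inj_onI)
    fix x y assume xy: "x \<in> {..n}" "y \<in> {..n}" "q (n - x) = q (n - y)"
    then have "n - x = n - y"
      using inj_onD[OF q(2)] by auto
    then show "x = y"
      using xy by auto
  qed
  fix i assume "i < n"
  then have "M (q (n - Suc i)) (q (Suc (n - Suc i))) \<noteq> 0" "Suc (n - Suc i) = n - i"
    using q(3) by auto
  then show "M (q (n - i)) (q (n - Suc i)) \<noteq> 0"
    using sym by metis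
qed

lemma path_new:
  assumes "path q n" "Suc k \<le> n" shows "q (Suc k) \<in> V - q ` {..k}"
proof -
  have "q x \<noteq> q (Suc k)" if "x \<le> k" for x
    using path_eq[OF assms(1)] that assms(2) by auto
  then show ?thesis
    using path_in[OF assms] by force
qed

lemma path_list:
  assumes "path q n" "distinct is" "list_all (\<lambda>i. i \<le> n) is"
  shows "distinct (map q is)" "set (map q is) \<subseteq> V"
    "x \<in> V - q ` {..n} \<Longrightarrow> list_all (\<lambda>y. x \<noteq> y \<and> y \<noteq> x) (map q is)"
proof -
  have "set is \<subseteq> {..n}"
    using assms(3) by (auto simp: list_all_iff)
  then show "distinct (map q is)" "set (map q is) \<subseteq> V"
    using assms(1,2) inj_on_subset[of q "{..n}"] by (auto simp: path_def distinct_map)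
  show "x \<in> V - q ` {..n} \<Longrightarrow> list_all (\<lambda>y. x \<noteq> y \<and> y \<noteq> x) (map q is)"
    using assms(3) by (auto simp: list_all_iff)
qed

lemma path_tl: "path q (Suc n) \<Longrightarrow> path (\<lambda>i. q (Suc i)) n"
  by (auto simp: path_def inj_on_def)

lemma longest_rev: "longest q m \<Longrightarrow> longest (\<lambda>i. q (m - i)) m"
  by (simp add: longest_def path_rev)

lemma exists_longest: "\<exists>q m. longest q m"
proof -
  obtain x where "x \<in> V"
    using nonempty by blast
  then have 0: "\<exists>q. path q 0"
    by (intro exI[of _ "\<lambda>_. x"]) (simp add: path_def)
  have "n \<le> card V" if n: "\<exists>q. path q n" for n
  proof -
    obtain q where "path q n"
      using n by blast
    then have "q ` {..n} \<subseteq> V" "card (q ` {..n}) = Suc n"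
      by (auto simp: path_def card_image)
    then show ?thesis
      using card_mono[OF fin, of "q ` {..n}"] by simp
  qed
  then have "\<exists>m. (\<exists>q. path q m) \<and> (\<forall>n. (\<exists>q. path q n) \<longrightarrow> n \<le> m)"
    using Nat.ex_has_greatest_nat[of "\<lambda>n. \<exists>q. path q n" 0 "card V"] 0 by simp
  then show ?thesis
    by (auto simp: longest_def)
qed

lemma path_conn:
  assumes "path q n" "i \<le> j" "j \<le> n" shows "conn (q ` {i..j})"
  using assms(2,3)
proof (induction j rule: dec_induct)
  case base
  then show ?case
    by (simp add: conn_in_singleton)
next
  case (step j)
  have "q ` {i..Suc j} = insert (q (Suc j)) (q ` {i..j})"
    using step by (simp add: atLeastAtMostSuc_conv)
  then show ?case
    using conn_insert[of "q ` {i..j}" "q j" "q (Suc j)"] step path_edge(2)[OF assms(1), of j] by auto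
qed

lemma path_nonadj:
  assumes "path q n" "Suc i < j" "j \<le> n" shows "M (q i) (q j) = 0"
proof -
  have "M (q j) (q i) = 0"
  proof (rule attach_zero[of "q ` {i..j - 1}" _ "q (j - 1)"])
    show "conn (q ` {i..j - 1})"
      using assms by (intro path_conn) auto
    show "M (q j) (q (j - 1)) \<noteq> 0"
      using path_edge(2)[OF assms(1), of "j - 1"] assms by simp
    show "q j \<in> V - q ` {i..j - 1}"
      using assms path_in[OF assms(1,3)] by (auto simp: path_eq[OF assms(1)])
    show "q i \<noteq> q (j - 1)"
      using assms by (subst path_eq[OF assms(1)]) auto
    show "q ` {i..j - 1} \<subseteq> V"
      using assms path_in[OF assms(1)] by auto
  qed (use assms in auto)
  then show ?thesis
    using sym by metis
qed

lemma path_attach: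
  assumes "path q n" "z \<in> V - q ` {..n}" "c \<le> n" "M z (q c) \<noteq> 0" "j \<le> n" "j \<noteq> c"
  shows "M z (q j) = 0"
proof (rule attach_zero[of "q ` {0..n}" _ "q c"])
  show "q j \<noteq> q c"
    using assms path_eq by auto
  show "q ` {0..n} \<subseteq> V"
    using path_in[OF assms(1)] by auto
qed (use assms path_conn[OF assms(1), of 0 n] in \<open>auto simp: atLeast0AtMost\<close>)

lemma path_Cons:
  assumes "path q n" "z \<in> V - q ` {..n}" "M z (q 0) \<noteq> 0"
  shows "path (case_nat z q) (Suc n)"
proof -
  have "case_nat z q ` {..Suc n} = insert z (q ` {..n})"
    by (simp add: atMost_Suc_eq_insert_0 image_image)
  moreover have "inj_on (case_nat z q) {..Suc n}"
    unfolding atMost_Suc_eq_insert_0 using assms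
    by (auto simp: path_def inj_on_def)
  moreover have "M (case_nat z q i) (case_nat z q (Suc i)) \<noteq> 0" if "i < Suc n" for i
    using that assms by (cases i) (auto simp: path_def)
  ultimately show ?thesis
    using assms by (auto simp: path_def)
qed

text \<open>A neighbour off the path would prolong it, and \<open>path_nonadj\<close> leaves only
  \<open>q 1\<close> on the path.\<close>

lemma end_leaf:
  assumes "longest q m" "p \<in> V" "p \<noteq> q 0" "M (q 0) p \<noteq> 0"
  shows "1 \<le> m \<and> p = q 1"
proof -
  have q: "path q m"
    using assms(1) by (simp add: longest_def)
  have "p \<in> q ` {..m}"
  proof (rule ccontr)
    assume "p \<notin> q ` {..m}"
    then have "path (case_nat p q) (Suc m)"
      using assms sym[of p "q 0"] by (intro path_Cons q) auto
    then show False
      using assms(1) by (force simp: longest_def)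
  qed
  then obtain j where j: "j \<le> m" "p = q j"
    by auto
  with assms(3) have "j \<noteq> 0"
    by (intro notI) simp
  moreover have "\<not> Suc 0 < j"
    using path_nonadj[OF q _ j(1), of 0] assms(4) j(2) by auto
  ultimately have "j = 1"
    by simp
  then show ?thesis
    using j by simp
qed

text \<open>\<open>q 0\<close> is a leaf, and so is \<open>z\<close>: a further neighbour
  \<open>w\<close> of \<open>z\<close> would give the path w, z, q 1, q 2, ... with m + 1 edges.
  With two leaves at \<open>q 1\<close>, \<open>fork\<close> exhausts the graph, although
  \<open>q 2\<close> is left over.\<close>

lemma fork_near_end:
  assumes q: "longest q m" and z: "z \<in> V - q ` {..m}" "M (q 1) z \<noteq> 0" and m: "2 \<le> m"
  shows False
proof -
  have p: "path q m"
    using q by (simp add: longest_def)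
  have V: "q 0 \<in> V" "q 1 \<in> V" "q 2 \<in> V"
    using path_in[OF p] m by auto
  have zq: "z \<noteq> q j" if "j \<le> m" for j
    using z that by auto
  have ne: "q 1 \<noteq> q 0" "q 2 \<noteq> q 0" "q 2 \<noteq> q 1"
    using path_eq[OF p] m by auto
  have z1: "M z (q 1) \<noteq> 0"
    using z sym by metis
  have "V = {q 1, q 0, z}"
  proof (rule fork)
    show "M (q 0) w = 0" if "w \<in> V" "w \<noteq> q 1" "w \<noteq> q 0" for w
      using end_leaf[OF q, of w] that by auto
    show "M z w = 0" if w: "w \<in> V" "w \<noteq> q 1" "w \<noteq> z" for w
    proof (rule ccontr)
      assume zw: "M z w \<noteq> 0"
      have wq: "w \<notin> q ` {..m}"
        using path_attach[OF p z(1) _ z1] w zw m by auto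
      let ?q = "\<lambda>i. q (Suc i)"
      have "path ?q (m - 1)"
        using path_tl[of q "m - 1"] p m by simp
      moreover have im: "?q ` {..m - 1} \<subseteq> q ` {..m}"
        using m by auto
      ultimately have 1: "path (case_nat z ?q) (Suc (m - 1))"
        using z z1 by (intro path_Cons) auto
      have "path (case_nat w (case_nat z ?q)) (Suc (Suc (m - 1)))"
      proof (rule path_Cons[OF 1])
        have "case_nat z ?q ` {..Suc (m - 1)} = insert z (?q ` {..m - 1})"
          unfolding atMost_Suc_eq_insert_0 by (simp add: image_image)
        then show "w \<in> V - case_nat z ?q ` {..Suc (m - 1)}"
          using w wq im by auto
        show "M w (case_nat z ?q 0) \<noteq> 0"
          using zw sym by simp
      qed
      then show False
        using q m by (force simp: longest_def)
    qed
    show "M (q 1) (q 0) \<noteq> 0"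
      using path_edge(2)[OF p, of 0] m by simp
  qed (use V ne z zq[of 0] zq[of 1] m diag2 in auto)
  then show False
    using V(3) ne zq[of 2] m by auto
qed

lemma branch_inner:
  assumes q: "longest q m" and z: "z \<in> V - q ` {..m}" "M (q c) z \<noteq> 0" and c: "c \<le> m"
  shows "2 \<le> c \<and> c + 2 \<le> m"
proof -
  \<comment> \<open>The last condition supplies \<open>2 \<le> m\<close> when \<open>c = 1\<close>,
    as \<open>fork_near_end\<close> requires.\<close>
  have half: "2 \<le> c" if "longest q m" "z \<in> V - q ` {..m}" "M (q c) z \<noteq> 0" "c < m \<or> c = 0" for q c
  proof -
    have "z \<noteq> q 0" "1 \<le> m \<Longrightarrow> z \<noteq> q 1"
      using that(2) by auto
    then have "c \<noteq> 0"
      using end_leaf[OF that(1), of z] that(2,3) by auto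
    moreover have "c \<noteq> 1"
      using fork_near_end[OF that(1,2)] that(3,4) by auto
    ultimately show ?thesis
      by simp
  qed
  have rev: "2 \<le> m - c" if "0 < c \<or> c = m"
    using half[OF longest_rev[OF q], of "m - c"] that z c by (auto simp: image_rev)
  have "c \<noteq> m"
    using rev by auto
  then have "2 \<le> c"
    using half[OF q z] c by simp
  then show ?thesis
    using rev c by auto
qed

text \<open>\<open>c\<close> bounds from below the inverse of the diagonal entry at \<open>y\<close> of the inverse form on \<open>X\<close>.\<close>

definition bounded_at :: "real \<Rightarrow> 'a set \<Rightarrow> 'a \<Rightarrow> bool" where
  "bounded_at c X y \<longleftrightarrow> conn X \<and> X \<subseteq> V \<and> y \<in> X \<and> (\<forall>v. c * (v y)\<^sup>2 \<le> bil X M v v)"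

lemma bounded_at_singleton: "x \<in> V \<Longrightarrow> bounded_at 2 {x} x"
  by (simp add: bounded_at_def conn_in_singleton bil_def diag2 power2_eq_square)

lemma bounded_at_move:
  assumes "bounded_at c X y" "0 < c" "z \<in> V - X" "M z y \<noteq> 0"
  shows "bounded_at (2 - 1 / c) (insert z X) z"
  using assms bound_attach(1)[of X z y c] conn_insert[of X y z] diag2[of z] by (auto simp: bounded_at_def)

lemma bounded_at_stay:
  assumes "bounded_at c X y" "z \<in> V - X" "M z y \<noteq> 0"
  shows "bounded_at (c - 1 / 2) (insert z X) y"
  using assms bound_attach(2)[of X z y c] conn_insert[of X y z] diag2[of z] by (auto simp: bounded_at_def)

lemma not_bounded_at: "bounded_at c V y \<Longrightarrow> c < 1 / 3"
  using not_bounded[of y c] by (fastforce simp: bounded_at_def)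

text \<open>Type A: the bound starts with 2 and moves along the path by c -> 2 - 1/c, which
  preserves c >= 1. So it exceeds 1/3 at the far end.\<close>

lemma not_path:
  assumes "path q n" shows "V \<noteq> q ` {..n}"
proof -
  have "\<exists>c\<ge>1. bounded_at c (q ` {..k}) (q k)" if "k \<le> n" for k
    using that
  proof (induction k)
    case 0
    then show ?case
      using bounded_at_singleton[OF path_in[OF assms]] by (intro exI[of _ 2]) simp
  next
    case (Suc k)
    then obtain c where c: "1 \<le> c" "bounded_at c (q ` {..k}) (q k)"
      by auto
    have "bounded_at (2 - 1 / c) (insert (q (Suc k)) (q ` {..k})) (q (Suc k))"
    proof (rule bounded_at_move[OF c(2)])
      show "q (Suc k) \<in> V - q ` {..k}"
        using path_new[OF assms Suc.prems] .
    qed (use c path_edge[OF assms] Suc.prems in auto)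
    moreover have "1 \<le> 2 - 1 / c"
      using c(1) by (simp add: field_simps)
    ultimately show ?case
      unfolding atMost_Suc image_insert by blast
  qed
  then obtain c where "c \<ge> 1" "bounded_at c (q ` {..n}) (q n)"
    by blast
  then show ?thesis
    using not_bounded_at by force
qed

text \<open>Types E6, E7 and E8. The bound runs through 2, 3/2, 4/3 at \<open>q 0\<close>,
  \<open>q 1\<close>, \<open>q 2\<close>, drops to 5/6 by absorbing \<open>z\<close>, and continues
  with 4/5, 3/4, 2/3, 1/2 at \<open>q 3\<close> to \<open>q 6\<close>. The next value would be 0, at
  the end of an affine E8.\<close>

lemma not_short_arm:
  assumes q: "path q m" and z: "z \<in> V - q ` {..m}" "M z (q 2) \<noteq> 0" and m: "4 \<le> m" "m \<le> 6"
  shows "V \<noteq> insert z (q ` {..m})"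
proof
  assume V: "V = insert z (q ` {..m})"
  have new: "q (Suc k) \<in> V - q ` {..k}" "q (Suc k) \<in> V - insert z (q ` {..k})" if "Suc k \<le> m" for k
    using path_new[OF q that] z that by auto
  have step: "bounded_at (2 - 1 / c) (q ` {..Suc k}) (q (Suc k))"
    if "bounded_at c (q ` {..k}) (q k)" "0 < c" "Suc k \<le> m" for c k
    unfolding atMost_Suc image_insert
    using that new(1) path_edge(2)[OF q, of k] by (intro bounded_at_move) auto
  have step': "bounded_at (2 - 1 / c) (insert z (q ` {..Suc k})) (q (Suc k))"
    if "bounded_at c (insert z (q ` {..k})) (q k)" "0 < c" "Suc k \<le> m" for c k
    unfolding atMost_Suc image_insert insert_commute[of z]
    using that new(2) path_edge(2)[OF q, of k] by (intro bounded_at_move) auto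
  have "bounded_at 2 (q ` {..0}) (q 0)"
    using bounded_at_singleton[OF path_in[OF q]] by simp
  then have "bounded_at (4 / 3) (q ` {..2}) (q 2)"
    using step[of 2 0] step[of "3 / 2" 1] m by (simp add: numeral_2_eq_2)
  then have "bounded_at (5 / 6) (insert z (q ` {..2})) (q 2)"
    using bounded_at_stay[of "4 / 3" "q ` {..2}" "q 2" z] z m image_mono[of "{..2}" "{..m}" q] by auto
  then have b4: "bounded_at (3 / 4) (insert z (q ` {..4})) (q 4)"
    using step'[of "5 / 6" 2] step'[of "4 / 5" 3] m by simp
  consider "m = 4" | "m = 5" | "m = 6"
    using m by linarith
  then show False
  proof cases
    case 1
    then show ?thesis
      using not_bounded_at[of "3 / 4" "q 4"] b4 V by simp
  next
    case 2
    then show ?thesis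
      using not_bounded_at[of "2 / 3" "q 5"] step'[of "3 / 4" 4] b4 V by simp
  next
    case 3
    then show ?thesis
      using not_bounded_at[of "1 / 2" "q 6"] step'[of "3 / 4" 4] step'[of "2 / 3" 5] b4 V by simp
  qed
qed

section \<open>Affine E diagrams at a branch of a longest path\<close>

abbreviation has_affine_E :: bool where
  "has_affine_E \<equiv> \<exists>xs. set xs = V \<and>
     (tree_list M xs E6_parents \<or> tree_list M xs E7_parents \<or> tree_list M xs E8_parents)"

text \<open>By \<open>branch_inner\<close> both sides of \<open>q c\<close> have at least two edges.
  If \<open>z\<close> has another neighbour, the arms (2,2,2) appear; if c >= 3, the arms (1,3,3),
  as the first side is the shorter one; if c = 2 and m >= 7, the arms (1,2,5). In the remaining case
  \<open>not_short_arm\<close> supplies one more vertex.\<close>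

lemma affine_E_of_branch:
  assumes q: "longest q m" and z: "z \<in> V - q ` {..m}" "M (q c) z \<noteq> 0" and c: "2 * c \<le> m"
  shows has_affine_E
proof -
  have p: "path q m"
    using q by (simp add: longest_def)
  have c2: "2 \<le> c" "c + 2 \<le> m"
    using branch_inner[OF q z] c by auto
  note inV = path_in[OF p]
  note edge = path_edge[OF p]
  have zc: "M z (q c) \<noteq> 0"
    using z(2) sym by metis
  have zV: "z \<in> V"
    using z(1) by simp
  have zq: "z \<noteq> q j" "q j \<noteq> z" if "j \<le> m" for j
    using z that by auto
  show ?thesis
  proof (cases "\<exists>u\<in>V. u \<noteq> q c \<and> u \<noteq> z \<and> M z u \<noteq> 0")
    case True
    then obtain u where u: "u \<in> V" "u \<noteq> q c" "u \<noteq> z" "M z u \<noteq> 0"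
      by blast
    have uq: "u \<noteq> q j" "q j \<noteq> u" if "j \<le> m" for j
      using path_attach[OF p z(1) _ zc that] u c2 by auto
    obtain k where k: "c = k + 2"
      using c2 by (metis add.commute le_Suc_ex)
    have m4: "k + 4 \<le> m"
      using c2 k by simp
    have uV: "u \<in> V - q ` {..m}" and uz: "u \<noteq> z" "z \<noteq> u" "M u z \<noteq> 0"
      using uq u sym[of z u] by auto
    let ?xs = "[q (k + 2), z, u, q (k + 1), q k, q (k + 3), q (k + 4)]"
    have "set ?xs = V \<and> tree_list M ?xs E6_parents"
      proof (rule null_tree[OF null_weights_E(1)])
      have "distinct ([k + 2, k + 1, k, k + 3, k + 4] :: nat list)" "list_all (\<lambda>i. i \<le> m) [k + 2, k + 1, k, k + 3, k + 4]"
        using m4 by simp_all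
      note l = path_list[OF p this]
      show "distinct ?xs" "set ?xs \<subseteq> V"
        using l(1,2) l(3)[OF z(1)] zV l(3)[OF uV] uV uz by auto
      show "list_all (\<lambda>(x, p). M x (?xs ! p) \<noteq> 0) (zip (tl ?xs) (tl E6_parents))"
        using m4 edge[of k] edge[of "k + 1"] edge[of "k + 2"] edge[of "k + 3"] zc[unfolded k] uz by (simp add: eval_nat_numeral)
    qed simp
    then show ?thesis
      by blast
  next
    case False
    show ?thesis
    proof (cases "3 \<le> c")
      case True
      then obtain k where k: "c = k + 3"
        by (metis add.commute le_Suc_ex)
      then have m: "k + 6 \<le> m"
        using c by simp
      let ?xs = "[q (k + 3), z, q (k + 2), q (k + 1), q k, q (k + 4), q (k + 5), q (k + 6)]"
      have "set ?xs = V \<and> tree_list M ?xs E7_parents"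
        proof (rule null_tree[OF null_weights_E(2)])
        have "distinct ([k + 3, k + 2, k + 1, k, k + 4, k + 5, k + 6] :: nat list)" "list_all (\<lambda>i. i \<le> m) [k + 3, k + 2, k + 1, k, k + 4, k + 5, k + 6]"
          using m by simp_all
        note l = path_list[OF p this]
        show "distinct ?xs" "set ?xs \<subseteq> V"
          using l(1,2) l(3)[OF z(1)] zV by auto
        show "list_all (\<lambda>(x, p). M x (?xs ! p) \<noteq> 0) (zip (tl ?xs) (tl E7_parents))"
          using m edge[of k] edge[of "k + 1"] edge[of "k + 2"] edge[of "k + 3"] edge[of "k + 4"] edge[of "k + 5"] zc[unfolded k] by (simp add: eval_nat_numeral)
      qed simp
      then show ?thesis
        by blast
    next
      case c3: False
      then have c: "c = 2"
        using c2 by simp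
      show ?thesis
      proof (cases "7 \<le> m")
        case True
        let ?xs = "[q 2, z, q 1, q 0, q 3, q 4, q 5, q 6, q 7]"
        have "set ?xs = V \<and> tree_list M ?xs E8_parents"
          proof (rule null_tree[OF null_weights_E(3)])
          have "distinct ([2, 1, 0, 3, 4, 5, 6, 7] :: nat list)" "list_all (\<lambda>i. i \<le> m) [2, 1, 0, 3, 4, 5, 6, 7]"
            using True by simp_all
          note l = path_list[OF p this]
          show "distinct ?xs" "set ?xs \<subseteq> V"
            using l(1,2) l(3)[OF z(1)] zV by auto
          show "list_all (\<lambda>(x, p). M x (?xs ! p) \<noteq> 0) (zip (tl ?xs) (tl E8_parents))"
            using True edge[of 0] edge[of 1] edge[of 2] edge[of 3] edge[of 4] edge[of 5] edge[of 6] zc[unfolded c] by (simp add: eval_nat_numeral)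
        qed simp
        then show ?thesis
          by blast
      next
        case m: False
        have "V \<noteq> insert z (q ` {..m})"
          using not_short_arm[OF p z(1)] zc c c2 m by auto
        moreover have "insert z (q ` {..m}) \<subseteq> V"
          using zV inV by auto
        ultimately obtain x u where xu: "x \<in> insert z (q ` {..m})" "u \<in> V - insert z (q ` {..m})" "M x u \<noteq> 0"
          using outside[OF _ insert_not_empty] by metis
        then have "x \<noteq> z"
          using False c c2 by auto
        then obtain j where j: "x = q j" "j \<le> m"
          using xu(1) by auto
        have uj: "M u (q j) \<noteq> 0"
          using xu(3) j sym by metis
        have uq: "u \<noteq> q i" "q i \<noteq> u" if "i \<le> m" for i
          using xu(2) that by auto
        have uz: "u \<noteq> z" "z \<noteq> u"
          using xu(2) by auto
        have uV: "u \<in> V - q ` {..m}"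
          using xu(2) by auto
        have j2: "2 \<le> j" "j + 2 \<le> m"
          using branch_inner[OF q _ _ j(2), of u] xu j by auto
        \<comment> \<open>\<open>u\<close> branches off at \<open>q j\<close>. Together with
          \<open>z\<close> at \<open>q 2\<close> this gives an affine D4, D5 or D6, which must be
          all of \<open>V\<close> although it avoids the path end \<open>q 0\<close>.\<close>
        consider "j = 2" | "j = 3" | "j = 4"
          using j2 m by linarith
        then have "q 0 \<notin> V"
        proof cases
          case 1
          let ?xs = "[q 2, q 1, q 3, z, u]"
          have "set ?xs = V"
            proof (rule null_tree[OF null_weights_D(1), THEN conjunct1])
            have "distinct ([2, 1, 3] :: nat list)" "list_all (\<lambda>i. i \<le> m) [2, 1, 3]"
              using j2(2)[unfolded 1] by simp_all
            note l = path_list[OF p this]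
            show "distinct ?xs" "set ?xs \<subseteq> V"
              using l(1,2) l(3)[OF z(1)] zV l(3)[OF uV] uV uz by auto
            show "list_all (\<lambda>(x, p). M x (?xs ! p) \<noteq> 0) (zip (tl ?xs) (tl [0, 0, 0, 0, 0 :: nat]))"
              using j2(2)[unfolded 1] edge[of 1] edge[of 2] zc[unfolded c] uj[unfolded 1] by (simp add: eval_nat_numeral)
          qed simp
          then show ?thesis
            using zq[of 0] uq[of 0] path_list(1)[OF p, of "[0, 2, 1, 3]"] j2 1 by auto
        next
          case 2
          let ?xs = "[q 2, q 3, q 1, z, q 4, u]"
          have "set ?xs = V"
            proof (rule null_tree[OF null_weights_D(2), THEN conjunct1])
            have "distinct ([2, 3, 1, 4] :: nat list)" "list_all (\<lambda>i. i \<le> m) [2, 3, 1, 4]"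
              using j2(2)[unfolded 2] by simp_all
            note l = path_list[OF p this]
            show "distinct ?xs" "set ?xs \<subseteq> V"
              using l(1,2) l(3)[OF z(1)] zV l(3)[OF uV] uV uz by auto
            show "list_all (\<lambda>(x, p). M x (?xs ! p) \<noteq> 0) (zip (tl ?xs) (tl [0, 0, 0, 0, 1, 1 :: nat]))"
              using j2(2)[unfolded 2] edge[of 1] edge[of 2] edge[of 3] zc[unfolded c] uj[unfolded 2] by (simp add: eval_nat_numeral)
          qed simp
          then show ?thesis
            using zq[of 0] uq[of 0] path_list(1)[OF p, of "[0, 2, 3, 1, 4]"] j2 2 by auto
        next
          case 3
          let ?xs = "[q 2, q 3, q 4, q 1, z, q 5, u]"
          have "set ?xs = V"
            proof (rule null_tree[OF null_weights_D(3), THEN conjunct1])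
            have "distinct ([2, 3, 4, 1, 5] :: nat list)" "list_all (\<lambda>i. i \<le> m) [2, 3, 4, 1, 5]"
              using j2(2)[unfolded 3] by simp_all
            note l = path_list[OF p this]
            show "distinct ?xs" "set ?xs \<subseteq> V"
              using l(1,2) l(3)[OF z(1)] zV l(3)[OF uV] uV uz by auto
            show "list_all (\<lambda>(x, p). M x (?xs ! p) \<noteq> 0) (zip (tl ?xs) (tl [0, 0, 1, 0, 0, 2, 2 :: nat]))"
              using j2(2)[unfolded 3] edge[of 1] edge[of 2] edge[of 3] edge[of 4] zc[unfolded c] uj[unfolded 3] by (simp add: eval_nat_numeral)
          qed simp
          then show ?thesis
            using zq[of 0] uq[of 0] path_list(1)[OF p, of "[0, 2, 3, 4, 1, 5]"] j2 3 by auto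
        qed
        then show ?thesis
          using inV[of 0] by simp
      qed
    qed
  qed
qed

lemma affine_E: has_affine_E
proof -
  obtain q m where q: "longest q m"
    using exists_longest by blast
  then have p: "path q m"
    by (simp add: longest_def)
  obtain x z where xz: "x \<in> q ` {..m}" "z \<in> V - q ` {..m}" "M x z \<noteq> 0"
    using outside[of "q ` {..m}"] not_path[OF p] p by (auto simp: path_def)
  then obtain c where c: "x = q c" "c \<le> m"
    by auto
  show ?thesis
  proof (cases "2 * c \<le> m")
    case True
    then show ?thesis
      using affine_E_of_branch[OF q xz(2)] xz(3) c by blast
  next
    case False
    show ?thesis
      using affine_E_of_branch[OF longest_rev[OF q], of z "m - c"] xz c False by (simp add: image_rev)
  qed
qed

end

lemma (in special_tree) classification:
  obtains x where "V = {x}" "M x x = 0"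
  | x y where "x \<noteq> y" "V = {x, y}" "M x x = 1" "M y y = 1" "M x y = -1"
  | x y z where "distinct [x, y, z]" "V = {x, y, z}" "M x x = 1" "M y y = 2" "M z z = 2"
      "M x y = -1" "M x z \<noteq> 0" "M y z = 0"
  | xs where "\<And>x. x \<in> V \<Longrightarrow> M x x = 2" "set xs = V"
      "tree_list M xs E6_parents \<or> tree_list M xs E7_parents \<or> tree_list M xs E8_parents"
proof -
  consider x where "x \<in> V" "M x x = 0" | x where "x \<in> V" "M x x = 1" | "\<forall>x\<in>V. M x x = 2"
    using diag by blast
  then show thesis
  proof cases
    case 1
    then show thesis
      using that(1) diag0_singleton by blast
  next
    case 2
    then show thesis
      using that(2,3) diag1_cases[OF 2] by metis
  next
    case 3
    interpret regular_tree V M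
      by unfold_locales (use 3 in blast)
    show thesis
      using that(4) affine_E 3 by blast
  qed
qed

section \<open>Extensions of Hoffman graphs\<close>

lemma hoffman_embedding_iff:
  assumes "hoffman h" "hoffman h'"
  shows "hoffman_embedding \<phi> h h' \<longleftrightarrow> inj_on \<phi> (verts h) \<and> \<phi> ` slim h \<subseteq> slim h' \<and> \<phi> ` fat h \<subseteq> fat h' \<and>
    (\<forall>x\<in>verts h. \<forall>y\<in>verts h. adj h x y \<longleftrightarrow> adj h' (\<phi> x) (\<phi> y))"
proof -
  have U: "verts (induced h' (\<phi> ` verts h)) = verts h' \<inter> \<phi> ` verts h"
    by (auto simp: verts_def induced_def)
  have "slim h' \<inter> fat h' = {}"
    using hoffmanD(3)[OF assms(2)] .
  then show ?thesis
    unfolding hoffman_embedding_def hoffman_iso_def U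
    by (auto simp: induced_def verts_def bij_betw_def)
qed

text \<open>Extensions are built on \<open>'a option\<close>, whereas \<open>reducible\<close> and
  \<open>seedling\<close> quantify over graphs on \<open>nat\<close>; copies bridge the two
  types.\<close>

definition copy :: "('a \<Rightarrow> 'b) \<Rightarrow> 'a hoffman_graph \<Rightarrow> 'b hoffman_graph \<Rightarrow> bool" where
  "copy \<psi> g k \<longleftrightarrow> hoffman g \<and> hoffman k \<and> inj_on \<psi> (verts g) \<and> slim k = \<psi> ` slim g \<and> fat k = \<psi> ` fat g \<and>
     (\<forall>x\<in>verts g. \<forall>y\<in>verts g. adj k (\<psi> x) (\<psi> y) \<longleftrightarrow> adj g x y)"

lemma exists_nat_copy:
  fixes g :: "'a hoffman_graph"
  assumes g: "hoffman g"
  obtains k :: "nat hoffman_graph" and \<psi> where "copy \<psi> g k"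
proof -
  have "finite (verts g)"
    using hoffmanD(1,2)[OF g] by (simp add: verts_def)
  then obtain \<psi> :: "'a \<Rightarrow> nat" where inj: "inj_on \<psi> (verts g)"
    using finite_imp_inj_to_nat_seg by metis
  let ?k = "\<lparr>slim = \<psi> ` slim g, fat = \<psi> ` fat g,
    adj = (\<lambda>a b. \<exists>x\<in>verts g. \<exists>y\<in>verts g. a = \<psi> x \<and> b = \<psi> y \<and> adj g x y)\<rparr>"
  have a: "adj ?k (\<psi> x) (\<psi> y) \<longleftrightarrow> adj g x y" if "x \<in> verts g" "y \<in> verts g" for x y
    using that inj by (auto dest: inj_onD)
  have v: "slim g \<subseteq> verts g" "fat g \<subseteq> verts g"
    by (auto simp: verts_def)
  have "hoffman ?k"
    unfolding hoffman_def
  proof (intro conjI)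
    show "slim ?k \<inter> fat ?k = {}"
      using inj_on_image_Int[OF inj v] hoffmanD(3)[OF g] by simp
    show "\<forall>x y. adj ?k x y \<longrightarrow> adj ?k y x"
      using hoffmanD(6)[OF g] by auto
    show "\<forall>x. \<not> adj ?k x x"
      using hoffmanD(7)[OF g] inj by (auto dest: inj_onD)
    show "\<forall>f\<in>fat ?k. \<exists>x\<in>slim ?k. adj ?k f x"
    proof
      fix f assume "f \<in> fat ?k"
      then obtain f' where f': "f' \<in> fat g" "f = \<psi> f'"
        by auto
      obtain x where "x \<in> slim g" "adj g f' x"
        using hoffmanD(8)[OF g f'(1)] by blast
      then show "\<exists>x\<in>slim ?k. adj ?k f x"
        using a[of f' x] f' v by (intro bexI[of _ "\<psi> x"]) auto
    qed
    show "\<forall>f\<in>fat ?k. \<forall>g\<in>fat ?k. \<not> adj ?k f g"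
    proof (intro ballI)
      fix e f assume "e \<in> fat ?k" "f \<in> fat ?k"
      then obtain e' f' where "e' \<in> fat g" "e = \<psi> e'" "f' \<in> fat g" "f = \<psi> f'"
        by auto
      then show "\<not> adj ?k e f"
        using a[of e' f'] v hoffmanD(9)[OF g, of e' f'] by auto
    qed
  qed (use hoffmanD(1,2)[OF g] in \<open>auto simp: verts_def\<close>)
  then have "copy \<psi> g ?k"
    using g inj a by (simp add: copy_def)
  then show thesis
    by (rule that)
qed

lemma copyD:
  assumes "copy \<psi> g k"
  shows "hoffman g" "hoffman k" "inj_on \<psi> (verts g)" "slim k = \<psi> ` slim g" "fat k = \<psi> ` fat g"
    "x \<in> verts g \<Longrightarrow> y \<in> verts g \<Longrightarrow> adj k (\<psi> x) (\<psi> y) \<longleftrightarrow> adj g x y"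
  using assms by (auto simp: copy_def)

lemma slim_verts: "slim g \<subseteq> verts g" and fat_verts: "fat g \<subseteq> verts g"
  by (auto simp: verts_def)

lemma copy_Sp:
  assumes c: "copy \<psi> g k" and "x \<in> slim g" "y \<in> slim g"
  shows "Sp k (\<psi> x) (\<psi> y) = Sp g x y"
proof -
  have "inj_on \<psi> (fat g)"
    using copyD(3)[OF c] fat_verts inj_on_subset by metis
  moreover have "adj k (\<psi> a) (\<psi> f) \<longleftrightarrow> adj g a f" if "a \<in> slim g" "f \<in> fat g" for a f
    using copyD(6)[OF c, of a f] that by (simp add: verts_def)
  ultimately have "(\<Sum>f\<in>fat k. adj_matrix k (\<psi> x) f * adj_matrix k (\<psi> y) f) =
      (\<Sum>f\<in>fat g. adj_matrix g x f * adj_matrix g y f)"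
    unfolding copyD(5)[OF c] using assms(2,3) by (simp add: sum.reindex adj_matrix_def)
  then show ?thesis
    using assms copyD(6)[OF c] slim_verts[of g] by (auto simp: Sp_def adj_matrix_def)
qed

lemma copy_shifted:
  assumes c: "copy \<psi> g k" and "x \<in> slim g" "y \<in> slim g"
  shows "shifted \<mu> k (\<psi> x) (\<psi> y) = shifted \<mu> g x y"
  using copy_Sp[OF assms] assms slim_verts[of g] inj_onD[OF copyD(3)[OF c], of x y]
  by (auto simp: shifted_def)

lemma bil_image:
  assumes "inj_on \<psi> S"
  shows "bil (\<psi> ` S) A v w = bil S (\<lambda>x y. A (\<psi> x) (\<psi> y)) (\<lambda>x. v (\<psi> x)) (\<lambda>x. w (\<psi> x))"
  by (simp add: bil_def sum.reindex[OF assms])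

lemma copy_psd:
  assumes c: "copy \<psi> g k" and "S \<subseteq> slim g" "psd S (shifted \<mu> g)"
  shows "psd (\<psi> ` S) (shifted \<mu> k)"
  unfolding psd_def
proof
  fix v
  have inj: "inj_on \<psi> S"
    using copyD(3)[OF c] assms(2) slim_verts inj_on_subset by (metis subset_trans)
  have "bil (\<psi> ` S) (shifted \<mu> k) v v = bil S (shifted \<mu> g) (\<lambda>x. v (\<psi> x)) (\<lambda>x. v (\<psi> x))"
    unfolding bil_image[OF inj] using assms(2) by (intro bil_cong copy_shifted[OF c]) auto
  then show "0 \<le> bil (\<psi> ` S) (shifted \<mu> k) v v"
    using psdD[OF assms(3)] by metis
qed

lemma copy_tree_like:
  assumes c: "copy \<psi> g k" and t: "tree_like g"
  shows "tree_like k"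
proof -
  have vk: "verts k = \<psi> ` verts g"
    using copyD(4,5)[OF c] by (auto simp: verts_def)
  have "(adj k)\<^sup>*\<^sup>* (\<psi> x) (\<psi> y)" if "(adj g)\<^sup>*\<^sup>* x y" for x y
    using that
  proof induction
    case (step y z)
    then have "adj k (\<psi> y) (\<psi> z)"
      using copyD(6)[OF c, of y z] hoffmanD(4,5)[OF copyD(1)[OF c] step(2)] by simp
    then show ?case
      using step.IH by simp
  qed simp
  then have conn: "\<forall>x\<in>verts k. \<forall>y\<in>verts k. (adj k)\<^sup>*\<^sup>* x y"
    using t by (auto simp: vk tree_like_def)
  have "\<not> has_cycle k"
  proof
    assume "has_cycle k"
    then obtain xs where xs: "length xs \<ge> 3" "distinct xs" "successively (adj k) xs" "adj k (last xs) (hd xs)"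
      unfolding has_cycle_def by blast
    let ?i = "inv_into (verts g) \<psi>"
    have a: "adj g (?i x) (?i y)" if "adj k x y" for x y
    proof -
      have "x \<in> \<psi> ` verts g" "y \<in> \<psi> ` verts g"
        using hoffmanD(4,5)[OF copyD(2)[OF c] that] vk by auto
      then show ?thesis
        using copyD(6)[OF c, of "?i x" "?i y"] that by (simp add: inv_into_into f_inv_into_f)
    qed
    have set: "set xs \<subseteq> \<psi> ` verts g"
    proof
      fix x assume "x \<in> set xs"
      then obtain i where i: "i < length xs" "x = xs ! i"
        by (auto simp: in_set_conv_nth)
      have "x \<in> verts k"
      proof (cases "Suc i < length xs")
        case True
        then show ?thesis
          using xs(3) i hoffmanD(4)[OF copyD(2)[OF c]] by (metis successively_nth)
      next
        case False
        then have "i = length xs - 1" "xs \<noteq> []"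
          using i(1) by auto
        then have "x = last xs"
          using i(2) by (simp add: last_conv_nth)
        then show ?thesis
          using xs(4) hoffmanD(4)[OF copyD(2)[OF c]] by metis
      qed
      then show "x \<in> \<psi> ` verts g"
        by (simp add: vk)
    qed
    have "distinct (map ?i xs)"
      using xs(2) inj_on_inv_into[OF set] by (simp add: distinct_map)
    moreover have "successively (adj g) (map ?i xs)"
      using xs(3) a by (auto simp: successively_map elim: successively_mono)
    moreover have "adj g (last (map ?i xs)) (hd (map ?i xs))"
      using xs(1) a[OF xs(4)] by (cases xs) (auto simp: last_map)
    ultimately have "has_cycle g"
      unfolding has_cycle_def using xs(1) by (intro exI[of _ "map ?i xs"]) simp
    then show False
      using t by (simp add: tree_like_def)
  qed
  then show ?thesis
    using t conn copyD(2)[OF c] by (simp add: tree_like_def vk)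
qed

text \<open>Common fat neighbours of two vertices of \<open>V\<close> lie in
  \<open>fat_nbrs h V\<close>, so a summand inherits its special matrix. Conditions on summands thus
  become conditions on blocks of one form.\<close>

lemma induced_part:
  assumes h: "hoffman h" and V: "V \<subseteq> slim h"
  defines "h' \<equiv> induced h (V \<union> fat_nbrs h V)"
  shows "slim h' = V" "sym_on S (Sp h')" "x \<in> V \<Longrightarrow> y \<in> V \<Longrightarrow> Sp h' x y = Sp h x y"
proof -
  have f: "fat_nbrs h V \<subseteq> fat h"
    by (auto simp: fat_nbrs_def)
  show "slim h' = V"
    using V f hoffmanD(3)[OF h] by (auto simp: h'_def induced_def)
  have "adj h' x y \<longleftrightarrow> adj h' y x" for x y
    using hoffmanD(6)[OF h] by (auto simp: h'_def induced_def)
  then show "sym_on S (Sp h')"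
    by (simp add: sym_on_def Sp_def adj_matrix_def mult.commute)
  assume xy: "x \<in> V" "y \<in> V"
  have "fat h' = fat_nbrs h V"
    using f V hoffmanD(3)[OF h] by (auto simp: h'_def induced_def)
  then have "(\<Sum>f\<in>fat h'. adj_matrix h' x f * adj_matrix h' y f) =
      (\<Sum>f\<in>fat_nbrs h V. adj_matrix h x f * adj_matrix h y f)"
    using xy by (intro sum.cong) (auto simp: adj_matrix_def h'_def induced_def)
  also have "\<dots> = (\<Sum>f\<in>fat h. adj_matrix h x f * adj_matrix h y f)"
    using xy f hoffmanD(2)[OF h] by (intro sum.mono_neutral_left) (auto simp: adj_matrix_def fat_nbrs_def)
  finally show "Sp h' x y = Sp h x y"
    using xy by (simp add: Sp_def) (simp add: adj_matrix_def h'_def induced_def)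
qed

lemma induced_part_lambda_min:
  assumes "hoffman h" "V \<subseteq> slim h" "V \<noteq> {}"
  shows "\<mu> \<le> lambda_min (induced h (V \<union> fat_nbrs h V)) \<longleftrightarrow> psd V (shifted \<mu> h)"
proof -
  let ?h' = "induced h (V \<union> fat_nbrs h V)"
  note p = induced_part[OF assms(1,2)]
  have "finite V"
    using hoffmanD(1)[OF assms(1)] assms(2) finite_subset by blast
  then have "\<mu> \<le> lambda_min ?h' \<longleftrightarrow> psd V (shifted \<mu> ?h')"
    using lambda_min_ge_iff_psd[of ?h' \<mu>] p(1,2) assms(3) by simp
  also have "\<dots> \<longleftrightarrow> psd V (shifted \<mu> h)"
  proof -
    have "bil V (shifted \<mu> ?h') v v = bil V (shifted \<mu> h) v v" for v
      by (intro bil_cong) (simp_all add: shifted_def p(3))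
    then show ?thesis
      by (simp add: psd_def)
  qed
  finally show ?thesis .
qed

lemma lambda_min_iff: "hoffman h \<Longrightarrow> slim h \<noteq> {} \<Longrightarrow> \<mu> \<le> lambda_min h \<longleftrightarrow> psd (slim h) (shifted \<mu> h)"
  using lambda_min_ge_iff_psd hoffmanD(1) Sp_sym by (metis sym_on_def)

lemma reducibleI:
  fixes h :: "'a hoffman_graph" and g :: "'b hoffman_graph"
  assumes h: "hoffman h" and g: "hoffman g" and \<phi>: "hoffman_embedding \<phi> h g"
    and V: "V1 \<union> V2 = slim g" "V1 \<inter> V2 = {}" "V1 \<inter> \<phi> ` slim h \<noteq> {}" "V2 \<inter> \<phi> ` slim h \<noteq> {}"
    and Sp: "\<And>x y. x \<in> V1 \<Longrightarrow> y \<in> V2 \<Longrightarrow> Sp g x y = 0"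
    and psd: "psd V1 (shifted \<mu> g)" "psd V2 (shifted \<mu> g)"
  shows "reducible \<mu> h"
proof -
  obtain k :: "nat hoffman_graph" and \<psi> where c: "copy \<psi> g k"
    using exists_nat_copy[OF g] .
  note emb = \<phi>[unfolded hoffman_embedding_iff[OF h g]]
  have \<phi>v: "\<phi> ` verts h \<subseteq> verts g"
    using emb by (auto simp: verts_def)
  have "hoffman_embedding (\<psi> \<circ> \<phi>) h k"
    unfolding hoffman_embedding_iff[OF h copyD(2)[OF c]]
  proof (intro conjI ballI)
    show "inj_on (\<psi> \<circ> \<phi>) (verts h)"
      using emb copyD(3)[OF c] \<phi>v inj_on_subset by (metis comp_inj_on)
    fix x y assume "x \<in> verts h" "y \<in> verts h"
    then show "adj h x y \<longleftrightarrow> adj k ((\<psi> \<circ> \<phi>) x) ((\<psi> \<circ> \<phi>) y)"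
      using emb copyD(6)[OF c, of "\<phi> x" "\<phi> y"] \<phi>v by auto
  qed (use emb copyD(4,5)[OF c] in auto)
  moreover
  have sub: "V1 \<subseteq> slim g" "V2 \<subseteq> slim g" "\<psi> ` V1 \<subseteq> slim k" "\<psi> ` V2 \<subseteq> slim k"
    using V(1) copyD(4)[OF c] by auto
  have inj: "inj_on \<psi> (slim g)"
    using copyD(3)[OF c] slim_verts inj_on_subset by metis
  define h1 where "h1 = induced k (\<psi> ` V1 \<union> fat_nbrs k (\<psi> ` V1))"
  define h2 where "h2 = induced k (\<psi> ` V2 \<union> fat_nbrs k (\<psi> ` V2))"
  have disj: "\<psi> ` V1 \<inter> \<psi> ` V2 = {}"
    using inj_on_image_Int[OF inj sub(1,2)] V(2) by simp
  have cross: "Sp k x y = 0 \<and> Sp k y x = 0" if xy: "x \<in> \<psi> ` V1" "y \<in> \<psi> ` V2" for x y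
  proof -
    obtain x' y' where "x = \<psi> x'" "y = \<psi> y'" "x' \<in> V1" "y' \<in> V2"
      using xy by auto
    then have "Sp k x y = 0"
      using copy_Sp[OF c, of x' y'] sub Sp by auto
    then show ?thesis
      using Sp_sym[OF copyD(2)[OF c]] by metis
  qed
  have ne: "\<psi> ` V1 \<noteq> {}" "\<psi> ` V2 \<noteq> {}"
    using V by auto
  have "direct_sum k h1 h2"
    unfolding direct_sum_def using disj cross V(1) copyD(4)[OF c] ne
    by (intro exI[of _ "\<psi> ` V1"] exI[of _ "\<psi> ` V2"]) (auto simp: h1_def h2_def)
  moreover have "\<mu> \<le> lambda_min h1" "\<mu> \<le> lambda_min h2"
    unfolding h1_def h2_def using induced_part_lambda_min[OF copyD(2)[OF c]] sub ne copy_psd[OF c] psd by auto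
  moreover have "slim h1 \<inter> (\<psi> \<circ> \<phi>) ` slim h \<noteq> {}" "slim h2 \<inter> (\<psi> \<circ> \<phi>) ` slim h \<noteq> {}"
    unfolding h1_def h2_def induced_part(1)[OF copyD(2)[OF c] sub(3)] induced_part(1)[OF copyD(2)[OF c] sub(4)]
    using V(3,4) by auto
  ultimately show ?thesis
    unfolding reducible_def using copyD(2)[OF c] by blast
qed

definition splitting ::
    "real \<Rightarrow> 'a hoffman_graph \<Rightarrow> ('a \<Rightarrow> 'b) \<Rightarrow> 'b hoffman_graph \<Rightarrow> 'b set \<Rightarrow> 'b set \<Rightarrow> bool" where
  "splitting \<mu> h \<phi> g V1 V2 \<longleftrightarrow> hoffman g \<and> hoffman_embedding \<phi> h g \<and> V1 \<union> V2 = slim g \<and>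
     V1 \<inter> V2 = {} \<and> V1 \<inter> \<phi> ` slim h \<noteq> {} \<and> V2 \<inter> \<phi> ` slim h \<noteq> {} \<and>
     (\<forall>x\<in>V1. \<forall>y\<in>V2. Sp g x y = 0) \<and> psd V1 (shifted \<mu> g) \<and> psd V2 (shifted \<mu> g)"

lemma splittingD:
  assumes "splitting \<mu> h \<phi> g V1 V2"
  shows "hoffman g" "hoffman_embedding \<phi> h g" "V1 \<union> V2 = slim g" "V1 \<inter> V2 = {}"
    "V1 \<inter> \<phi> ` slim h \<noteq> {}" "V2 \<inter> \<phi> ` slim h \<noteq> {}"
    "\<And>x y. x \<in> V1 \<Longrightarrow> y \<in> V2 \<Longrightarrow> Sp g x y = 0" "psd V1 (shifted \<mu> g)" "psd V2 (shifted \<mu> g)"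
  using assms by (simp_all add: splitting_def)

lemma reducibleE:
  assumes "reducible \<mu> h"
  obtains g :: "nat hoffman_graph" and \<phi> V1 V2 where "splitting \<mu> h \<phi> g V1 V2"
proof -
  obtain g :: "nat hoffman_graph" and \<phi> h1 h2 where g: "hoffman g" "hoffman_embedding \<phi> h g"
    "direct_sum g h1 h2" "lambda_min h1 \<ge> \<mu>" "lambda_min h2 \<ge> \<mu>"
    "slim h1 \<inter> \<phi> ` slim h \<noteq> {}" "slim h2 \<inter> \<phi> ` slim h \<noteq> {}"
    using assms unfolding reducible_def by blast
  obtain V1 V2 where V: "V1 \<noteq> {}" "V2 \<noteq> {}" "V1 \<inter> V2 = {}" "V1 \<union> V2 = slim g"
    "h1 = induced g (V1 \<union> fat_nbrs g V1)" "h2 = induced g (V2 \<union> fat_nbrs g V2)"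
    "\<forall>x\<in>V1. \<forall>y\<in>V2. Sp g x y = 0 \<and> Sp g y x = 0"
    using g(3) unfolding direct_sum_def by blast
  have sub: "V1 \<subseteq> slim g" "V2 \<subseteq> slim g"
    using V by auto
  have "splitting \<mu> h \<phi> g V1 V2"
    unfolding splitting_def
    using g V induced_part(1)[OF g(1)] sub induced_part_lambda_min[OF g(1)] by auto
  then show thesis
    by (rule that)
qed

text \<open>\<open>None\<close> is a new vertex with neighbourhood \<open>S\<close>, fat if \<open>b\<close> holds and slim otherwise.\<close>

definition add_vertex :: "bool \<Rightarrow> 'a set \<Rightarrow> 'a hoffman_graph \<Rightarrow> 'a option hoffman_graph" where
  "add_vertex b S h =
     \<lparr>slim = Some ` slim h \<union> (if b then {} else {None}),
      fat = Some ` fat h \<union> (if b then {None} else {}),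
      adj = (\<lambda>x y. case x of None \<Rightarrow> (case y of None \<Rightarrow> False | Some y' \<Rightarrow> y' \<in> S)
        | Some x' \<Rightarrow> (case y of None \<Rightarrow> x' \<in> S | Some y' \<Rightarrow> adj h x' y'))\<rparr>"

lemma add_vertex_simps [simp]:
  "slim (add_vertex True S h) = Some ` slim h" "fat (add_vertex True S h) = insert None (Some ` fat h)"
  "slim (add_vertex False S h) = insert None (Some ` slim h)" "fat (add_vertex False S h) = Some ` fat h"
  "adj (add_vertex b S h) (Some x) (Some y) \<longleftrightarrow> adj h x y"
  "adj (add_vertex b S h) None (Some y) \<longleftrightarrow> y \<in> S" "adj (add_vertex b S h) (Some x) None \<longleftrightarrow> x \<in> S"
  "\<not> adj (add_vertex b S h) None None"
  by (auto simp: add_vertex_def)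

lemma verts_add_vertex [simp]: "verts (add_vertex b S h) = insert None (Some ` verts h)"
  by (auto simp: verts_def add_vertex_def)

lemma hoffman_add_vertex:
  assumes h: "hoffman h" and S: "S \<subseteq> slim h" "S \<noteq> {}"
  shows "hoffman (add_vertex b S h)"
proof -
  let ?g = "add_vertex b S h"
  have Sv: "S \<subseteq> verts h"
    using order_trans[OF S(1) slim_verts] .
  have sym: "adj h x y \<Longrightarrow> adj h y x" for x y
    using hoffmanD(6)[OF h] by blast
  show ?thesis
    unfolding hoffman_def
  proof (intro conjI)
    show "finite (slim ?g)" "finite (fat ?g)"
      using hoffmanD(1,2)[OF h] by (cases b; simp)+
    show "slim ?g \<inter> fat ?g = {}"
      using hoffmanD(3)[OF h] by (cases b) auto
    show "\<forall>x y. adj ?g x y \<longrightarrow> x \<in> verts ?g \<and> y \<in> verts ?g"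
      using hoffmanD(4,5)[OF h] Sv by (auto simp: split_option_all)
    show "\<forall>x y. adj ?g x y \<longrightarrow> adj ?g y x"
      using sym by (auto simp: split_option_all)
    show "\<forall>x. \<not> adj ?g x x"
      using hoffmanD(7)[OF h] by (simp add: split_option_all)
    have old: "\<exists>x\<in>slim ?g. adj ?g (Some f) x" if "f \<in> fat h" for f
      using hoffmanD(8)[OF h that] by (cases b) auto
    have new: "\<exists>x\<in>slim ?g. adj ?g None x"
      using S by (cases b) auto
    show "\<forall>f\<in>fat ?g. \<exists>x\<in>slim ?g. adj ?g f x"
    proof
      fix f assume f: "f \<in> fat ?g"
      show "\<exists>x\<in>slim ?g. adj ?g f x"
      proof (cases f)
        case None
        then show ?thesis
          using new by simp
      next
        case (Some f')
        then have "f' \<in> fat h"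
          using f by (cases b) auto
        then show ?thesis
          using old Some by simp
      qed
    qed
    show "\<forall>f\<in>fat ?g. \<forall>e\<in>fat ?g. \<not> adj ?g f e"
      using hoffmanD(3,9)[OF h] S by (cases b) (auto dest: subsetD)
  qed
qed

lemma Sp_add_fat:
  assumes "hoffman h"
  shows "Sp (add_vertex True S h) (Some x) (Some y) = Sp h x y - of_bool (x \<in> S \<and> y \<in> S)"
  using hoffmanD(2)[OF assms]
  by (simp add: Sp_def adj_matrix_def sum.reindex comp_def)

lemma Sp_add_slim: "Sp (add_vertex False S h) (Some x) (Some y) = Sp h x y"
  "Sp (add_vertex False S h) None (Some x) = of_bool (x \<in> S)"
  "Sp (add_vertex False S h) None None = 0" if "S \<subseteq> slim h" "hoffman h"
proof -
  have [simp]: "f \<notin> S" if "f \<in> fat h" for f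
    using that \<open>S \<subseteq> slim h\<close> hoffmanD(3)[OF \<open>hoffman h\<close>] by auto
  show "Sp (add_vertex False S h) (Some x) (Some y) = Sp h x y"
  "Sp (add_vertex False S h) None (Some x) = of_bool (x \<in> S)"
  "Sp (add_vertex False S h) None None = 0"
    by (simp_all add: Sp_def adj_matrix_def sum.reindex comp_def)
qed

lemma embedding_add_vertex:
  assumes "hoffman h" "S \<subseteq> slim h" "S \<noteq> {}"
  shows "hoffman_embedding Some h (add_vertex b S h)"
  unfolding hoffman_embedding_iff[OF assms(1) hoffman_add_vertex[OF assms]]
  by (cases b) auto

text \<open>A new fat vertex subtracts from \<open>Sp\<close> the rank-one matrix of the indicator
  of \<open>S\<close>. Semidefiniteness of the result is therefore exactly the bound in
  \<open>irred\<close>.\<close>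

lemma bil_add_fat:
  assumes h: "hoffman h" and S: "S \<subseteq> slim h"
  shows "bil (slim (add_vertex True S h)) (shifted \<mu> (add_vertex True S h)) v v =
    bil (slim h) (shifted \<mu> h) (\<lambda>x. v (Some x)) (\<lambda>x. v (Some x)) - (\<Sum>x\<in>S. v (Some x))\<^sup>2"
proof -
  let ?u = "\<lambda>x. v (Some x)"
  have f: "finite (slim h)"
    using hoffmanD(1)[OF h] .
  have s: "(\<Sum>x\<in>slim h. if x \<in> S then ?u x else 0) = (\<Sum>x\<in>S. ?u x)"
    using f S by (simp add: sum.If_cases Int_absorb1)
  have 1: "(\<Sum>y\<in>slim h. of_bool (x \<in> S \<and> y \<in> S) * ?u y) = of_bool (x \<in> S) * (\<Sum>y\<in>S. ?u y)" for x
    unfolding s[symmetric] by (auto intro!: sum.cong)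
  have "bil (slim h) (\<lambda>x y. of_bool (x \<in> S \<and> y \<in> S)) ?u ?u = (\<Sum>x\<in>slim h. ?u x * (of_bool (x \<in> S) * (\<Sum>y\<in>S. ?u y)))"
    by (simp only: bil_def 1)
  also have "\<dots> = (\<Sum>x\<in>slim h. if x \<in> S then ?u x else 0) * (\<Sum>y\<in>S. ?u y)"
    unfolding sum_distrib_right by (intro sum.cong) auto
  finally have 2: "bil (slim h) (\<lambda>x y. of_bool (x \<in> S \<and> y \<in> S)) ?u ?u = (\<Sum>x\<in>S. ?u x)\<^sup>2"
    by (simp add: s power2_eq_square)
  have "bil (slim (add_vertex True S h)) (shifted \<mu> (add_vertex True S h)) v v =
      bil (slim h) (\<lambda>x y. shifted \<mu> h x y - of_bool (x \<in> S \<and> y \<in> S)) ?u ?u"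
    unfolding add_vertex_simps bil_image[OF inj_Some[THEN inj_on_subset[OF _ subset_UNIV]]]
    by (intro bil_cong) (auto simp: shifted_def Sp_add_fat[OF h])
  also have "\<dots> = bil (slim h) (shifted \<mu> h) ?u ?u - bil (slim h) (\<lambda>x y. of_bool (x \<in> S \<and> y \<in> S)) ?u ?u"
    by (simp only: bil_def left_diff_distrib right_diff_distrib sum_subtractf)
  finally show ?thesis
    by (simp add: 2)
qed

lemma bil_add_slim:
  assumes h: "hoffman h" and x: "x \<in> slim h"
  shows "bil (slim (add_vertex False {x} h)) (shifted \<mu> (add_vertex False {x} h)) v v =
    bil (slim h) (shifted \<mu> h) (\<lambda>x. v (Some x)) (\<lambda>x. v (Some x)) - \<mu> * (v None)\<^sup>2 + 2 * v None * v (Some x)"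
proof -
  let ?u = "\<lambda>x. v (Some x)" and ?A = "shifted \<mu> (add_vertex False {x} h)"
  have f: "finite (slim h)"
    using hoffmanD(1)[OF h] .
  note Sp = Sp_add_slim[of "{x}" h] h x
  have g: "hoffman (add_vertex False {x} h)"
    using hoffman_add_vertex[OF h] x by simp
  have A: "?A (Some y) (Some z) = shifted \<mu> h y z" "?A None (Some y) = (if y = x then 1 else 0)"
    "?A (Some y) None = (if y = x then 1 else 0)" "?A None None = - \<mu>" for y z
    using Sp Sp_sym[OF g, of "Some y" None] by (auto simp: shifted_def)
  show ?thesis
    using f x by (simp add: bil_def sum.reindex A distrib_left sum.distrib if_distrib if_distribR
        power2_eq_square cong: if_cong)
qed

text \<open>If the entries between \<open>V1\<close> and the rest agreed with the rank-one matrix of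
  \<open>W\<close>, a new fat vertex on \<open>W\<close> would cancel them, \<open>bound\<close>
  would keep the form semidefinite, and the enlarged graph would be a direct sum.\<close>

lemma irreducible_cross:
  assumes h: "irreducible_hoffman \<mu> h" and W: "W \<subseteq> slim h"
    and V1: "V1 \<subseteq> slim h" "V1 \<noteq> {}" "V1 \<noteq> slim h"
    and bound: "\<And>v. (\<Sum>x\<in>W. v x)\<^sup>2 \<le> bil (slim h) (shifted \<mu> h) v v"
  shows "\<exists>x\<in>V1. \<exists>y\<in>slim h - V1. shifted \<mu> h x y \<noteq> of_bool (x \<in> W \<and> y \<in> W)"
proof (rule ccontr)
  assume "\<not> ?thesis"
  then have no: "shifted \<mu> h x y = of_bool (x \<in> W \<and> y \<in> W)" if "x \<in> V1" "y \<in> slim h - V1" for x y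
    using that by blast
  have hh: "hoffman h" "\<not> reducible \<mu> h"
    using h by (auto simp: irreducible_hoffman_def)
  have fin: "finite (slim h)"
    using hoffmanD(1)[OF hh(1)] .
  have "reducible \<mu> h"
  proof (cases "W = {}")
    \<comment> \<open>A fat vertex needs a slim neighbour, so for empty \<open>W\<close> the graph
      itself is split.\<close>
    case True
    have "psd (slim h) (shifted \<mu> h)"
      using bound True by (simp add: psd_def)
    then have "psd V1 (shifted \<mu> h)" "psd (slim h - V1) (shifted \<mu> h)"
      using psd_subset[OF fin] V1(1) by auto
    moreover have "hoffman_embedding id h h"
      unfolding hoffman_embedding_iff[OF hh(1) hh(1)] by simp
    moreover have "Sp h x y = 0" if "x \<in> V1" "y \<in> slim h - V1" for x y
    proof -
      have "x \<noteq> y"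
        using that by auto
      then show ?thesis
        using no[OF that] True by (simp add: shifted_def)
    qed
    ultimately show ?thesis
      using V1 by (intro reducibleI[OF hh(1) hh(1), of id V1 "slim h - V1"]) auto
  next
    case False
    let ?g = "add_vertex True W h"
    have p: "psd (slim ?g) (shifted \<mu> ?g)"
      unfolding psd_def bil_add_fat[OF hh(1) W] using bound by simp
    have "psd (Some ` V1) (shifted \<mu> ?g)" "psd (Some ` (slim h - V1)) (shifted \<mu> ?g)"
      by (rule psd_subset[OF _ _ p]; use fin V1(1) in auto)+
    moreover have "Sp ?g x y = 0" if xy: "x \<in> Some ` V1" "y \<in> Some ` (slim h - V1)" for x y
    proof -
      obtain x' y' where x': "x = Some x'" "y = Some y'" "x' \<in> V1" "y' \<in> slim h - V1"
        using xy by auto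
      then have "x' \<noteq> y'"
        by auto
      then show ?thesis
        using no[OF x'(3,4)] x'(1,2) Sp_add_fat[OF hh(1)] by (simp add: shifted_def)
    qed
    moreover have "Some ` V1 \<inter> Some ` slim h \<noteq> {}" "Some ` (slim h - V1) \<inter> Some ` slim h \<noteq> {}"
      using V1 by blast+
    ultimately show ?thesis
      using V1 by (intro reducibleI[OF hh(1) hoffman_add_vertex[OF hh(1) W False]
          embedding_add_vertex[OF hh(1) W False], of "Some ` V1" "Some ` (slim h - V1)"]) auto
  qed
  then show False
    using hh(2) by simp
qed

text \<open>In a cycle through the new vertex both of its cyclic neighbours would be
  \<open>x\<close>; any other cycle lies in \<open>h\<close>. As cycles are lists,
  \<open>None\<close> may stand first, last or in between.\<close>

lemma tree_like_add_vertex: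
  assumes t: "tree_like h" and x: "x \<in> slim h"
  shows "tree_like (add_vertex b {x} h)"
proof -
  let ?g = "add_vertex b {x} h"
  have h: "hoffman h"
    using t by (simp add: tree_like_def)
  have xv: "x \<in> verts h"
    using x by (simp add: verts_def)
  have g: "hoffman ?g"
    using hoffman_add_vertex[OF h] x by simp
  have lift: "(adj ?g)\<^sup>*\<^sup>* (Some y) (Some z)" if "(adj h)\<^sup>*\<^sup>* y z" for y z
    using that
  proof induction
    case (step y z)
    then show ?case
      by (metis add_vertex_simps(5) rtranclp.rtrancl_into_rtrancl)
  qed simp
  have c: "(adj ?g)\<^sup>*\<^sup>* (Some y) (Some z)" if "y \<in> verts h" "z \<in> verts h" for y z
    using lift t that by (simp add: tree_like_def)
  have "(adj ?g)\<^sup>*\<^sup>* None (Some y)" if "y \<in> verts h" for y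
    using converse_rtranclp_into_rtranclp[of "adj ?g" None "Some x"] c[OF xv that] by simp
  moreover have "(adj ?g)\<^sup>*\<^sup>* (Some y) None" if "y \<in> verts h" for y
    using rtranclp.rtrancl_into_rtrancl[of "adj ?g" "Some y" "Some x" None] c[OF that xv] by simp
  ultimately have conn: "\<forall>y\<in>verts ?g. \<forall>z\<in>verts ?g. (adj ?g)\<^sup>*\<^sup>* y z"
    using c by auto
  have "\<not> has_cycle ?g"
  proof
    assume "has_cycle ?g"
    then obtain xs where xs: "length xs \<ge> 3" "distinct xs" "successively (adj ?g) xs" "adj ?g (last xs) (hd xs)"
      unfolding has_cycle_def by blast
    have only: "y = Some x" if "adj ?g None y \<or> adj ?g y None" for y
      using that by (cases y) auto
    show False
    proof (cases "None \<in> set xs")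
      case True
      then obtain as bs where ab: "xs = as @ None # bs"
        by (meson split_list)
      consider "as \<noteq> []" "bs \<noteq> []" | "as = []" "bs \<noteq> []" | "as \<noteq> []" "bs = []"
        using ab xs(1) by fastforce
      then show False
      proof cases
        case 1
        then have "last as = Some x" "hd bs = Some x"
          using xs(3) only by (auto simp: ab successively_append_iff successively_Cons)
        then show False
          using xs(2) 1 ab by (metis distinct_append distinct.simps(2) disjoint_iff hd_in_set last_in_set set_ConsD list.set_intros(2))
      next
        case 2
        then have "last bs = Some x" "hd bs = Some x"
          using xs(3,4) only by (auto simp: ab successively_Cons)
        then show False
          using xs(1,2) 2 ab by (cases bs) (auto split: if_splits dest: last_in_set)
      next
        case 3
        then have "last as = Some x" "hd as = Some x"
          using xs(3,4) only by (auto simp: ab successively_append_iff)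
        then show False
          using xs(1,2) 3 ab by (cases as) (auto split: if_splits dest: last_in_set)
      qed
    next
      case False
      then have "set xs \<subseteq> range Some"
        by (metis not_Some_eq rangeI subsetI)
      then obtain ys where ys: "xs = map Some ys"
        by (metis ex_map_conv rangeE subset_iff)
      have "successively (adj h) ys" "distinct ys"
        using xs(2,3) by (auto simp: ys successively_map distinct_map)
      moreover have "adj h (last ys) (hd ys)"
        using xs(1,4) by (cases ys) (auto simp: ys last_map)
      ultimately have "has_cycle h"
        unfolding has_cycle_def using xs(1) ys by (intro exI[of _ ys]) auto
      then show False
        using t by (simp add: tree_like_def)
    qed
  qed
  then show ?thesis
    using g conn by (simp add: tree_like_def)
qed

text \<open>The identity Sp = A_s - C C^T as a form: each fat vertex contributes minus a square. The
  map \<open>\<phi>\<close> pulls the form of a larger graph back to \<open>S\<close>, where the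
  squares of both graphs can be compared.\<close>

lemma bil_Sp_squares:
  assumes "finite S"
  shows "bil S (\<lambda>x y. Sp h (\<phi> x) (\<phi> y)) v v =
    bil S (\<lambda>x y. adj_matrix h (\<phi> x) (\<phi> y)) v v - (\<Sum>f\<in>fat h. (\<Sum>x\<in>S. adj_matrix h (\<phi> x) f * v x)\<^sup>2)"
proof -
  let ?a = "\<lambda>x f. adj_matrix h (\<phi> x) f"
  have "bil S (\<lambda>x y. \<Sum>f\<in>fat h. ?a x f * ?a y f) v v = (\<Sum>x\<in>S. \<Sum>y\<in>S. \<Sum>f\<in>fat h. (?a x f * v x) * (?a y f * v y))"
    by (simp add: bil_def sum_distrib_left sum_distrib_right algebra_simps)
  also have "\<dots> = (\<Sum>x\<in>S. \<Sum>f\<in>fat h. \<Sum>y\<in>S. (?a x f * v x) * (?a y f * v y))"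
    by (intro sum.cong refl sum.swap)
  also have "\<dots> = (\<Sum>f\<in>fat h. \<Sum>x\<in>S. \<Sum>y\<in>S. (?a x f * v x) * (?a y f * v y))"
    by (rule sum.swap)
  also have "\<dots> = (\<Sum>f\<in>fat h. (\<Sum>x\<in>S. ?a x f * v x)\<^sup>2)"
    by (simp add: power2_eq_square sum_product)
  finally show ?thesis
    by (simp add: bil_def Sp_def left_diff_distrib right_diff_distrib sum_subtractf)
qed

section \<open>Attaching pendant vertices to a seedling\<close>

lemma hoffman_embedding_comp:
  assumes "hoffman h" "hoffman g" "hoffman k" and \<phi>: "hoffman_embedding \<phi> h g" and \<psi>: "hoffman_embedding \<psi> g k"
  shows "hoffman_embedding (\<psi> \<circ> \<phi>) h k"
proof -
  note e = \<phi>[unfolded hoffman_embedding_iff[OF assms(1,2)]] \<psi>[unfolded hoffman_embedding_iff[OF assms(2,3)]]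
  have v: "\<phi> ` verts h \<subseteq> verts g"
    using e(1) by (auto simp: verts_def)
  have "inj_on (\<psi> \<circ> \<phi>) (verts h)"
    using e v inj_on_subset by (metis comp_inj_on)
  moreover have "adj h x y \<longleftrightarrow> adj k (\<psi> (\<phi> x)) (\<psi> (\<phi> y))" if "x \<in> verts h" "y \<in> verts h" for x y
    using e that v by (simp add: image_subset_iff)
  ultimately show ?thesis
    unfolding hoffman_embedding_iff[OF assms(1,3)] using e by (auto simp: image_subset_iff)
qed

lemma copy_embedding: "copy \<psi> g k \<Longrightarrow> hoffman_embedding \<psi> g k"
  by (subst hoffman_embedding_iff) (auto simp: copy_def)

lemma reducible_copy:
  assumes c: "copy \<psi> g k" and "reducible \<mu> k"
  shows "reducible \<mu> g"
proof -
  obtain e :: "nat hoffman_graph" and \<phi> V1 V2 where "splitting \<mu> k \<phi> e V1 V2"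
    using reducibleE[OF assms(2)] .
  note e = splittingD[OF this]
  have "hoffman_embedding (\<phi> \<circ> \<psi>) g e"
    using hoffman_embedding_comp[OF copyD(1,2)[OF c] e(1) copy_embedding[OF c] e(2)] .
  moreover have "(\<phi> \<circ> \<psi>) ` slim g = \<phi> ` slim k"
    by (simp add: copyD(4)[OF c] image_comp)
  ultimately show ?thesis
    using reducibleI[OF copyD(1)[OF c] e(1) _ e(3,4)] e(5-9) by simp
qed

text \<open>The extension is tree-like with semidefinite form, so its irreducibility would
  contradict the maximality of the seedling.\<close>

lemma seedling_not_extendable:
  assumes s: "seedling \<mu> t" and x: "x \<in> slim t"
    and p: "psd (slim (add_vertex b {x} t)) (shifted (- \<mu>) (add_vertex b {x} t))"
  shows "reducible (- \<mu>) (add_vertex b {x} t)"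
proof (rule ccontr)
  let ?g = "add_vertex b {x} t"
  assume nr: "\<not> reducible (- \<mu>) ?g"
  have t: "tree_like t" "hoffman t" "- \<mu> \<le> -1"
    using s by (auto simp: seedling_def tree_like_def irreducible_hoffman_def)
  have g: "hoffman ?g"
    using hoffman_add_vertex[OF t(2)] x by simp
  obtain k :: "nat hoffman_graph" and \<psi> where c: "copy \<psi> ?g k"
    using exists_nat_copy[OF g] .
  have "slim ?g \<noteq> {}"
    using x by (cases b) auto
  then have "- \<mu> \<le> lambda_min k"
    using lambda_min_iff[OF copyD(2)[OF c]] copyD(4)[OF c] copy_psd[OF c subset_refl p] by auto
  then have "irreducible_hoffman (- \<mu>) k"
    using copyD(2)[OF c] t(3) nr reducible_copy[OF c] by (auto simp: irreducible_hoffman_def)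
  moreover have "tree_like k"
    using copy_tree_like[OF c tree_like_add_vertex[OF t(1) x]] .
  moreover have "hoffman_embedding (\<psi> \<circ> Some) t k"
    using hoffman_embedding_comp[OF t(2) g copyD(2)[OF c] embedding_add_vertex[OF t(2)] copy_embedding[OF c]] x by simp
  moreover have "(\<psi> \<circ> Some) ` verts t \<noteq> verts k"
  proof -
    have "\<psi> None \<in> verts k"
      using copyD(4,5)[OF c] by (cases b) (auto simp: verts_def)
    moreover have "\<psi> None \<notin> (\<psi> \<circ> Some) ` verts t"
      using copyD(3)[OF c] by auto
    ultimately show ?thesis
      by auto
  qed
  ultimately show False
    using s unfolding seedling_def by blast
qed

text \<open>The slim vertices are unchanged, so the same larger graph and the same splitting serve
  for \<open>h\<close>.\<close>

lemma reducible_add_fat: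
  assumes h: "hoffman h" and x: "x \<in> slim h" and r: "reducible \<mu> (add_vertex True {x} h)"
  shows "reducible \<mu> h"
proof -
  let ?g = "add_vertex True {x} h"
  have g: "hoffman ?g"
    using hoffman_add_vertex[OF h] x by simp
  obtain e :: "nat hoffman_graph" and \<phi> V1 V2 where "splitting \<mu> ?g \<phi> e V1 V2"
    using reducibleE[OF r] .
  note e = splittingD[OF this]
  have "hoffman_embedding (\<phi> \<circ> Some) h e"
    using hoffman_embedding_comp[OF h g e(1) embedding_add_vertex[OF h] e(2)] x by simp
  moreover have "(\<phi> \<circ> Some) ` slim h = \<phi> ` slim ?g"
    by (simp add: image_comp)
  ultimately show ?thesis
    using reducibleI[OF h e(1) _ e(3,4)] e(5-9) by simp
qed

text \<open>If a pendant slim vertex at \<open>x\<close> can be split off in some larger graph, then there the pendant vertex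
  and \<open>x\<close> have a common fat neighbour, which is adjacent to no other slim vertex of \<open>h\<close>.\<close>

lemma split_pendant:
  assumes h: "hoffman h" and x: "x \<in> slim h" and e: "hoffman e"
    and \<phi>: "hoffman_embedding \<phi> (add_vertex False {x} h) e"
    and V: "V1 \<subseteq> slim e" "(\<phi> \<circ> Some) ` slim h \<subseteq> V1" "\<phi> None \<in> V2"
    and Sp: "\<And>x y. x \<in> V1 \<Longrightarrow> y \<in> V2 \<Longrightarrow> Sp e x y = 0" and p: "psd V1 (shifted \<mu> e)"
  shows "(v x)\<^sup>2 \<le> bil (slim h) (shifted \<mu> h) v v"
proof -
  let ?g = "add_vertex False {x} h" and ?S = "slim h"
  define \<psi> where "\<psi> = \<phi> \<circ> Some"
  have g: "hoffman ?g"
    using hoffman_add_vertex[OF h] x by simp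
  have fin: "finite ?S"
    using hoffmanD(1)[OF h] .
  have "hoffman_embedding \<psi> h e"
    unfolding \<psi>_def using hoffman_embedding_comp[OF h g e embedding_add_vertex[OF h] \<phi>] x by simp
  note emb = this[unfolded hoffman_embedding_iff[OF h e]]
  note embg = \<phi>[unfolded hoffman_embedding_iff[OF g e]]
  have \<psi>S: "\<psi> ` ?S \<subseteq> V1"
    using V(2) by (simp add: \<psi>_def)
  have adj_None: "adj e (\<psi> y) (\<phi> None) \<longleftrightarrow> y = x" if "y \<in> verts h" for y
    using embg that by (auto simp: \<psi>_def)
  have Sp0: "Sp e (\<psi> y) (\<phi> None) = 0" if "y \<in> ?S" for y
    using Sp[of "\<psi> y" "\<phi> None"] that \<psi>S V(3) by blast
  have fe: "finite (fat e)"
    using hoffmanD(2)[OF e] .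
  \<comment> \<open>Adjacency contributes 1 to an entry that vanishes, so some common fat neighbour
    must cancel it.\<close>
  have "(\<Sum>f\<in>fat e. adj_matrix e (\<psi> x) f * adj_matrix e (\<phi> None) f) \<noteq> 0"
    using Sp0[OF x] adj_None[of x] x slim_verts[of h] by (auto simp: Sp_def adj_matrix_def)
  then obtain f where "f \<in> fat e" "adj_matrix e (\<psi> x) f * adj_matrix e (\<phi> None) f \<noteq> 0"
    by (rule sum.not_neutral_contains_not_neutral)
  then have f: "f \<in> fat e" "adj e (\<psi> x) f" "adj e (\<phi> None) f"
    by (auto simp: adj_matrix_def split: if_splits)
  have only: "\<not> adj e (\<psi> y) f" if "y \<in> ?S" "y \<noteq> x" for y
  proof
    assume "adj e (\<psi> y) f"
    then have "1 \<le> (\<Sum>f\<in>{f}. adj_matrix e (\<psi> y) f * adj_matrix e (\<phi> None) f)"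
      using f by (simp add: adj_matrix_def)
    also have "\<dots> \<le> (\<Sum>f\<in>fat e. adj_matrix e (\<psi> y) f * adj_matrix e (\<phi> None) f)"
      using f fe by (intro sum_mono2) (auto simp: adj_matrix_def)
    finally have "Sp e (\<psi> y) (\<phi> None) \<le> -1"
      using adj_None[of y] that slim_verts[of h] by (auto simp: Sp_def adj_matrix_def)
    then show False
      using Sp0[OF that(1)] by simp
  qed
  have new: "f \<notin> \<psi> ` fat h"
  proof
    assume "f \<in> \<psi> ` fat h"
    then obtain f' where f': "f' \<in> fat h" "f = \<psi> f'"
      by blast
    then have "f' = x"
      using adj_None[of f'] f(3) hoffmanD(6)[OF e, of f "\<phi> None"] fat_verts[of h] by auto
    then show False
      using f'(1) x hoffmanD(3)[OF h] by auto
  qed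
  have a: "adj_matrix e (\<psi> y) (\<psi> z) = adj_matrix h y z" if "y \<in> verts h" "z \<in> verts h" for y z
    using emb that by (simp add: adj_matrix_def)
  let ?q = "\<lambda>f. (\<Sum>y\<in>?S. adj_matrix e (\<psi> y) f * v y)\<^sup>2"
  have "(\<Sum>y\<in>?S. adj_matrix e (\<psi> y) f * v y) = (\<Sum>y\<in>{x}. adj_matrix e (\<psi> y) f * v y)"
    using fin x only by (intro sum.mono_neutral_right) (auto simp: adj_matrix_def)
  then have qf: "?q f = (v x)\<^sup>2"
    using f by (simp add: adj_matrix_def)
  have inj: "inj_on \<psi> (verts h)"
    using emb by blast
  \<comment> \<open>The fat vertices of \<open>h\<close> contribute the same squares in
    \<open>e\<close> as in \<open>h\<close>, and \<open>f\<close> adds the square of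
    \<open>v x\<close>. Semidefiniteness on \<open>V1\<close> then leaves this surplus for the form
    of \<open>h\<close>.\<close>
  have "(\<Sum>f\<in>fat h. (\<Sum>y\<in>?S. adj_matrix h y f * v y)\<^sup>2) + (v x)\<^sup>2 = (\<Sum>f\<in>\<psi> ` fat h. ?q f) + ?q f"
    unfolding qf using inj_on_subset[OF inj fat_verts] a slim_verts[of h] fat_verts[of h]
    by (simp add: sum.reindex subset_iff)
  also have "\<dots> = (\<Sum>f\<in>insert f (\<psi> ` fat h). ?q f)"
    using new hoffmanD(2)[OF h] by simp
  also have "\<dots> \<le> (\<Sum>f\<in>fat e. ?q f)"
    using f(1) emb fe by (intro sum_mono2) auto
  finally have fat: "(\<Sum>f\<in>fat h. (\<Sum>y\<in>?S. adj_matrix h y f * v y)\<^sup>2) + (v x)\<^sup>2 \<le> (\<Sum>f\<in>fat e. ?q f)" .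
  have "bil ?S (\<lambda>x y. adj_matrix e (\<psi> x) (\<psi> y)) v v = bil ?S (adj_matrix h) v v"
    using a slim_verts[of h] by (intro bil_cong) auto
  then have Spe: "bil ?S (\<lambda>x y. Sp e (\<psi> x) (\<psi> y)) v v \<le> bil ?S (Sp h) v v - (v x)\<^sup>2"
    using fat bil_Sp_squares[OF fin, of h "\<lambda>x. x" v] bil_Sp_squares[OF fin, of e \<psi> v] by simp
  have injS: "inj_on \<psi> ?S"
    using inj_on_subset[OF inj slim_verts] .
  have "0 \<le> bil (\<psi> ` ?S) (shifted \<mu> e) (\<lambda>y. v (inv_into ?S \<psi> y)) (\<lambda>y. v (inv_into ?S \<psi> y))"
  proof (rule psdD[OF psd_subset[OF _ \<psi>S p]])
    show "finite V1"
      using V(1) hoffmanD(1)[OF e] finite_subset by blast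
  qed
  also have "\<dots> = bil ?S (\<lambda>y z. Sp e (\<psi> y) (\<psi> z) + (if y = z then - \<mu> else 0)) v v"
    unfolding bil_image[OF injS] using injS by (intro bil_cong) (auto simp: shifted_def dest: inj_onD)
  also have "\<dots> = bil ?S (\<lambda>y z. Sp e (\<psi> y) (\<psi> z)) v v - \<mu> * (\<Sum>y\<in>?S. v y * v y)"
    unfolding bil_shift[OF fin] by simp
  finally show ?thesis
    using Spe bil_shifted[OF fin, of \<mu> h v v] by linarith
qed

text \<open>If the bound held for all \<open>v\<close>, the slim extension would have a semidefinite
  form, hence be reducible. As \<open>t\<close> is irreducible, the splitting separates the new
  vertex from all of \<open>t\<close>. By \<open>split_pendant\<close> the form is then at least
  v_x^2, and the fat extension contradicts maximality.\<close>

lemma seedling_maximal: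
  assumes s: "seedling 3 t" and x: "x \<in> slim t"
  shows "\<exists>v. bil (slim t) (shifted (-3) t) v v < (v x)\<^sup>2 / 3"
proof (rule ccontr)
  assume "\<not> ?thesis"
  then have bound: "(v x)\<^sup>2 / 3 \<le> bil (slim t) (shifted (-3) t) v v" for v
    by (simp add: not_less)
  have t: "hoffman t" "\<not> reducible (-3) t"
    using s by (auto simp: seedling_def irreducible_hoffman_def)
  have fat: "\<not> (\<forall>v. (v x)\<^sup>2 \<le> bil (slim t) (shifted (-3) t) v v)"
  proof
    assume le: "\<forall>v. (v x)\<^sup>2 \<le> bil (slim t) (shifted (-3) t) v v"
    have "0 \<le> bil (slim (add_vertex True {x} t)) (shifted (-3) (add_vertex True {x} t)) v v" for v
      using spec[OF le, of "\<lambda>y. v (Some y)"] x bil_add_fat[OF t(1), of "{x}" "-3" v] by simp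
    then have "psd (slim (add_vertex True {x} t)) (shifted (-3) (add_vertex True {x} t))"
      unfolding psd_def by blast
    then show False
      using seedling_not_extendable[OF s x, of True] reducible_add_fat[OF t(1) x] t(2) by simp
  qed
  let ?g = "add_vertex False {x} t"
  have g: "hoffman ?g"
    using hoffman_add_vertex[OF t(1)] x by simp
  have "0 \<le> bil (slim ?g) (shifted (-3) ?g) v v" for v
  proof -
    have "0 \<le> 3 * (v None + v (Some x) / 3)\<^sup>2"
      by simp
    also have "\<dots> = (v (Some x))\<^sup>2 / 3 + 3 * (v None)\<^sup>2 + 2 * v None * v (Some x)"
      by (simp add: power2_eq_square field_simps)
    finally show ?thesis
      unfolding bil_add_slim[OF t(1) x] using bound[of "\<lambda>y. v (Some y)"] by linarith
  qed
  then have "psd (slim ?g) (shifted (-3) ?g)"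
    unfolding psd_def by blast
  then have r: "reducible (-3) ?g"
    using seedling_not_extendable[OF s x, of False] by simp
  obtain e :: "nat hoffman_graph" and \<phi> V1 V2 where "splitting (-3) ?g \<phi> e V1 V2"
    using reducibleE[OF r] .
  note e = splittingD[OF this]
  note embg = e(2)[unfolded hoffman_embedding_iff[OF g e(1)]]
  have emb: "hoffman_embedding (\<phi> \<circ> Some) t e"
    using hoffman_embedding_comp[OF t(1) g e(1) embedding_add_vertex[OF t(1)] e(2)] x by simp
  have sl: "\<phi> ` slim ?g = insert (\<phi> None) ((\<phi> \<circ> Some) ` slim t)"
    by (simp add: image_comp)
  have slim_sub: "\<phi> ` slim ?g \<subseteq> slim e"
    using embg by blast
  have one: False if V: "V2 \<inter> (\<phi> \<circ> Some) ` slim t = {}" "V2 \<inter> \<phi> ` slim ?g \<noteq> {}" "V1 \<union> V2 = slim e"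
    "\<And>x y. x \<in> V1 \<Longrightarrow> y \<in> V2 \<Longrightarrow> Sp e x y = 0" "psd V1 (shifted (-3) e)" for V1 V2
  proof -
    have 1: "\<phi> None \<in> V2"
      using V(1,2) unfolding sl by auto
    have 2: "(\<phi> \<circ> Some) ` slim t \<subseteq> V1"
      using V(1,3) slim_sub unfolding sl by auto
    have "(v x)\<^sup>2 \<le> bil (slim t) (shifted (-3) t) v v" for v
      by (rule split_pendant[OF t(1) x e(1,2) _ 2 1 V(4,5)]) (use V(3) in auto)
    then show False
      using fat by blast
  qed
  consider "V1 \<inter> (\<phi> \<circ> Some) ` slim t = {}" | "V2 \<inter> (\<phi> \<circ> Some) ` slim t = {}"
    using reducibleI[OF t(1) e(1) emb e(3,4) _ _ e(7) e(8,9)] t(2) by auto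
  then show False
  proof cases
    case 1
    have "V2 \<union> V1 = slim e"
      using e(3) by auto
    moreover have "Sp e x y = 0" if "x \<in> V2" "y \<in> V1" for x y
      using e(7)[OF that(2,1)] Sp_sym[OF e(1), of x y] by simp
    ultimately show False
      using one[OF 1 e(5) _ _ e(9)] by blast
  next
    case 2
    show False
      by (rule one[OF 2 e(6,3,7,8)])
  qed
qed

section \<open>The special graph of a tree-like Hoffman graph\<close>

lemma rtranclp_distinct_path:
  assumes "r\<^sup>*\<^sup>* x y"
  shows "\<exists>xs. xs \<noteq> [] \<and> hd xs = x \<and> last xs = y \<and> distinct xs \<and> successively r xs"
  using assms
proof (induction rule: converse_rtranclp_induct)
  case base
  then show ?case
    by (intro exI[of _ "[y]"]) simp
next
  case (step x z)
  then obtain xs where xs: "xs \<noteq> []" "hd xs = z" "last xs = y" "distinct xs" "successively r xs"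
    by blast
  show ?case
  proof (cases "x \<in> set xs")
    case True
    then obtain as bs where "xs = as @ x # bs"
      by (meson split_list)
    then show ?thesis
      using xs by (intro exI[of _ "x # bs"]) (auto simp: successively_append_iff)
  next
    case False
    then show ?thesis
      using xs step(1) by (intro exI[of _ "x # xs"]) (auto simp: successively_Cons)
  qed
qed

lemma rtranclp_two: "r a b \<Longrightarrow> r b c \<Longrightarrow> r\<^sup>*\<^sup>* a c"
  by (rule rtranclp.rtrancl_into_rtrancl[OF r_into_rtranclp])

lemma rtranclp_three: "r a b \<Longrightarrow> r b c \<Longrightarrow> r c d \<Longrightarrow> r\<^sup>*\<^sup>* a d"
  by (rule rtranclp.rtrancl_into_rtrancl[OF rtranclp_two])

text \<open>A detour, made simple, has at least three vertices because the edge itself is forbidden,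
  and that edge closes it to a cycle. Later arguments by acyclicity only exhibit a detour as a
  reachability statement.\<close>

lemma tree_like_bridge:
  assumes t: "tree_like h" and uv: "adj h u v"
  shows "\<not> (\<lambda>x y. adj h x y \<and> {x, y} \<noteq> {u, v})\<^sup>*\<^sup>* u v"
proof
  let ?r = "\<lambda>x y. adj h x y \<and> {x, y} \<noteq> {u, v}"
  assume "?r\<^sup>*\<^sup>* u v"
  then obtain xs where xs: "xs \<noteq> []" "hd xs = u" "last xs = v" "distinct xs" "successively ?r xs"
    using rtranclp_distinct_path[of ?r u v] by blast
  have h: "hoffman h"
    using t by (simp add: tree_like_def)
  have "u \<noteq> v"
    using hoffmanD(7)[OF h] uv by auto
  obtain zs where zs: "xs = u # zs"
    using xs(1,2) by (cases xs) auto
  then obtain w ws where ws: "xs = u # w # ws"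
    using xs(3) \<open>u \<noteq> v\<close> by (cases zs) auto
  have "ws \<noteq> []"
    using xs(3,5) ws by auto
  then have "3 \<le> length xs"
    using ws by (cases ws) auto
  moreover have "successively (adj h) xs"
    using xs(5) by (rule successively_mono) auto
  moreover have "adj h (last xs) (hd xs)"
    using xs(2,3) uv hoffmanD(6)[OF h, of u v] by simp
  ultimately have "has_cycle h"
    unfolding has_cycle_def using xs(4) by blast
  then show False
    using t by (simp add: tree_like_def)
qed

lemma Sp_card:
  assumes "hoffman h"
  shows "Sp h x y = of_bool (adj h x y) - real (card {f \<in> fat h. adj h x f \<and> adj h y f})"
proof -
  have "(\<Sum>f\<in>fat h. adj_matrix h x f * adj_matrix h y f) = (\<Sum>f\<in>fat h. if adj h x f \<and> adj h y f then 1 else 0)"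
    by (intro sum.cong) (auto simp: adj_matrix_def)
  also have "\<dots> = real (card {f \<in> fat h. adj h x f \<and> adj h y f})"
    using hoffmanD(2)[OF assms] by (simp add: sum.If_cases Int_def)
  finally show ?thesis
    by (simp add: Sp_def adj_matrix_def)
qed

locale hoffman_tree =
  fixes t :: "'a hoffman_graph"
  assumes tree: "tree_like t"
begin

lemma hoffman: "hoffman t"
  using tree by (simp add: tree_like_def)

lemma adj_sym: "adj t x y \<Longrightarrow> adj t y x"
  using hoffmanD(6)[OF hoffman] by blast

lemma slim_not_fat: "x \<in> slim t \<Longrightarrow> f \<in> fat t \<Longrightarrow> x \<noteq> f"
  using hoffmanD(3)[OF hoffman] by auto

lemma no_triangle:
  assumes "x \<in> slim t" "y \<in> slim t" "f \<in> fat t" "adj t x y" "adj t x f" "adj t y f"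
  shows False
proof -
  let ?r = "\<lambda>p q. adj t p q \<and> {p, q} \<noteq> {x, f}"
  have "x \<noteq> y"
    using hoffmanD(7)[OF hoffman] assms(4) by auto
  then have "?r x y" "?r y f"
    using assms slim_not_fat by (auto simp: doubleton_eq_iff)
  then have "?r\<^sup>*\<^sup>* x f"
    by (rule rtranclp_two[of ?r])
  then show False
    using tree_like_bridge[OF tree assms(5)] by blast
qed

lemma common_fat_unique:
  assumes "x \<in> slim t" "y \<in> slim t" "x \<noteq> y" "f \<in> fat t" "adj t x f" "adj t y f"
    "g \<in> fat t" "adj t x g" "adj t y g"
  shows "f = g"
proof (rule ccontr)
  let ?r = "\<lambda>p q. adj t p q \<and> {p, q} \<noteq> {x, f}"
  assume "f \<noteq> g"
  then have "?r x g" "?r g y" "?r y f"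
    using assms slim_not_fat adj_sym by (auto simp: doubleton_eq_iff)
  then have "?r\<^sup>*\<^sup>* x f"
    by (rule rtranclp_three[of ?r])
  then show False
    using tree_like_bridge[OF tree assms(5)] by blast
qed

text \<open>Two slim vertices share at most one fat neighbour (no 4-cycle), and none if they are
  adjacent (no triangle), so nothing cancels within an entry.\<close>

lemma Sp_offdiag:
  assumes "x \<in> slim t" "y \<in> slim t" "x \<noteq> y"
  shows "Sp t x y \<in> {-1, 0, 1}" "Sp t x y = 1 \<longleftrightarrow> adj t x y"
    "Sp t x y = -1 \<longleftrightarrow> (\<exists>f\<in>fat t. adj t x f \<and> adj t y f)"
proof -
  let ?C = "{f \<in> fat t. adj t x f \<and> adj t y f}"
  have fin: "finite ?C"
    using hoffmanD(2)[OF hoffman] by simp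
  have "card ?C \<le> 1"
    using common_fat_unique[OF assms] by (auto intro!: card_le_Suc0_iff_eq[OF fin, THEN iffD2])
  moreover have "card ?C = 0 \<longleftrightarrow> ?C = {}"
    using fin by simp
  moreover have "adj t x y \<Longrightarrow> ?C = {}"
    using no_triangle[OF assms(1,2)] by auto
  ultimately consider "adj t x y" "?C = {}" | "\<not> adj t x y" "?C = {}" | "\<not> adj t x y" "?C \<noteq> {}" "card ?C = 1"
    by linarith
  then have "Sp t x y \<in> {-1, 0, 1} \<and> (Sp t x y = 1 \<longleftrightarrow> adj t x y) \<and> (Sp t x y = -1 \<longleftrightarrow> ?C \<noteq> {})"
  proof cases
    case 1
    then have "Sp t x y = 1"
      by (simp only: Sp_card[OF hoffman] card.empty) simp
    then show ?thesis
      using 1 by simp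
  next
    case 2
    then have "Sp t x y = 0"
      by (simp only: Sp_card[OF hoffman] card.empty) simp
    then show ?thesis
      using 2 by simp
  next
    case 3
    then have "Sp t x y = -1"
      by (simp only: Sp_card[OF hoffman]) simp
    then show ?thesis
      using 3(1,2) by simp
  qed
  then show "Sp t x y \<in> {-1, 0, 1}" "Sp t x y = 1 \<longleftrightarrow> adj t x y"
    "Sp t x y = -1 \<longleftrightarrow> (\<exists>f\<in>fat t. adj t x f \<and> adj t y f)"
    by blast+
qed

lemma Sp_nonzero:
  assumes "x \<in> slim t" "y \<in> slim t" "x \<noteq> y" "Sp t x y \<noteq> 0"
  shows "adj t x y \<or> (\<exists>f\<in>fat t. adj t x f \<and> adj t y f)"
  using Sp_offdiag[OF assms(1-3)] assms(4) by auto

text \<open>If \<open>z\<close> is joined to \<open>y\<close> and \<open>y'\<close>, which are connected without \<open>z\<close>, then acyclicity forces both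
  joins to go through the same fat vertex.\<close>

lemma joined_twice:
  assumes s: "z \<in> slim t" "y \<in> slim t" "y' \<in> slim t" and d: "z \<noteq> y" "z \<noteq> y'" "y \<noteq> y'"
    and path: "(\<lambda>p q. adj t p q \<and> z \<notin> {p, q})\<^sup>*\<^sup>* y' y"
    and j: "Sp t z y \<noteq> 0" "Sp t z y' \<noteq> 0"
  shows "\<exists>f\<in>fat t. adj t z f \<and> adj t y f \<and> adj t y' f"
proof (rule ccontr)
  assume no: "\<not> ?thesis"
  \<comment> \<open>\<open>w\<close> is the first vertex after \<open>z\<close> on the join to
    \<open>y\<close>. Without a fat vertex common to all three, going from \<open>z\<close> to y',
    to \<open>y\<close> and to \<open>w\<close> is a detour around the edge from \<open>z\<close> to
    \<open>w\<close>.\<close>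
  have False if w: "adj t z w" "w = y \<or> w \<in> fat t \<and> adj t y w" for w
  proof -
    let ?r = "\<lambda>p q. adj t p q \<and> {p, q} \<noteq> {z, w}"
    have mono: "?r\<^sup>*\<^sup>* p q" if "(\<lambda>p q. adj t p q \<and> z \<notin> {p, q})\<^sup>*\<^sup>* p q" for p q
      using that by (rule rtranclp_mono[THEN predicate2D, rotated]) auto
    have 1: "?r\<^sup>*\<^sup>* z y'"
      using Sp_nonzero[OF s(1,3) d(2) j(2)]
    proof
      assume a: "adj t z y'"
      have "y' \<noteq> w"
        using w(2) d(3) slim_not_fat[OF s(3)] by auto
      then have "?r z y'"
        using a d by (auto simp: doubleton_eq_iff)
      then show ?thesis
        by (rule r_into_rtranclp)
    next
      assume "\<exists>f\<in>fat t. adj t z f \<and> adj t y' f"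
      then obtain f where f: "f \<in> fat t" "adj t z f" "adj t y' f"
        by blast
      have "f \<noteq> w"
        using w(2) no f slim_not_fat[OF s(2)] by auto
      then have "?r z f" "?r f y'"
        using f adj_sym d slim_not_fat[OF s(1)] by (auto simp: doubleton_eq_iff)
      then show ?thesis
        by (rule rtranclp_two[of ?r])
    qed
    have 2: "?r\<^sup>*\<^sup>* y w"
    proof (cases "w = y")
      case False
      then have "?r y w"
        using w(2) d by (auto simp: doubleton_eq_iff)
      then show ?thesis
        by (rule r_into_rtranclp)
    qed simp
    have "?r\<^sup>*\<^sup>* z w"
      using rtranclp_trans[OF rtranclp_trans[OF 1 mono[OF path]] 2] .
    then show False
      using tree_like_bridge[OF tree w(1)] by blast
  qed
  then show False
    using Sp_nonzero[OF s(1,2) d(1) j(1)] by blast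
qed

text \<open>An edge of the special graph is realised by an edge of \<open>t\<close> or by two edges
  through a fat vertex, and neither meets the slim vertex \<open>z\<close> outside
  \<open>X\<close>.\<close>

lemma conn_in_avoid:
  assumes X: "conn_in (\<lambda>a b. Sp t a b \<noteq> 0) X" "X \<subseteq> slim t" "z \<in> slim t - X" and ab: "a \<in> X" "b \<in> X"
  shows "(\<lambda>p q. adj t p q \<and> z \<notin> {p, q})\<^sup>*\<^sup>* a b"
proof -
  let ?r = "\<lambda>p q. adj t p q \<and> z \<notin> {p, q}"
  have sp_step: "?r\<^sup>*\<^sup>* a b" if "a \<in> X" "b \<in> X" "Sp t a b \<noteq> 0" for a b
  proof (cases "a = b")
    case False
    have "adj t a b \<or> (\<exists>f\<in>fat t. adj t a f \<and> adj t b f)"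
      using Sp_nonzero[of a b] that X(2) False by auto
    then show ?thesis
    proof
      assume "adj t a b"
      then have "?r a b"
        using that X(3) by auto
      then show ?thesis
        by (rule r_into_rtranclp)
    next
      assume "\<exists>f\<in>fat t. adj t a f \<and> adj t b f"
      then obtain f where f: "f \<in> fat t" "adj t a f" "adj t b f"
        by blast
      then have "?r a f" "?r f b"
        using that X(3) adj_sym slim_not_fat[of z f] by auto
      then show ?thesis
        by (rule rtranclp_two[of ?r])
    qed
  qed simp
  have "(\<lambda>a b. a \<in> X \<and> b \<in> X \<and> Sp t a b \<noteq> 0)\<^sup>*\<^sup>* a b"
    using X(1) ab unfolding conn_in_def by blast
  then show ?thesis
  proof induction
    case (step b c)
    from step(2) have "?r\<^sup>*\<^sup>* b c"
      by (elim conjE) (rule sp_step)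
    with step.IH show ?case
      by (rule rtranclp_trans)
  qed simp
qed

end

section \<open>The form of a fat seedling\<close>

locale fat_seedling = hoffman_tree t for t :: "'a hoffman_graph" +
  assumes seedling: "seedling 3 t" and fat: "fat_hoffman t"
begin

abbreviation V :: "'a set" where "V \<equiv> slim t"
abbreviation M :: "'a \<Rightarrow> 'a \<Rightarrow> real" where "M \<equiv> shifted (-3) t"

definition fats :: "'a \<Rightarrow> 'a set" where "fats x = {f \<in> fat t. adj t x f}"

lemma slim_nonempty: "V \<noteq> {}"
proof -
  obtain x where "x \<in> verts t"
    using tree by (auto simp: tree_like_def)
  then show ?thesis
    using hoffmanD(8)[OF hoffman, of x] by (auto simp: verts_def)
qed

lemma finite_slim: "finite V"
  using hoffmanD(1)[OF hoffman] .

lemma irreducible: "irreducible_hoffman (-3) t"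
  using seedling by (simp add: seedling_def)

lemma psd_M: "psd V M"
  using lambda_min_iff[OF hoffman slim_nonempty, of "-3"] irreducible by (simp add: irreducible_hoffman_def)

lemma M_sym: "M x y = M y x"
  using shifted_sym[OF hoffman, of UNIV] by (simp add: sym_on_def)

lemma M_offdiag: "x \<noteq> y \<Longrightarrow> M x y = Sp t x y"
  by (simp add: shifted_def)

lemma M_diag: "x \<in> V \<Longrightarrow> M x x = 3 - real (card (fats x))"
  using hoffmanD(7)[OF hoffman, of x] by (simp add: shifted_def Sp_card[OF hoffman] fats_def)

lemma finite_fats: "finite (fats x)"
  using hoffmanD(2)[OF hoffman] by (simp add: fats_def)

text \<open>Fatness gives at least one fat neighbour; semidefiniteness, tested on a unit vector,
  allows at most three.\<close>

lemma M_diag_cases: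
  assumes "x \<in> V" shows "M x x \<in> {0, 1, 2}"
proof -
  let ?e = "\<lambda>y. if y = x then 1 else (0::real)"
  have "bil V M ?e ?e = (\<Sum>y\<in>V. M x y * ?e y)"
    by (rule bil_unit_left[OF finite_slim assms])
  also have "\<dots> = M x x"
    using finite_slim assms by (simp add: if_distrib cong: if_cong)
  finally have "0 \<le> M x x"
    using psdD[OF psd_M, of ?e] by simp
  moreover have "fats x \<noteq> {}"
    using fat assms by (auto simp: fat_hoffman_def fats_def)
  then have "card (fats x) \<ge> 1"
    using finite_fats by (metis One_nat_def Suc_leI card_gt_0_iff)
  ultimately have "card (fats x) = 1 \<or> card (fats x) = 2 \<or> card (fats x) = 3"
    unfolding M_diag[OF assms] by linarith
  then show ?thesis
    unfolding M_diag[OF assms] by auto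
qed

text \<open>A violation of \<open>attach\<close> would by \<open>joined_twice\<close> yield a fat
  vertex with three slim neighbours. So would one of \<open>one_neg\<close>: diagonal entry 2 means
  a single fat neighbour, through which both negative edges pass.\<close>

lemma special_tree_M:
  assumes two: "\<And>f x y z. f \<in> fat t \<Longrightarrow> x \<in> V \<Longrightarrow> y \<in> V \<Longrightarrow> z \<in> V \<Longrightarrow> distinct [x, y, z] \<Longrightarrow>
    adj t x f \<Longrightarrow> adj t y f \<Longrightarrow> adj t z f \<Longrightarrow> False"
  shows "special_tree V M"
proof
  show "finite V" "V \<noteq> {}" "psd V M" "\<And>x y. M x y = M y x" "\<And>x. x \<in> V \<Longrightarrow> M x x \<in> {0, 1, 2}"
    using finite_slim slim_nonempty psd_M M_sym M_diag_cases by auto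
  show "M x y \<in> {-1, 0, 1}" if "x \<in> V" "y \<in> V" "x \<noteq> y" for x y
    using Sp_offdiag(1)[OF that] M_offdiag[OF that(3)] by simp
  show "y = z" if V: "x \<in> V" "y \<in> V" "z \<in> V" and x: "M x x = 2" and n: "M x y = -1" "M x z = -1" for x y z
  proof (rule ccontr)
    assume yz: "y \<noteq> z"
    have d: "x \<noteq> y" "x \<noteq> z"
      using x n by auto
    obtain f where f: "f \<in> fat t" "adj t x f" "adj t y f"
      using Sp_offdiag(3)[OF V(1,2) d(1)] n(1) M_offdiag[OF d(1)] by auto
    obtain g where g: "g \<in> fat t" "adj t x g" "adj t z g"
      using Sp_offdiag(3)[OF V(1,3) d(2)] n(2) M_offdiag[OF d(2)] by auto
    have "card (fats x) = 1"
      using x M_diag[OF V(1)] by simp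
    then obtain e where "fats x = {e}"
      by (rule card_1_singletonE)
    moreover have "f \<in> fats x" "g \<in> fats x"
      using f g by (auto simp: fats_def)
    ultimately have "f = g"
      by simp
    then show False
      using two[of f x y z] V f g d yz by auto
  qed
  show "\<exists>v. bil V M v v < (v x)\<^sup>2 / 3" if "x \<in> V" for x
    by (rule seedling_maximal[OF seedling that])
  show "\<exists>x\<in>V1. \<exists>y\<in>V - V1. M x y \<noteq> of_bool (x \<in> W \<and> y \<in> W)"
    if "W \<subseteq> V" "V1 \<subseteq> V" "V1 \<noteq> {}" "V1 \<noteq> V" "\<And>v. (\<Sum>x\<in>W. v x)\<^sup>2 \<le> bil V M v v" for W V1
    by (rule irreducible_cross[OF irreducible that])
  show "y = y'" if c: "conn_in (\<lambda>a b. M a b \<noteq> 0) X" and X: "X \<subseteq> V" "z \<in> V - X" "y \<in> X" "y' \<in> X"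
    and n: "M z y \<noteq> 0" "M z y' \<noteq> 0" for X z y y'
  proof (rule ccontr)
    assume yy: "y \<noteq> y'"
    have "conn_in (\<lambda>a b. Sp t a b \<noteq> 0) X"
      unfolding conn_in_def
    proof (intro ballI)
      fix a b assume "a \<in> X" "b \<in> X"
      then have "(\<lambda>a b. a \<in> X \<and> b \<in> X \<and> M a b \<noteq> 0)\<^sup>*\<^sup>* a b"
        using c by (simp add: conn_in_def)
      then show "(\<lambda>a b. a \<in> X \<and> b \<in> X \<and> Sp t a b \<noteq> 0)\<^sup>*\<^sup>* a b"
      proof induction
        case (step b c)
        then show ?case
          by (cases "b = c") (auto simp: M_offdiag intro: rtranclp.rtrancl_into_rtrancl)
      qed simp
    qed
    note path = conn_in_avoid[OF this X(1,2,4,3)]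
    have d: "z \<noteq> y" "z \<noteq> y'"
      using X by auto
    have "\<exists>f\<in>fat t. adj t z f \<and> adj t y f \<and> adj t y' f"
      by (rule joined_twice[OF _ _ _ d yy path]) (use X n d in \<open>auto simp: M_offdiag\<close>)
    then show False
      using two[of _ z y y'] X d yy by auto
  qed
qed

end

section \<open>The exceptional and the affine cases\<close>

context fat_seedling
begin

lemma fat_eq: "fat t = (\<Union>x\<in>V. fats x)"
  using hoffmanD(8)[OF hoffman] adj_sym by (fastforce simp: fats_def)

lemma isomorphic_mk_hoffmanI:
  assumes inj: "inj_on \<phi> (V \<union> fat t)" and im: "\<phi> ` V = S" "\<phi> ` fat t = F"
    and ss: "\<And>x y. x \<in> V \<Longrightarrow> y \<in> V \<Longrightarrow> adj t x y \<longleftrightarrow> (\<phi> x, \<phi> y) \<in> E \<or> (\<phi> y, \<phi> x) \<in> E"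
    and sf: "\<And>x f. x \<in> V \<Longrightarrow> f \<in> fat t \<Longrightarrow> f \<in> fats x \<longleftrightarrow> (\<phi> x, \<phi> f) \<in> E \<or> (\<phi> f, \<phi> x) \<in> E"
    and ff: "\<And>f g. f \<in> fat t \<Longrightarrow> g \<in> fat t \<Longrightarrow> (\<phi> f, \<phi> g) \<notin> E"
  shows "hoffman_isomorphic t (mk_hoffman S F E)"
proof -
  let ?g = "mk_hoffman S F E"
  have adj: "adj t x y \<longleftrightarrow> adj ?g (\<phi> x) (\<phi> y)" if xy: "x \<in> verts t" "y \<in> verts t" for x y
  proof -
    consider "x \<in> V" "y \<in> V" | "x \<in> V" "y \<in> fat t" | "x \<in> fat t" "y \<in> V" | "x \<in> fat t" "y \<in> fat t"
      using xy by (auto simp: verts_def)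
    then show ?thesis
    proof cases
      case 1
      then show ?thesis
        using ss by (simp add: mk_hoffman_def)
    next
      case 2
      then show ?thesis
        using sf[OF 2] by (simp add: mk_hoffman_def fats_def)
    next
      case 3
      then show ?thesis
        using sf[OF 3(2,1)] hoffmanD(6)[OF hoffman, of x y] by (auto simp: mk_hoffman_def fats_def)
    next
      case 4
      then show ?thesis
        using ff hoffmanD(9)[OF hoffman 4] by (simp add: mk_hoffman_def)
    qed
  qed
  have "verts ?g = \<phi> ` verts t"
    using im by (auto simp: verts_def mk_hoffman_def)
  then have "hoffman_iso \<phi> t ?g"
    unfolding hoffman_iso_def using inj im adj by (auto simp: bij_betw_def verts_def mk_hoffman_def)
  then show ?thesis
    by (auto simp: hoffman_isomorphic_def)
qed

lemma card_fats: "x \<in> V \<Longrightarrow> real (card (fats x)) = 3 - M x x"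
  using M_diag by simp

lemma fats_singleton:
  assumes "x \<in> V" "M x x = 2" "f \<in> fats x" shows "fats x = {f}"
proof -
  have "card (fats x) = 1"
    using card_fats[OF assms(1)] assms(2) by simp
  then obtain e where "fats x = {e}"
    by (rule card_1_singletonE)
  then show ?thesis
    using assms(3) by simp
qed

lemma fats_pair:
  assumes "x \<in> V" "M x x = 1" "f \<in> fats x" obtains g where "g \<noteq> f" "fats x = {f, g}"
proof -
  have "card (fats x) = 2"
    using card_fats[OF assms(1)] assms(2) by simp
  then have "card (fats x - {f}) = 1"
    using assms(3) finite_fats by simp
  then obtain g where "fats x - {f} = {g}"
    by (rule card_1_singletonE)
  then show thesis
    using assms(3) by (intro that[of g]) auto
qed

lemma M_neg:
  assumes "x \<in> V" "y \<in> V" "x \<noteq> y" "M x y = -1"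
  obtains f where "f \<in> fats x" "f \<in> fats y" "\<not> adj t x y" "\<not> adj t y x"
    "\<And>g. g \<in> fats x \<Longrightarrow> g \<in> fats y \<Longrightarrow> g = f"
proof -
  have s: "Sp t x y = -1"
    using assms(3,4) by (simp add: M_offdiag)
  then obtain f where f: "f \<in> fats x" "f \<in> fats y"
    using Sp_offdiag(3)[OF assms(1-3)] by (auto simp: fats_def)
  moreover have "\<not> adj t x y"
    using s Sp_offdiag(2)[OF assms(1-3)] by simp
  moreover have "g = f" if "g \<in> fats x" "g \<in> fats y" for g
    using common_fat_unique[OF assms(1-3), of g f] that f by (simp add: fats_def)
  ultimately show thesis
    using that adj_sym by blast
qed

lemma M_pos:
  assumes "x \<in> V" "y \<in> V" "x \<noteq> y" "M x y = 1"
  shows "adj t x y" "adj t y x" "fats x \<inter> fats y = {}"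
proof -
  have "Sp t x y = 1"
    using assms(3,4) by (simp add: M_offdiag)
  then show "adj t x y"
    using Sp_offdiag(2)[OF assms(1-3)] by simp
  then show "adj t y x" "fats x \<inter> fats y = {}"
    using adj_sym no_triangle[OF assms(1,2)] by (auto simp: fats_def)
qed

lemma M_zero:
  assumes "x \<in> V" "y \<in> V" "x \<noteq> y" "M x y = 0"
  shows "\<not> adj t x y" "\<not> adj t y x" "fats x \<inter> fats y = {}"
proof -
  have s: "Sp t x y = 0"
    using assms(3,4) by (simp add: M_offdiag)
  then show "\<not> adj t x y"
    using Sp_offdiag(2)[OF assms(1-3)] by simp
  then show "\<not> adj t y x" "fats x \<inter> fats y = {}"
    using adj_sym s Sp_offdiag(3)[OF assms(1-3)] by (auto simp: fats_def)
qed

lemma not_adj_self: "\<not> adj t x x"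
  using hoffmanD(7)[OF hoffman] .

lemma isomorphic_slim1_fat3:
  assumes "V = {x}" "M x x = 0" shows "hoffman_isomorphic t slim1_fat3"
proof -
  have "card (fats x) = 3"
    using card_fats[of x] assms by simp
  then obtain f1 f2 f3 where f: "fats x = {f1, f2, f3}" "f1 \<noteq> f2" "f1 \<noteq> f3" "f2 \<noteq> f3"
    by (auto simp: card_3_iff)
  have fat: "fat t = {f1, f2, f3}"
    unfolding fat_eq using assms(1) f(1) by simp
  have ne: "x \<noteq> f1" "x \<noteq> f2" "x \<noteq> f3"
    using slim_not_fat[of x] assms(1) fat by auto
  show ?thesis
    unfolding slim1_fat3_def
    by (rule isomorphic_mk_hoffmanI[where \<phi> = "\<lambda>v. if v = x then 0 else if v = f1 then 1 else if v = f2 then 2 else 3"];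
        use f(2-) ne not_adj_self in \<open>auto simp: assms(1) fat f(1)\<close>)
qed

lemma isomorphic_c2:
  assumes d: "x \<noteq> y" and V: "V = {x, y}" and M: "M x x = 1" "M y y = 1" "M x y = -1"
  shows "hoffman_isomorphic t (c_graph 2)"
proof -
  have xy: "x \<in> V" "y \<in> V"
    using V by auto
  obtain f where f: "f \<in> fats x" "f \<in> fats y" "\<not> adj t x y" "\<not> adj t y x"
    "\<And>g. g \<in> fats x \<Longrightarrow> g \<in> fats y \<Longrightarrow> g = f"
    using M_neg[OF xy d M(3)] by blast
  obtain f1 where f1: "f1 \<noteq> f" "fats x = {f, f1}"
    using fats_pair[OF xy(1) M(1) f(1)] .
  obtain f2 where f2: "f2 \<noteq> f" "fats y = {f, f2}"
    using fats_pair[OF xy(2) M(2) f(2)] .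
  have f12: "f1 \<noteq> f2"
    using f(5)[of f1] f1 f2 by auto
  have fat: "fat t = {f, f1, f2}"
    unfolding fat_eq using V f1 f2 by auto
  have ne: "v \<noteq> f" "v \<noteq> f1" "v \<noteq> f2" if "v \<in> {x, y}" for v
    using that V fat by (auto dest: slim_not_fat[rotated])
  have "{1..2} = {1, 2 :: nat}"
    by auto
  then have E: "{(Y i, Y (i + 2)) | i. 1 \<le> i \<and> i + 2 \<le> (2::nat)} = {}" "Y ` {1..2} = {Y 1, Y 2}"
    by auto
  show ?thesis
    unfolding c_graph_def E
    by (rule isomorphic_mk_hoffmanI[where \<phi> = "\<lambda>v. if v = x then Y 1 else if v = y then Y 2 else if v = f then F12
          else if v = f1 then F1 else FM"];
        use d f(3,4) f1(1) f2(1) f12 ne ne[THEN not_sym] not_adj_self in \<open>auto simp: V fat f1(2) f2(2)\<close>)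
qed

text \<open>The sign of \<open>M x z\<close> decides. A negative edge passes through the second fat
  neighbour of \<open>x\<close>, as \<open>y\<close> and \<open>z\<close> share none, and gives the
  path. A positive edge is an adjacency, \<open>z\<close> has a fat neighbour of its own, and the
  graph is \<open>c_graph 3\<close>.\<close>

lemma isomorphic_path_or_c3:
  assumes d: "distinct [x, y, z]" and V: "V = {x, y, z}"
    and M: "M x x = 1" "M y y = 2" "M z z = 2" "M x y = -1" "M x z \<noteq> 0" "M y z = 0"
  shows "hoffman_isomorphic t path_xfygz \<or> hoffman_isomorphic t (c_graph 3)"
proof -
  have xyz: "x \<in> V" "y \<in> V" "z \<in> V" "x \<noteq> y" "x \<noteq> z" "y \<noteq> z"
    using V d by auto
  obtain f where f: "f \<in> fats x" "f \<in> fats y" "\<not> adj t x y" "\<not> adj t y x"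
    using M_neg[OF xyz(1,2,4) M(4)] by blast
  have fy: "fats y = {f}"
    using fats_singleton[OF xyz(2) M(2) f(2)] .
  obtain f1 where f1: "f1 \<noteq> f" "fats x = {f, f1}"
    using fats_pair[OF xyz(1) M(1) f(1)] .
  note yz = M_zero[OF xyz(2,3,6) M(6)]
  have "M x z = -1 \<or> M x z = 1"
    using Sp_offdiag(1)[OF xyz(1,3,5)] M(5) M_offdiag[OF xyz(5)] by auto
  then show ?thesis
  proof
    assume "M x z = -1"
    then obtain g where g: "g \<in> fats x" "g \<in> fats z" "\<not> adj t x z" "\<not> adj t z x"
      using M_neg[OF xyz(1,3,5)] by blast
    have fz: "fats z = {g}"
      using fats_singleton[OF xyz(3) M(3) g(2)] .
    have gf: "g = f1"
      using g yz(3) f1(2) fy fz by auto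
    have fat: "fat t = {f, f1}"
      unfolding fat_eq using V f1 fy fz gf by auto
    have ne: "v \<noteq> f" "v \<noteq> f1" if "v \<in> {x, y, z}" for v
      using that V fat by (auto dest: slim_not_fat[rotated])
    show ?thesis
      unfolding path_xfygz_def
      by (rule disjI1, rule isomorphic_mk_hoffmanI[where \<phi> = "\<lambda>v. if v = y then 0 else if v = f then 1 else if v = x then 2
            else if v = f1 then 3 else 4"];
          use xyz(4-6) xyz(4-6)[THEN not_sym] f(3,4) g(3,4) yz(1,2) f1(1) ne ne[THEN not_sym] not_adj_self in
            \<open>auto simp: V fat f1(2) fy fz gf\<close>)
  next
    assume "M x z = 1"
    note xz = M_pos[OF xyz(1,3,5) this]
    obtain g where g: "g \<in> fats z"
      using fat xyz(3) by (auto simp: fat_hoffman_def fats_def)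
    have fz: "fats z = {g}"
      using fats_singleton[OF xyz(3) M(3) g] .
    have gf: "g \<noteq> f" "g \<noteq> f1"
      using xz(3) f1 fz by auto
    have fat: "fat t = {f, f1, g}"
      unfolding fat_eq using V f1 fy fz by auto
    have ne: "v \<noteq> f" "v \<noteq> f1" "v \<noteq> g" if "v \<in> {x, y, z}" for v
      using that V fat by (auto dest: slim_not_fat[rotated])
    have "{1..3} = {1, 2, 3 :: nat}"
      by auto
    moreover have "1 \<le> i \<and> i + 2 \<le> 3 \<longleftrightarrow> i = 1" for i :: nat
      by auto
    ultimately have E: "{(Y i, Y (i + 2)) | i. 1 \<le> i \<and> i + 2 \<le> (3::nat)} = {(Y 1, Y 3)}" "Y ` {1..3} = {Y 1, Y 2, Y 3}"
      by simp_all
    show ?thesis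
      unfolding c_graph_def E
      by (rule disjI2, rule isomorphic_mk_hoffmanI[where \<phi> = "\<lambda>v. if v = x then Y 1 else if v = y then Y 2 else if v = z then Y 3
            else if v = f then F12 else if v = f1 then F1 else FM"];
          use xyz(4-6) xyz(4-6)[THEN not_sym] f(3,4) xz(1,2) yz(1,2) f1(1) gf ne ne[THEN not_sym] not_adj_self in
            \<open>auto simp: V fat f1(2) fy fz\<close>)
  qed
qed

text \<open>Three slim vertices at a common fat vertex carry the null vector \<open>(1, 1, 1)\<close> of the form.\<close>

lemma isomorphic_fat1_slim3:
  assumes f: "f \<in> fat t" and S: "a \<in> V" "b \<in> V" "c \<in> V" and d: "distinct [a, b, c]"
    and adj: "adj t a f" "adj t b f" "adj t c f"
  shows "hoffman_isomorphic t fat1_slim3"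
proof -
  let ?X = "{a, b, c}"
  have X: "?X \<subseteq> V" and Xf: "p \<in> ?X \<Longrightarrow> adj t p f" for p
    using S adj by auto
  have neg: "M p q = -1" if "p \<in> V" "q \<in> V" "p \<noteq> q" "adj t p f" "adj t q f" for p q
    using Sp_offdiag(3)[OF that(1-3)] f that by (auto simp: M_offdiag)
  have off: "M a b = -1" "M b a = -1" "M a c = -1" "M c a = -1" "M b c = -1" "M c b = -1"
    using neg S adj d by auto
  let ?v = "\<lambda>p. if p \<in> ?X then 1 else (0::real)"
  have "bil V M ?v ?v = bil ?X M ?v ?v"
    by (rule bil_subset[OF finite_slim X]) auto
  also have "\<dots> = M a a + M b b + M c c - 6"
    using d by (simp add: bil_def off)
  finally have v: "bil V M ?v ?v = M a a + M b b + M c c - 6" .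
  \<comment> \<open>The form is at most 6 - 6 at this vector, so nonnegativity forces all three
    diagonal entries to be 2.\<close>
  have "M p p \<le> 2" if "p \<in> ?X" for p
    using M_diag_cases[of p] that X by auto
  then have "M a a \<le> 2" "M b b \<le> 2" "M c c \<le> 2"
    by auto
  moreover have "0 \<le> bil V M ?v ?v"
    using psdD[OF psd_M] .
  ultimately have diag: "M a a = 2" "M b b = 2" "M c c = 2" and null: "bil V M ?v ?v = 0"
    unfolding v by linarith+
  have V: "V = ?X"
  proof (rule ccontr)
    \<comment> \<open>The three entries of an outside vertex \<open>z\<close> sum to 0 by the null
      vector. \<open>z\<close> is not adjacent to \<open>f\<close>, or the sum would be -3; two
      nonzero entries would by \<open>joined_twice\<close> force adjacency to \<open>f\<close>. So
      only the entry at \<open>y\<close> is nonzero, a contradiction.\<close>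
    assume "V \<noteq> ?X"
    then obtain y z where yz: "y \<in> ?X" "z \<in> V - ?X" "M y z \<noteq> 0"
      using irreducible_cross[OF irreducible, of "{}" ?X] X psdD[OF psd_M] by auto
    have "(\<Sum>p\<in>V. M z p * ?v p) = 0"
      using psd_kernel[OF finite_slim shifted_sym[OF hoffman] psd_M null, of z] yz(2) by simp
    moreover have "(\<Sum>p\<in>V. M z p * ?v p) = (\<Sum>p\<in>?X. M z p * ?v p)"
      using finite_slim X by (intro sum.mono_neutral_right) auto
    ultimately have sum: "M z a + M z b + M z c = 0"
      using d by simp
    have zf: "\<not> adj t z f"
    proof
      assume "adj t z f"
      then have "M z p = -1" if "p \<in> ?X" for p
        using neg[of z p] yz(2) that X Xf by auto
      then show False
        using sum by simp
    qed
    have one: "M z q = 0" if q: "q \<in> ?X" "q \<noteq> y" for q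
    proof (rule ccontr)
      assume "M z q \<noteq> 0"
      have d': "z \<noteq> y" "z \<noteq> q"
        using yz q by auto
      have S': "z \<in> V" "y \<in> V" "q \<in> V"
        using yz q X by auto
      have path: "(\<lambda>p q. adj t p q \<and> z \<notin> {p, q})\<^sup>*\<^sup>* q y"
        by (rule rtranclp_two[of "\<lambda>p q. adj t p q \<and> z \<notin> {p, q}" q f])
          (use Xf q(1) yz(1) d' slim_not_fat[OF S'(1) f] adj_sym in auto)
      have "\<exists>g\<in>fat t. adj t z g \<and> adj t y g \<and> adj t q g"
        using joined_twice[OF S' d' q(2)[symmetric] path] \<open>M z q \<noteq> 0\<close> yz(3) d' M_sym[of y z] by (simp add: M_offdiag)
      then obtain g where g: "g \<in> fat t" "adj t z g" "adj t y g" "adj t q g"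
        by blast
      then have "g = f"
        using common_fat_unique[OF S'(2,3) q(2)[symmetric], of g f] f Xf yz(1) q(1) by auto
      then show False
        using g(2) zf by simp
    qed
    have "M z y \<noteq> 0"
      using yz(3) M_sym[of y z] by simp
    then show False
      using sum one[of a] one[of b] one[of c] yz(1) d by auto
  qed
  have fats: "fats p = {f}" if "p \<in> ?X" for p
    using fats_singleton[of p f] that X Xf diag f by (auto simp: fats_def)
  have fat: "fat t = {f}"
    unfolding fat_eq V using fats by auto
  have nadj: "\<not> adj t p q" if "p \<in> ?X" "q \<in> ?X" for p q
    using no_triangle[of p q f] Xf that X f by auto
  have ne: "p \<noteq> f" if "p \<in> ?X" for p
    using slim_not_fat[of p f] that X f by auto
  show ?thesis
    unfolding fat1_slim3_def
    by (rule isomorphic_mk_hoffmanI[where \<phi> = "\<lambda>v. if v = a then 1 else if v = b then 2 else if v = c then 3 else 0"];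
        use d nadj fats ne ne[THEN not_sym] in \<open>auto simp: V fat\<close>)
qed

end

section \<open>Matching with the star-like trees\<close>

definition star_vertices :: "nat list \<Rightarrow> (nat \<times> nat) list" where
  "star_vertices ls = (0, 0) # concat (map (\<lambda>i. map (Pair i) [1..<Suc (ls ! i)]) [0..<length ls])"

lemma set_star_vertices: "set (star_vertices ls) = sverts (star_like_tree s ls)"
  by (auto simp: star_vertices_def star_like_tree_def atLeastLessThanSuc_atLeastAtMost simp del: upt_Suc)

text \<open>An executable form of \<open>star_like_edges\<close>, for the evaluation in
  \<open>star_parents_E\<close>.\<close>

fun star_edge :: "nat list \<Rightarrow> nat \<times> nat \<Rightarrow> nat \<times> nat \<Rightarrow> bool" where
  "star_edge ls (a, b) (c, d) \<longleftrightarrow> (a = 0 \<and> b = 0 \<and> d = 1 \<and> c < length ls \<and> 1 \<le> ls ! c) \<or>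
     (c = a \<and> d = b + 1 \<and> a < length ls \<and> 1 \<le> b \<and> b + 1 \<le> ls ! a)"

lemma star_edge_iff: "(p, q) \<in> star_like_edges ls \<longleftrightarrow> star_edge ls p q"
  by (cases p; cases q) (auto simp: star_like_edges_def)

definition star_parents :: "nat list \<Rightarrow> nat list \<Rightarrow> bool" where
  "star_parents ls ps \<longleftrightarrow> (let ks = star_vertices ls; n = length ps in
     length ks = n \<and> distinct ks \<and> (\<forall>i\<in>set [0..<n]. \<forall>j\<in>set [0..<n].
       (star_edge ls (ks ! i) (ks ! j) \<or> star_edge ls (ks ! j) (ks ! i)) \<longleftrightarrow>
       (j < i \<and> ps ! i = j \<or> i < j \<and> ps ! j = i)))"

lemma star_parents_E:
  "star_parents [2, 2, 2] E6_parents" "star_parents [1, 3, 3] E7_parents" "star_parents [1, 2, 5] E8_parents"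
  by code_simp+

context fat_seedling
begin

text \<open>Switching where \<open>\<sigma>\<close> is -1 makes every edge negative, hence the sign
  -1 of the target. The isomorphism matches the two vertex lists by position.\<close>

lemma switching_equivalent_star:
  assumes xs: "set xs = V" "tree_list M xs ps" and ps: "star_parents ls ps"
    and \<sigma>: "\<And>x. \<sigma> x = 1 \<or> \<sigma> x = (-1 :: real)"
      "\<And>x y. x \<in> V \<Longrightarrow> y \<in> V \<Longrightarrow> x \<noteq> y \<Longrightarrow> M x y = 0 \<or> M x y = - \<sigma> x * \<sigma> y"
  shows "switching_equivalent (special_graph t) (star_like_tree (-1) ls)"
proof -
  define ks where "ks = star_vertices ls"
  define U where "U = {x \<in> V. \<sigma> x = -1}"
  define \<phi> where "\<phi> x = the (map_of (zip xs ks) x)" for x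
  let ?n = "length xs"
  have len: "length ks = ?n" "length ps = ?n" and dist: "distinct xs" "distinct ks"
    and edge: "\<And>i j. i < ?n \<Longrightarrow> j < ?n \<Longrightarrow> (star_edge ls (ks ! i) (ks ! j) \<or> star_edge ls (ks ! j) (ks ! i)) \<longleftrightarrow>
       (j < i \<and> ps ! i = j \<or> i < j \<and> ps ! j = i)"
    using xs(2) ps by (auto simp: tree_list_def star_parents_def Let_def ks_def)
  have \<phi>: "\<phi> (xs ! i) = ks ! i" if "i < ?n" for i
    unfolding \<phi>_def using that dist(1) len(1) by (simp add: map_of_zip_nth)
  have map: "map \<phi> xs = ks"
    using \<phi> len(1) by (intro nth_equalityI) auto
  have "bij_betw \<phi> V (set ks)"
    unfolding bij_betw_def xs(1)[symmetric] using dist map by (metis distinct_map list.set_map)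
  moreover have "sgnf (switch U (special_graph t)) x y = sgnf (star_like_tree (-1) ls) (\<phi> x) (\<phi> y)"
    if "x \<in> V" "y \<in> V" for x y
  proof -
    obtain i j where i: "i < ?n" "x = xs ! i" and j: "j < ?n" "y = xs ! j"
      using \<open>x \<in> V\<close> \<open>y \<in> V\<close> xs(1) by (metis in_set_conv_nth)
    have star: "sgnf (star_like_tree (-1) ls) (\<phi> x) (\<phi> y) = (if j < i \<and> ps ! i = j \<or> i < j \<and> ps ! j = i then -1 else 0)"
      using edge[OF i(1) j(1)] \<phi>[OF i(1)] \<phi>[OF j(1)] i(2) j(2) by (simp add: star_like_tree_def star_edge_iff)
    show ?thesis
    proof (cases "x = y")
      case True
      then have "i = j"
        using i j dist(1) by (simp add: nth_eq_iff_index_eq)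
      then show ?thesis
        unfolding star using True by (simp add: switch_def special_graph_def)
    next
      case False
      then have ij: "i \<noteq> j"
        using i j by auto
      have nz: "M x y \<noteq> 0 \<longleftrightarrow> j < i \<and> ps ! i = j \<or> i < j \<and> ps ! j = i"
        using xs(2) i j ij by (simp add: tree_list_def)
      have "sgnf (switch U (special_graph t)) x y = (if M x y \<noteq> 0 then -1 else 0)"
        using \<sigma>(2)[OF that False] \<sigma>(1)[of x] \<sigma>(1)[of y] that False
        by (auto simp: switch_def special_graph_def M_offdiag U_def)
      then show ?thesis
        unfolding star nz .
    qed
  qed
  ultimately have "signed_isomorphic (switch U (special_graph t)) (star_like_tree (-1) ls)"
    unfolding signed_isomorphic_def ks_def set_star_vertices[of ls "-1"]
    by (intro exI[of _ \<phi>]) (simp add: switch_def special_graph_def)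
  moreover have "U \<subseteq> sverts (special_graph t)"
    by (auto simp: U_def special_graph_def)
  ultimately show ?thesis
    unfolding switching_equivalent_def by blast
qed

end

theorem theorem5p5:
  fixes t :: "'a hoffman_graph"
  assumes "seedling 3 t" and "fat_hoffman t"
  shows
    "(hoffman_isomorphic t slim1_fat3 \<or>
      hoffman_isomorphic t (c_graph 2) \<or>
      hoffman_isomorphic t fat1_slim3 \<or>
      hoffman_isomorphic t path_xfygz \<or>
      hoffman_isomorphic t (c_graph 3))
     \<or>
     ((\<exists>s\<in>{1, -1}.
         switching_equivalent (special_graph t) (E6_tilde s) \<or>
         switching_equivalent (special_graph t) (E7_tilde s) \<or>
         switching_equivalent (special_graph t) (E8_tilde s)) \<and>
      (\<forall>x\<in>slim t. \<forall>y\<in>slim t. \<forall>z\<in>slim t.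
         sgnf (special_graph t) x y = -1 \<and> sgnf (special_graph t) x z = -1 \<longrightarrow> y = z))"
proof -
  interpret fat_seedling t
    by unfold_locales (use assms in \<open>auto simp: seedling_def\<close>)
  show ?thesis
    (is "?iso \<or> ?equiv \<and> ?neg")
  \<comment> \<open>A fat vertex with three slim neighbours makes a triangle in the special graph;
    in its absence \<open>special_tree\<close> applies.\<close>
  proof (cases "\<exists>f\<in>fat t. \<exists>a\<in>V. \<exists>b\<in>V. \<exists>c\<in>V. distinct [a, b, c] \<and> adj t a f \<and> adj t b f \<and> adj t c f")
    case True
    then show ?thesis
      using isomorphic_fat1_slim3 by blast
  next
    case False
    then have two: "False" if "f \<in> fat t" "x \<in> V" "y \<in> V" "z \<in> V" "distinct [x, y, z]"
      "adj t x f" "adj t y f" "adj t z f" for f x y z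
      using that by blast
    interpret special_tree V M
      using two by (rule special_tree_M)
    show ?thesis
    proof (cases rule: classification)
      case (1 x)
      then show ?thesis
        using isomorphic_slim1_fat3 by blast
    next
      case (2 x y)
      then show ?thesis
        using isomorphic_c2 by blast
    next
      case (3 x y z)
      have "hoffman_isomorphic t path_xfygz \<or> hoffman_isomorphic t (c_graph 3)"
        by (rule isomorphic_path_or_c3[OF 3])
      then show ?thesis
        by blast
    next
      case (4 xs)
      obtain \<sigma> where signs: "(\<forall>x. \<sigma> x = 1 \<or> \<sigma> x = (-1::real)) \<and>
          (\<forall>x\<in>V. \<forall>y\<in>V. x \<noteq> y \<longrightarrow> M x y = 0 \<or> M x y = - \<sigma> x * \<sigma> y)"
        using exists_signs by (rule exE)
      have star: "switching_equivalent (special_graph t) (star_like_tree (-1) ls)"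
        if "tree_list M xs ps" "star_parents ls ps" for ls ps
        by (rule switching_equivalent_star[where \<sigma> = \<sigma>, OF 4(2) that]) (use signs in blast)+
      have ?equiv
        using 4(3) star star_parents_E unfolding E6_tilde_def E7_tilde_def E8_tilde_def by blast
      \<comment> \<open>All diagonal entries are 2 here, so \<open>one_neg\<close> applies at every
        vertex.\<close>
      moreover have ?neg
      proof (intro ballI impI)
        fix x y z assume V: "x \<in> V" "y \<in> V" "z \<in> V"
          and neg: "sgnf (special_graph t) x y = -1 \<and> sgnf (special_graph t) x z = -1"
        have "M x p = -1" if "p \<in> V" "sgnf (special_graph t) x p = -1" for p
          using that offdiag[OF V(1) that(1)]
          by (auto simp: special_graph_def M_offdiag split: if_splits)
        then show "y = z"
          using one_neg[OF V 4(1)[OF V(1)]] V neg by blast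
      qed
      ultimately show ?thesis
        by blast
    qed
  qed
qed

end
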